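(* Let $\mathcal{N}$ be a network with Hamiltonians $(H_e)_{e\in\mathcal{E}}$ satisfying (H0)–(H6) and flux limiters $(A_n)_{n\in\mathcal{V}}$ satisfying (A0)–(A2) (all listed in the context), and let $u_0:\mathcal{N}\to\mathbb{R}$ be uniformly continuous. Let $T>0$. Let $u$ be a sub-solution and $w$ a super-solution in $[0,T)\times\mathcal{N}$ of $$u_t+H_{\mathcal N}(t,x,u_x)=0,\qquad u(0,x)=u_0(x)\ \text{ for }x\in\mathcal{N},$$ satisfying, for some $C_T>0$ and some $x_0\in\mathcal{N}$, $$u(t,x)\le C_T(1+d(x_0,x)),\qquad w(t,x)\ge-C_T(1+d(x_0,x))\qquad\text{for all }(t,x)\in[0,T)\times\mathcal{N}.$$ Then $u\le w$ on $[0,T)\times\mathcal{N}$.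
   Context: Network: $\mathcal{E}$ is a finite or countable set of edges. Each $e\in\mathcal{E}$ is isometric either to $[0,+\infty)$, with $\partial e=\{e^0\}$ ($e^0$ identified with $0$), or to a compact interval $[0,l_e]$, with $\partial e=\{e^0,e^1\}$ ($e^0,e^1$ identified with $0,l_e$), and $\inf_{e}l_e>0$. $e^*=e\setminus\partial e$. The set $\mathcal{V}$ of vertices is a partition of the set of all edge endpoints, $\bigcup_{e}\partial e=\bigcup_{n\in\mathcal V}n$, each $n$ containing finitely many endpoints. $\mathcal{N}$ is the quotient of $\bigcup_e e$ obtained by identifying all endpoints belonging to the same $n$; so $\mathcal{N}=(\bigcup_e e^* )\cup\mathcal{V}$. $\mathcal{E}_n=\{e: n\in\partial e\}=\mathcal{E}_n^-\cup\mathcal{E}_n^+$ with $\mathcal{E}_n^-=\{e\in\mathcal E_n:n=e^0\}$, $\mathcal{E}_n^+=\{e\in\mathcal E_n:n=e^1\}$. $d(x,y)$ is the minimal length of a continuous path connecting $x$ and $y$ in $\mathcal{N}$. Gradient: $\partial_eu(x)$ is the derivative at $x\in e$ along the coordinate of $e$; $u_x(x)=\partial_eu(x)$ if $x\in e^*$, $u_x(n)=(\partial_eu(n))_{e\in\mathcal{E}_n}$ for $n\in\mathcal{V}$. A modulus of continuity is a nondecreasing $\omega:[0,+\infty)\to[0,+\infty)$ with $\omega(0+)=0$. Assumptions on $H_e:[0,+\infty)\times e\times\mathbb{R}\to\mathbb{R}$. (H0) $H_e$ is continuous. (H1) For all $T>0$, $H_e(t,x,q)\to+\infty$ as $|q|\to+\infty$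 uniformly in $t\in[0,T]$, $x\in e\in\mathcal{E}$. (H2) For all $T,L>0$ there is $C_{T,L}>0$ with $|H_e(t,x,p)|\le C_{T,L}$ for all $t\in[0,T]$, $|p|\le L$, $x\in e^*$, $e\in\mathcal E$. (H3) For all $T,L>0$ there is a modulus $\omega_{T,L}$ with $|H_e(t,x,p)-H_e(t,x,q)|\le\omega_{T,L}(|p-q|)$ for all $|p|,|q|\le L$, $t\in[0,T]$, $x\in e\in\mathcal E$. (H4) For all $n\in\mathcal V$ and $e\in\mathcal E_n$ there is a (possibly discontinuous) function $t\mapsto p_e^0(t,n)$ such that $H_e(t,n,\cdot)$ is nonincreasing on $(-\infty,p^0_e(t,n)]$ and nondecreasing on $[p^0_e(t,n),+\infty)$. (H5) For all $T>0$ there is a modulus $\bar\omega_T$ with $H_e(t,x,p)-H_e(s,x,p)\le\bar\omega_T\big(|t-s|(1+\max(H_e(s,x,p),0))\big)$ for all $t,s\in[0,T]$, $p\in\mathbb R$, $x\in e\in\mathcal E$. (H6) For all $T>0$ there is a modulus $\bar\omega_T$ with $|A_n^0(t)-A_n^0(s)|\le\bar\omega_T(|t-s|)$ for all $t,s\in[0,T]$, $n\in\mathcal V$, where $A_n^0(t)=\max_{e\in\mathcal E_n}H_e(t,n,p_e^0(t,n))$. Assumptions on $A_n$. (A0) For all $T>0$, $n\in\mathcal V$, $A_n\in C([0,T])$. (A1) For all $T>0$ there is $C_T>0$ with $|A_n(t)|\le C_T$ for all $t\in[0,T]$, $n\in\mathcal V$. (A2) For all $T>0$ there is a modulus $\bar\omega_T$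 with $|A_n(t)-A_n(s)|\le\bar\omega_T(|t-s|)$ for all $t,s\in[0,T]$, $n\in\mathcal V$. Limited flux: $H_e^-(t,n,q)=H_e(t,n,q)$ if $q\le p_e^0(t,n)$ and $=H_e(t,n,p_e^0(t,n))$ otherwise; $H_e^+(t,n,q)=H_e(t,n,p_e^0(t,n))$ if $q\le p_e^0(t,n)$ and $=H_e(t,n,q)$ otherwise. For $p=(p_e)_{e\in\mathcal E_n}$, $$F_A(t,n,p)=\max\Big(A_n(t),\max_{e\in\mathcal E_n^-}H_e^-(t,n,p_e),\max_{e\in\mathcal E_n^+}H_e^+(t,n,p_e)\Big).$$ $H_{\mathcal N}(t,x,p)=H_e(t,x,p)$ if $x\in e^*$ ($p\in\mathbb R$), and $H_{\mathcal N}(t,n,p)=F_A(t,n,p)$ if $n\in\mathcal V$. Solutions: with $\mathcal N_T=(0,T)\times\mathcal N$, test functions are $\varphi\in C(\mathcal N_T)$ whose restriction to $(0,T)\times e$ is $C^1$ for all $e$. A (locally bounded) $u:[0,T)\times\mathcal N\to\mathbb R$ is a sub-solution (resp. super-solution) in $(0,T)\times\mathcal N$ if for every test function $\varphi$ with $u^*\le\varphi$ (resp. $u_*\ge\varphi$) near $(t_0,x_0)\in\mathcal N_T$ with equality at $(t_0,x_0)$, one has $\varphi_t+H_{\mathcal N}(t,x,\varphi_x)\le0$ (resp. $\ge0$) at $(t_0,x_0)$; here $u^*,u_*$ are the upper/lower semi-continuous envelopes. It is a sub-solution (resp. super-solution) in $[0,T)\times\mathcal N$ with initial datum $u_0$ if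 moreover $u^*(0,x)\le u_0(x)$ (resp. $u_*(0,x)\ge u_0(x)$) for all $x\in\mathcal N$. *)

theory Defs
  imports "HOL-Analysis.Analysis"
begin

section \<open>Networks\<close>

text \<open>
  The edge \<open>e\<close> is identified with \<open>[0, len e]\<close>, or with \<open>[0, \<infinity>)\<close> if \<open>len e = \<infinity>\<close>.
  A point of the disjoint union of the edges is a pair \<open>(e, x)\<close>; the endpoints are
  \<open>(e, 0)\<close> and, for bounded edges, \<open>(e, len e)\<close>. A vertex is a set of endpoints.
\<close>

record 'e network =
  edges :: "'e set"
  len :: "'e \<Rightarrow> ereal"
  vertices :: "('e \<times> real) set set"

type_synonym 'e point = "('e \<times> real) set"

definition edge :: "'e network \<Rightarrow> 'e \<Rightarrow> real set" where
  "edge G e = {x. 0 \<le> x \<and> ereal x \<le> len G e}"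

definition edge_interior :: "'e network \<Rightarrow> 'e \<Rightarrow> real set" where
  "edge_interior G e = {x. 0 < x \<and> ereal x < len G e}"

definition edge_points :: "'e network \<Rightarrow> ('e \<times> real) set" where
  "edge_points G = Sigma (edges G) (edge G)"

definition endpoints :: "'e network \<Rightarrow> ('e \<times> real) set" where
  "endpoints G = {(e, x) \<in> edge_points G. x = 0 \<or> ereal x = len G e}"

definition glue_rel :: "'e network \<Rightarrow> (('e \<times> real) \<times> ('e \<times> real)) set" where
  "glue_rel G = {(a, b). a \<in> edge_points G \<and> b \<in> edge_points G \<and>
     (a = b \<or> (\<exists>n \<in> vertices G. a \<in> n \<and> b \<in> n))}"

definition network_points :: "'e network \<Rightarrow> 'e point set" where
  "network_points G = edge_points G // glue_rel G"

definition proj :: "'e network \<Rightarrow> 'e \<times> real \<Rightarrow> 'e point" where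
  "proj G a = glue_rel G `` {a}"

definition edge_topology :: "'e network \<Rightarrow> ('e \<times> real) topology" where
  "edge_topology G = sum_topology (\<lambda>e. top_of_set (edge G e)) (edges G)"

definition network_topology :: "'e network \<Rightarrow> 'e point topology" where
  "network_topology G = topology (\<lambda>U. U \<subseteq> network_points G \<and>
     openin (edge_topology G) {a \<in> edge_points G. proj G a \<in> U})"

text \<open>
  The last conjunct is what is needed for the minimal length of a path joining two points
  to be a (finite) distance.
\<close>

definition is_network :: "'e network \<Rightarrow> bool" where
  "is_network G \<longleftrightarrow>
     countable (edges G) \<and>
     0 < (INF e \<in> edges G. len G e) \<and>
     partition_on (endpoints G) (vertices G) \<and>
     (\<forall>n \<in> vertices G. finite n) \<and>
     path_connected_space (network_topology G)"

text \<open>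
  Total variation of a path \<open>\<gamma>\<close>, parametrised by \<open>[0,1]\<close>, measured in the coordinates of the
  edges. Only time intervals during which \<open>\<gamma>\<close> stays in the interior of one edge (where the
  coordinate is unambiguous) are tested; the times at which \<open>\<gamma>\<close> sits at a vertex contribute
  no length, and every excursion of \<open>\<gamma>\<close> into an open edge is exhausted by such intervals.
\<close>

definition edge_coord :: "'e point \<Rightarrow> real" where
  "edge_coord z = snd (the_elem z)"

definition path_length :: "'e network \<Rightarrow> (real \<Rightarrow> 'e point) \<Rightarrow> ereal" where
  "path_length G \<gamma> =
     (SUP \<D> \<in> {\<D>. \<D> division_of (\<Union>\<D>) \<and> \<Union>\<D> \<subseteq> {0..1} \<and>
                   (\<forall>K \<in> \<D>. \<exists>e \<in> edges G. \<gamma> ` K \<subseteq> (\<lambda>x. proj G (e, x)) ` edge_interior G e)}.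
        ereal (\<Sum>K \<in> \<D>. \<bar>edge_coord (\<gamma> (Sup K)) - edge_coord (\<gamma> (Inf K))\<bar>))"

definition network_dist :: "'e network \<Rightarrow> 'e point \<Rightarrow> 'e point \<Rightarrow> real" where
  "network_dist G x y = real_of_ereal
     (INF \<gamma> \<in> {\<gamma>. pathin (network_topology G) \<gamma> \<and> \<gamma> 0 = x \<and> \<gamma> 1 = y}. path_length G \<gamma>)"

definition uniformly_continuous_on_network :: "'e network \<Rightarrow> ('e point \<Rightarrow> real) \<Rightarrow> bool" where
  "uniformly_continuous_on_network G v \<longleftrightarrow>
     (\<forall>\<epsilon>>0. \<exists>\<delta>>0. \<forall>x \<in> network_points G. \<forall>y \<in> network_points G.
        network_dist G x y < \<delta> \<longrightarrow> \<bar>v x - v y\<bar> < \<epsilon>)"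

text \<open>The incident edges for which \<open>n\<close> is the initial (\<open>e\<^sup>0\<close>) resp. terminal (\<open>e\<^sup>1\<close>)
  vertex. A loop belongs to both.\<close>

definition edges_minus :: "'e network \<Rightarrow> 'e point \<Rightarrow> 'e set" where
  "edges_minus G n = {e \<in> edges G. (e, 0) \<in> n}"

definition edges_plus :: "'e network \<Rightarrow> 'e point \<Rightarrow> 'e set" where
  "edges_plus G n = {e \<in> edges G. len G e \<noteq> \<infinity> \<and> (e, real_of_ereal (len G e)) \<in> n}"

lemma proj_endpoint:
  assumes P: "partition_on (endpoints G) (vertices G)" and n: "n \<in> vertices G" "a \<in> n"
  shows "proj G a = n"
proof -
  have "n \<subseteq> endpoints G"
    using P n(1) unfolding partition_on_def by blast
  then have sub: "n \<subseteq> edge_points G"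
    unfolding endpoints_def by blast
  have uniq: "m = n" if "m \<in> vertices G" "a \<in> m" for m
    using P n that unfolding partition_on_def disjoint_def by blast
  show ?thesis
    unfolding proj_def glue_rel_def using sub uniq n by blast
qed

lemma proj_interior:
  assumes P: "partition_on (endpoints G) (vertices G)"
    and e: "e \<in> edges G" "x \<in> edge_interior G e"
  shows "proj G (e, x) = {(e, x)}"
proof -
  have "(e, x) \<in> edge_points G"
    using e by (auto simp: edge_points_def edge_def edge_interior_def)
  moreover have "(e, x) \<notin> endpoints G"
    using e by (auto simp: endpoints_def edge_interior_def)
  then have "(e, x) \<notin> n" if "n \<in> vertices G" for n
    using P that unfolding partition_on_def by blast
  ultimately show ?thesis
    unfolding proj_def glue_rel_def by blast
qed

lemma network_points_conv_proj: "network_points G = proj G ` edge_points G"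
  unfolding network_points_def quotient_def proj_def by blast

lemma network_points_eq:
  assumes P: "partition_on (endpoints G) (vertices G)"
  shows "network_points G =
    vertices G \<union> {{(e, x)} | e x. e \<in> edges G \<and> x \<in> edge_interior G e}"
proof -
  have split: "edge_points G = endpoints G \<union> Sigma (edges G) (edge_interior G)"
    by (fastforce simp: edge_points_def endpoints_def edge_def edge_interior_def)
  have "proj G ` endpoints G = vertices G"
  proof
    show "proj G ` endpoints G \<subseteq> vertices G"
    proof
      fix z assume "z \<in> proj G ` endpoints G"
      then obtain a where a: "a \<in> endpoints G" "z = proj G a" by blast
      then obtain n where "n \<in> vertices G" "a \<in> n"
        using P unfolding partition_on_def by blast
      then show "z \<in> vertices G" using proj_endpoint[OF P] a by metis
    qed
    show "vertices G \<subseteq> proj G ` endpoints G"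
    proof
      fix n assume n: "n \<in> vertices G"
      then have "n \<noteq> {}" using P by (auto simp: partition_on_def)
      then obtain a where a: "a \<in> n" by blast
      have "a \<in> endpoints G" using a n P unfolding partition_on_def by blast
      then show "n \<in> proj G ` endpoints G"
        using proj_endpoint[OF P n a] by blast
    qed
  qed
  moreover have "proj G ` Sigma (edges G) (edge_interior G)
      = {{(e, x)} | e x. e \<in> edges G \<and> x \<in> edge_interior G e}"
    (is "?L = ?R")
  proof
    show "?L \<subseteq> ?R" using proj_interior[OF P] by fast
    show "?R \<subseteq> ?L"
    proof
      fix z assume "z \<in> ?R"
      then obtain e x where ex: "z = {(e, x)}" "e \<in> edges G" "x \<in> edge_interior G e" by blast
      then have "z = proj G (e, x)" using proj_interior[OF P] by simp
      then show "z \<in> ?L" using ex by blast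
    qed
  qed
  ultimately show ?thesis by (simp only: network_points_conv_proj split image_Un)
qed

lemma istopology_network:
  "istopology (\<lambda>U. U \<subseteq> network_points G \<and>
     openin (edge_topology G) {a \<in> edge_points G. proj G a \<in> U})"
proof -
  have 1: "{a \<in> edge_points G. proj G a \<in> S \<inter> T} =
     {a \<in> edge_points G. proj G a \<in> S} \<inter> {a \<in> edge_points G. proj G a \<in> T}" for S T by auto
  have 2: "{a \<in> edge_points G. proj G a \<in> \<Union>\<K>} =
     (\<Union>K\<in>\<K>. {a \<in> edge_points G. proj G a \<in> K})" for \<K> by auto
  show ?thesis
    unfolding istopology_def
  proof (intro conjI allI impI)
    fix \<K> assume K: "\<forall>K\<in>\<K>. K \<subseteq> network_points G \<and>
      openin (edge_topology G) {a \<in> edge_points G. proj G a \<in> K}"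
    show "\<Union>\<K> \<subseteq> network_points G" using K by blast
    show "openin (edge_topology G) {a \<in> edge_points G. proj G a \<in> \<Union>\<K>}"
      unfolding 2 using K by blast
  next
    fix S T assume ST: "S \<subseteq> network_points G \<and>
        openin (edge_topology G) {a \<in> edge_points G. proj G a \<in> S}"
      "T \<subseteq> network_points G \<and>
        openin (edge_topology G) {a \<in> edge_points G. proj G a \<in> T}"
    show "S \<inter> T \<subseteq> network_points G" using ST by blast
    show "openin (edge_topology G) {a \<in> edge_points G. proj G a \<in> S \<inter> T}"
      unfolding 1 using ST by (intro openin_Int) blast+
  qed
qed

lemma topspace_edge_topology: "topspace (edge_topology G) = edge_points G"
  by (auto simp: edge_topology_def edge_points_def)

lemma openin_network_topology:
  "openin (network_topology G) U \<longleftrightarrow> U \<subseteq> network_points G \<and>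
     openin (edge_topology G) {a \<in> edge_points G. proj G a \<in> U}"
  by (simp add: network_topology_def istopology_network)

lemma topspace_network_topology: "topspace (network_topology G) = network_points G"
proof -
  have "{a \<in> edge_points G. proj G a \<in> network_points G} = topspace (edge_topology G)"
    unfolding topspace_edge_topology network_points_conv_proj by blast
  then have "openin (network_topology G) (network_points G)"
    by (simp add: openin_network_topology)
  then show ?thesis
    by (metis openin_network_topology openin_subset openin_topspace subset_antisym)
qed

lemma quotient_map_proj: "quotient_map (edge_topology G) (network_topology G) (proj G)"
  unfolding quotient_map_def topspace_edge_topology topspace_network_topology
    openin_network_topology network_points_conv_proj by blast


section \<open>Assumptions on the Hamiltonians and the flux limiters\<close>

definition modulus :: "(real \<Rightarrow> real) \<Rightarrow> bool" where
  "modulus \<omega> \<longleftrightarrow> (\<forall>r\<ge>0. 0 \<le> \<omega> r) \<and> mono_on {0..} \<omega> \<and> (\<omega> \<longlongrightarrow> 0) (at_right 0)"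

text \<open>
  \<open>H e t x p\<close> is the Hamiltonian of the edge \<open>e\<close> at time \<open>t\<close> and coordinate \<open>x\<close>. A vertex \<open>n\<close>,
  seen from an incident edge \<open>e\<close>, is an endpoint \<open>(e, x) \<in> n\<close>, so that \<open>H\<^sub>e(t,n,p)\<close> and
  \<open>p\<^sub>e\<^sup>0(t,n)\<close> are \<open>H e t x p\<close> and \<open>p0 e t x\<close>; indexing by endpoints also covers loops.
\<close>

type_synonym 'e hamiltonian = "'e \<Rightarrow> real \<Rightarrow> real \<Rightarrow> real \<Rightarrow> real"

definition H0 :: "'e network \<Rightarrow> 'e hamiltonian \<Rightarrow> bool" where
  "H0 G H \<longleftrightarrow> (\<forall>e \<in> edges G.
     continuous_on ({0..} \<times> edge G e \<times> UNIV) (\<lambda>(t, x, q). H e t x q))"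

definition H1 :: "'e network \<Rightarrow> 'e hamiltonian \<Rightarrow> bool" where
  "H1 G H \<longleftrightarrow> (\<forall>T>0. \<forall>M. \<exists>R. \<forall>e \<in> edges G. \<forall>x \<in> edge G e. \<forall>t \<in> {0..T}. \<forall>q.
     \<bar>q\<bar> \<ge> R \<longrightarrow> H e t x q \<ge> M)"

definition H2 :: "'e network \<Rightarrow> 'e hamiltonian \<Rightarrow> bool" where
  "H2 G H \<longleftrightarrow> (\<forall>T>0. \<forall>L>0. \<exists>C>0. \<forall>e \<in> edges G. \<forall>x \<in> edge_interior G e. \<forall>t \<in> {0..T}. \<forall>p.
     \<bar>p\<bar> \<le> L \<longrightarrow> \<bar>H e t x p\<bar> \<le> C)"

definition H3 :: "'e network \<Rightarrow> 'e hamiltonian \<Rightarrow> bool" where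
  "H3 G H \<longleftrightarrow> (\<forall>T>0. \<forall>L>0. \<exists>\<omega>. modulus \<omega> \<and>
     (\<forall>e \<in> edges G. \<forall>x \<in> edge G e. \<forall>t \<in> {0..T}. \<forall>p q.
        \<bar>p\<bar> \<le> L \<longrightarrow> \<bar>q\<bar> \<le> L \<longrightarrow> \<bar>H e t x p - H e t x q\<bar> \<le> \<omega> \<bar>p - q\<bar>))"

definition H4 :: "'e network \<Rightarrow> 'e hamiltonian \<Rightarrow> ('e \<Rightarrow> real \<Rightarrow> real \<Rightarrow> real) \<Rightarrow> bool" where
  "H4 G H p0 \<longleftrightarrow> (\<forall>n \<in> vertices G. \<forall>(e, x) \<in> n. \<forall>t\<ge>0.
     antimono_on {..p0 e t x} (H e t x) \<and> mono_on {p0 e t x..} (H e t x))"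

definition H5 :: "'e network \<Rightarrow> 'e hamiltonian \<Rightarrow> bool" where
  "H5 G H \<longleftrightarrow> (\<forall>T>0. \<exists>\<omega>. modulus \<omega> \<and>
     (\<forall>e \<in> edges G. \<forall>x \<in> edge G e. \<forall>t \<in> {0..T}. \<forall>s \<in> {0..T}. \<forall>p.
        H e t x p - H e s x p \<le> \<omega> (\<bar>t - s\<bar> * (1 + max (H e s x p) 0))))"

definition min_limiter ::
  "'e hamiltonian \<Rightarrow> ('e \<Rightarrow> real \<Rightarrow> real \<Rightarrow> real) \<Rightarrow> 'e point \<Rightarrow> real \<Rightarrow> real" where
  "min_limiter H p0 n t = Max ((\<lambda>(e, x). H e t x (p0 e t x)) ` n)"

definition H6 :: "'e network \<Rightarrow> 'e hamiltonian \<Rightarrow> ('e \<Rightarrow> real \<Rightarrow> real \<Rightarrow> real) \<Rightarrow> bool" where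
  "H6 G H p0 \<longleftrightarrow> (\<forall>T>0. \<exists>\<omega>. modulus \<omega> \<and>
     (\<forall>n \<in> vertices G. \<forall>t \<in> {0..T}. \<forall>s \<in> {0..T}.
        \<bar>min_limiter H p0 n t - min_limiter H p0 n s\<bar> \<le> \<omega> \<bar>t - s\<bar>))"

definition A0 :: "'e network \<Rightarrow> ('e point \<Rightarrow> real \<Rightarrow> real) \<Rightarrow> bool" where
  "A0 G A \<longleftrightarrow> (\<forall>T>0. \<forall>n \<in> vertices G. continuous_on {0..T} (A n))"

definition A1 :: "'e network \<Rightarrow> ('e point \<Rightarrow> real \<Rightarrow> real) \<Rightarrow> bool" where
  "A1 G A \<longleftrightarrow> (\<forall>T>0. \<exists>C>0. \<forall>n \<in> vertices G. \<forall>t \<in> {0..T}. \<bar>A n t\<bar> \<le> C)"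

definition A2 :: "'e network \<Rightarrow> ('e point \<Rightarrow> real \<Rightarrow> real) \<Rightarrow> bool" where
  "A2 G A \<longleftrightarrow> (\<forall>T>0. \<exists>\<omega>. modulus \<omega> \<and>
     (\<forall>n \<in> vertices G. \<forall>t \<in> {0..T}. \<forall>s \<in> {0..T}. \<bar>A n t - A n s\<bar> \<le> \<omega> \<bar>t - s\<bar>))"


section \<open>The equation\<close>

definition H_minus ::
  "'e hamiltonian \<Rightarrow> ('e \<Rightarrow> real \<Rightarrow> real \<Rightarrow> real) \<Rightarrow> 'e hamiltonian" where
  "H_minus H p0 e t x q = (if q \<le> p0 e t x then H e t x q else H e t x (p0 e t x))"

definition H_plus ::
  "'e hamiltonian \<Rightarrow> ('e \<Rightarrow> real \<Rightarrow> real \<Rightarrow> real) \<Rightarrow> 'e hamiltonian" where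
  "H_plus H p0 e t x q = (if q \<le> p0 e t x then H e t x (p0 e t x) else H e t x q)"

text \<open>
  Gradients at a point \<open>z\<close> of the network are families indexed by the representatives
  \<open>(e, x) \<in> z\<close>: a single number in the interior of an edge, one number per incident edge end
  at a vertex.
\<close>

definition flux ::
  "'e network \<Rightarrow> 'e hamiltonian \<Rightarrow> ('e \<Rightarrow> real \<Rightarrow> real \<Rightarrow> real) \<Rightarrow> ('e point \<Rightarrow> real \<Rightarrow> real)
   \<Rightarrow> real \<Rightarrow> 'e point \<Rightarrow> ('e \<times> real \<Rightarrow> real) \<Rightarrow> real" where
  "flux G H p0 A t n p = Max (insert (A n t)
     ((\<lambda>e. H_minus H p0 e t 0 (p (e, 0))) ` edges_minus G n \<union>
      (\<lambda>e. let l = real_of_ereal (len G e) in H_plus H p0 e t l (p (e, l))) ` edges_plus G n))"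

definition network_hamiltonian ::
  "'e network \<Rightarrow> 'e hamiltonian \<Rightarrow> ('e \<Rightarrow> real \<Rightarrow> real \<Rightarrow> real) \<Rightarrow> ('e point \<Rightarrow> real \<Rightarrow> real)
   \<Rightarrow> real \<Rightarrow> 'e point \<Rightarrow> ('e \<times> real \<Rightarrow> real) \<Rightarrow> real" where
  "network_hamiltonian G H p0 A t z p =
     (if z \<in> vertices G then flux G H p0 A t z p
      else case the_elem z of (e, x) \<Rightarrow> H e t x (p (e, x)))"

text \<open>Derivative along the edge coordinate, one-sided at endpoints.\<close>

definition edge_gradient :: "'e network \<Rightarrow> ('e point \<Rightarrow> real) \<Rightarrow> 'e \<times> real \<Rightarrow> real" where
  "edge_gradient G v = (\<lambda>(e, x).
     vector_derivative (\<lambda>y. v (proj G (e, y))) (at x within edge G e))"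

definition C1_on :: "(real \<times> real) set \<Rightarrow> (real \<times> real \<Rightarrow> real) \<Rightarrow> bool" where
  "C1_on S f \<longleftrightarrow> (\<exists>a b. continuous_on S a \<and> continuous_on S b \<and>
     (\<forall>z \<in> S. (f has_derivative (\<lambda>(h, k). a z * h + b z * k)) (at z within S)))"

definition open_cylinder :: "'e network \<Rightarrow> real \<Rightarrow> (real \<times> 'e point) topology" where
  "open_cylinder G T = prod_topology (top_of_set {0<..<T}) (network_topology G)"

definition cylinder :: "'e network \<Rightarrow> real \<Rightarrow> (real \<times> 'e point) topology" where
  "cylinder G T = prod_topology (top_of_set {0..<T}) (network_topology G)"

definition test_function :: "'e network \<Rightarrow> real \<Rightarrow> (real \<Rightarrow> 'e point \<Rightarrow> real) \<Rightarrow> bool" where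
  "test_function G T \<phi> \<longleftrightarrow>
     continuous_map (open_cylinder G T) euclideanreal (\<lambda>(t, z). \<phi> t z) \<and>
     (\<forall>e \<in> edges G. C1_on ({0<..<T} \<times> edge G e) (\<lambda>(t, x). \<phi> t (proj G (e, x))))"

text \<open>\<^const>\<open>nhdsin\<close> is not punctured, so the value at the point itself enters the envelopes.\<close>

definition usc_env ::
  "'e network \<Rightarrow> real \<Rightarrow> (real \<Rightarrow> 'e point \<Rightarrow> real) \<Rightarrow> real \<Rightarrow> 'e point \<Rightarrow> ereal" where
  "usc_env G T u t z = Limsup (nhdsin (cylinder G T) (t, z)) (\<lambda>(s, y). ereal (u s y))"

definition lsc_env ::
  "'e network \<Rightarrow> real \<Rightarrow> (real \<Rightarrow> 'e point \<Rightarrow> real) \<Rightarrow> real \<Rightarrow> 'e point \<Rightarrow> ereal" where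
  "lsc_env G T u t z = Liminf (nhdsin (cylinder G T) (t, z)) (\<lambda>(s, y). ereal (u s y))"

definition locally_bounded :: "'e network \<Rightarrow> real \<Rightarrow> (real \<Rightarrow> 'e point \<Rightarrow> real) \<Rightarrow> bool" where
  "locally_bounded G T u \<longleftrightarrow>
     (\<forall>t \<in> {0..<T}. \<forall>z \<in> network_points G. \<exists>B.
        \<forall>\<^sub>F (s, y) in nhdsin (cylinder G T) (t, z). \<bar>u s y\<bar> \<le> B)"

definition subsolution_interior ::
  "'e network \<Rightarrow> 'e hamiltonian \<Rightarrow> ('e \<Rightarrow> real \<Rightarrow> real \<Rightarrow> real) \<Rightarrow> ('e point \<Rightarrow> real \<Rightarrow> real)
   \<Rightarrow> real \<Rightarrow> (real \<Rightarrow> 'e point \<Rightarrow> real) \<Rightarrow> bool" where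
  "subsolution_interior G H p0 A T u \<longleftrightarrow> locally_bounded G T u \<and>
     (\<forall>\<phi>. test_function G T \<phi> \<longrightarrow> (\<forall>t \<in> {0<..<T}. \<forall>z \<in> network_points G.
        (\<forall>\<^sub>F (s, y) in nhdsin (open_cylinder G T) (t, z). usc_env G T u s y \<le> ereal (\<phi> s y)) \<and>
        usc_env G T u t z = ereal (\<phi> t z) \<longrightarrow>
        deriv (\<lambda>s. \<phi> s z) t + network_hamiltonian G H p0 A t z (edge_gradient G (\<phi> t)) \<le> 0))"

definition supersolution_interior ::
  "'e network \<Rightarrow> 'e hamiltonian \<Rightarrow> ('e \<Rightarrow> real \<Rightarrow> real \<Rightarrow> real) \<Rightarrow> ('e point \<Rightarrow> real \<Rightarrow> real)
   \<Rightarrow> real \<Rightarrow> (real \<Rightarrow> 'e point \<Rightarrow> real) \<Rightarrow> bool" where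
  "supersolution_interior G H p0 A T u \<longleftrightarrow> locally_bounded G T u \<and>
     (\<forall>\<phi>. test_function G T \<phi> \<longrightarrow> (\<forall>t \<in> {0<..<T}. \<forall>z \<in> network_points G.
        (\<forall>\<^sub>F (s, y) in nhdsin (open_cylinder G T) (t, z). lsc_env G T u s y \<ge> ereal (\<phi> s y)) \<and>
        lsc_env G T u t z = ereal (\<phi> t z) \<longrightarrow>
        deriv (\<lambda>s. \<phi> s z) t + network_hamiltonian G H p0 A t z (edge_gradient G (\<phi> t)) \<ge> 0))"

definition subsolution ::
  "'e network \<Rightarrow> 'e hamiltonian \<Rightarrow> ('e \<Rightarrow> real \<Rightarrow> real \<Rightarrow> real) \<Rightarrow> ('e point \<Rightarrow> real \<Rightarrow> real)
   \<Rightarrow> real \<Rightarrow> ('e point \<Rightarrow> real) \<Rightarrow> (real \<Rightarrow> 'e point \<Rightarrow> real) \<Rightarrow> bool" where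
  "subsolution G H p0 A T u0 u \<longleftrightarrow> subsolution_interior G H p0 A T u \<and>
     (\<forall>z \<in> network_points G. usc_env G T u 0 z \<le> ereal (u0 z))"

definition supersolution ::
  "'e network \<Rightarrow> 'e hamiltonian \<Rightarrow> ('e \<Rightarrow> real \<Rightarrow> real \<Rightarrow> real) \<Rightarrow> ('e point \<Rightarrow> real \<Rightarrow> real)
   \<Rightarrow> real \<Rightarrow> ('e point \<Rightarrow> real) \<Rightarrow> (real \<Rightarrow> 'e point \<Rightarrow> real) \<Rightarrow> bool" where
  "supersolution G H p0 A T u0 u \<longleftrightarrow> supersolution_interior G H p0 A T u \<and>
     (\<forall>z \<in> network_points G. lsc_env G T u 0 z \<ge> ereal (u0 z))"

end

theory Submission
  imports Defs
begin

text \<open>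
  Let \<open>U\<close> be the upper envelope of \<open>u\<close> and \<open>V\<close> that of \<open>-w\<close>; the claim is \<open>U + V \<le> 0\<close>. Suppose that \<open>U + V\<close> is positive
  somewhere. The proof is a doubling of variables in which the vertices need a special argument.

  Barriers. The function \<open>u0 z + \<epsilon> + \<alpha> D + K t\<close>, where \<open>D\<close> is a smoothed distance from an arbitrary point \<open>z\<close>, lies above \<open>u\<close>, and
  \<open>u0 z - \<epsilon> - \<alpha> D - K t\<close> lies below \<open>w\<close>: the slope \<open>\<alpha>\<close> is taken above the growth rate of \<open>u\<close>, and then \<open>K\<close> above the values of the
  Hamiltonian at slopes up to \<open>\<alpha>\<close>. Their constants do not depend on \<open>z\<close>, so that \<open>U t z \<le> u0 z + \<epsilon> + K t\<close> for all \<open>z\<close> at once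
  (lemma \<open>barrier\<close>). Hence \<open>U t x + V s x\<close> is bounded, and small when \<open>t\<close> and \<open>s\<close> are small.

  Time. For fixed small \<open>\<nu>\<close>, maximise \<open>U t x + V s x - (t - s)\<^sup>2 / 2\<nu> - \<eta> / (T - t) - \<eta> / (T - s) - \<alpha> D x\<close>. Only the times are doubled.
  At the maximum \<open>(tb, sb, xb)\<close> the tests of \<open>U\<close> and \<open>V\<close> have time derivatives that differ by at least \<open>2 \<eta> / T\<^sup>2\<close>, and both are
  bounded in terms of \<open>\<nu>\<close>. Coercivity therefore bounds all slopes that matter, which makes it possible to let \<open>\<alpha>\<close> tend to \<open>0\<close>
  before \<open>\<nu>\<close>. Existence of the maximum rests on the finiteness of balls: finitely many edges meet a bounded region
  (lemma \<open>walk_finite_edges\<close>).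

  Space, inside an edge (lemma \<open>interior_maximum\<close>). Doubling \<open>x\<close> with the penalty \<open>k (x - y)\<^sup>2\<close> and letting \<open>k\<close> tend to infinity
  produces one slope for which both inequalities hold at \<open>xb\<close>, up to the time shift from \<open>tb\<close> to \<open>sb\<close>.

  Space, at a vertex \<open>n\<close> (lemma \<open>vertex_maximum\<close>). The level at which the sub-solution inequality holds is now known, so it suffices
  to penalise with fixed slopes. On each edge end let \<open>\<pi>\<close> be the slope at which the decreasing branch of the Hamiltonian reaches a
  level \<open>\<kappa>\<close> slightly above that of \<open>U\<close>. A penalty with slope \<open>\<pi>\<close> on one side of \<open>y\<close>, and with a very large slope on the other side
  and on the other edges, cannot be touched by \<open>U\<close> off the diagonal, neither inside an edge nor at the vertex: at all those slopes
  the Hamiltonian, or its decreasing part in the flux, is at least \<open>\<kappa>\<close>. So the doubled maximum stays on the diagonal, at \<open>n\<close>. Testing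
  \<open>U\<close> at \<open>n\<close> with the large slopes gives \<open>A n tb \<le> \<kappa>\<close> with a margin, and testing \<open>w\<close> at \<open>n\<close> with the slopes \<open>\<pi>\<close>, at which the decreasing
  parts have level \<open>\<kappa>\<close>, forces \<open>A n sb\<close> above \<open>\<kappa>\<close> with a margin. As \<open>tb - sb\<close> is small, this contradicts the continuity of \<open>A\<close> in time.

  The network distance enters only through upper bounds, so it is replaced from the start by the combinatorial length of walks,
  which are chains of edge segments.
\<close>


section \<open>Local structure of the network\<close>

definition coord_nbhd :: "'e network \<Rightarrow> 'e point \<Rightarrow> real \<Rightarrow> ('e \<times> real) set" where
  "coord_nbhd G Z \<rho> = {(e, y). y \<in> edge G e \<and> (\<exists>c. (e, c) \<in> Z \<and> \<bar>y - c\<bar> < \<rho>)}"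

locale network_graph =
  fixes G :: "'e network"
  assumes is_network: "is_network G"
begin

lemma partition: "partition_on (endpoints G) (vertices G)"
  using is_network by (simp add: is_network_def)

text \<open>A positive real number below all edge lengths. It is picked between \<open>0\<close> and the infimum of the lengths,
  because that infimum is \<open>\<infinity>\<close> on a network made of half-lines only.\<close>

definition min_len :: real where
  "min_len = (SOME l. 0 < l \<and> (\<forall>e\<in>edges G. ereal l \<le> len G e))"

lemma min_len: "0 < min_len" "e \<in> edges G \<Longrightarrow> ereal min_len \<le> len G e"
proof -
  have "0 < (INF e \<in> edges G. len G e)" using is_network by (simp add: is_network_def)
  then obtain l where l: "0 < ereal l" "ereal l < (INF e \<in> edges G. len G e)"
    using ereal_dense2 by blast
  have "ereal l \<le> len G e" if "e \<in> edges G" for e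
    using less_le_trans[OF l(2) INF_lower[OF that]] by simp
  then have "\<exists>l. 0 < l \<and> (\<forall>e\<in>edges G. ereal l \<le> len G e)" using l(1) by auto
  from someI_ex[OF this, folded min_len_def]
  show "0 < min_len" "e \<in> edges G \<Longrightarrow> ereal min_len \<le> len G e" by blast+
qed

lemma edge_convex: "x \<in> edge G e \<Longrightarrow> z \<in> edge G e \<Longrightarrow> x \<le> y \<Longrightarrow> y \<le> z \<Longrightarrow> y \<in> edge G e"
  unfolding edge_def by (auto intro: order_trans[of "ereal y" "ereal z"])

lemma edge_nonneg: "x \<in> edge G e \<Longrightarrow> 0 \<le> x"
  by (simp add: edge_def)

lemma zero_in_edge: "e \<in> edges G \<Longrightarrow> 0 \<in> edge G e"
  using min_len(1) min_len(2)[of e] unfolding edge_def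
  by (auto simp: zero_ereal_def[symmetric] intro: order_trans[of 0 "ereal min_len"])

lemma interior_in_edge: "x \<in> edge_interior G e \<Longrightarrow> x \<in> edge G e"
  by (auto simp: edge_def edge_interior_def)

lemma endpoint_cases:
  assumes "(e, c) \<in> endpoints G"
  shows "e \<in> edges G" "c \<in> edge G e" "c = 0 \<or> ereal c = len G e"
  using assms by (auto simp: endpoints_def edge_points_def)

lemma endpoints_distance:
  assumes "(e, c) \<in> endpoints G" "(e, d) \<in> endpoints G" "c \<noteq> d"
  shows "min_len \<le> \<bar>c - d\<bar>"
proof -
  note c = endpoint_cases[OF assms(1)] and d = endpoint_cases[OF assms(2)]
  have "ereal min_len \<le> len G e" using min_len(2)[OF c(1)] .
  then show ?thesis using c d assms(3) edge_nonneg[of c e] edge_nonneg[of d e]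
    by (metis abs_minus_commute abs_of_nonneg diff_zero ereal.inject ereal_less_eq(3))
qed

lemma edge_points_cases:
  assumes "(e, x) \<in> edge_points G"
  shows "(e, x) \<in> endpoints G \<or> x \<in> edge_interior G e"
  using assms by (fastforce simp: edge_points_def endpoints_def edge_def edge_interior_def)

lemma interior_not_endpoint: "x \<in> edge_interior G e \<Longrightarrow> (e, x) \<notin> endpoints G"
  by (auto simp: endpoints_def edge_interior_def)

lemma vertex_subset: "n \<in> vertices G \<Longrightarrow> n \<subseteq> endpoints G"
  using partition unfolding partition_on_def by blast

lemma vertex_network_point: "n \<in> vertices G \<Longrightarrow> n \<in> network_points G"
  using network_points_eq[OF partition] by blast

lemma network_point_cases:
  assumes "Z \<in> network_points G"
  obtains (vertex) "Z \<in> vertices G"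
    | (interior) e x where "Z = {(e, x)}" "e \<in> edges G" "x \<in> edge_interior G e"
  using assms network_points_eq[OF partition] by blast

lemma interior_not_vertex: "x \<in> edge_interior G e \<Longrightarrow> {(e, x)} \<notin> vertices G"
  using vertex_subset interior_not_endpoint by blast

lemma interior_network_point: "e \<in> edges G \<Longrightarrow> x \<in> edge_interior G e \<Longrightarrow> {(e, x)} \<in> network_points G"
  using network_points_eq[OF partition] by blast

lemma network_point_subset:
  assumes "Z \<in> network_points G" shows "Z \<subseteq> edge_points G"
  using assms
proof (cases rule: network_point_cases)
  case vertex
  then show ?thesis using vertex_subset[OF vertex] by (auto simp: endpoints_def)
next
  case (interior e x)
  then show ?thesis using interior_in_edge by (auto simp: edge_points_def)
qed

lemma network_point_proj:
  assumes "Z \<in> network_points G" "a \<in> Z" shows "proj G a = Z"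
  using assms(1)
proof (cases rule: network_point_cases)
  case vertex
  then show ?thesis using proj_endpoint[OF partition] assms(2) by blast
next
  case (interior e x)
  then show ?thesis using proj_interior[OF partition] assms(2) by blast
qed

lemma network_point_finite:
  assumes "Z \<in> network_points G" shows "finite Z"
  using assms
proof (cases rule: network_point_cases)
  case vertex
  then show ?thesis using is_network by (simp add: is_network_def)
qed simp

lemma network_point_nonempty:
  assumes "Z \<in> network_points G" shows "Z \<noteq> {}"
  using assms
proof (cases rule: network_point_cases)
  case vertex
  then show ?thesis using partition by (auto simp: partition_on_def)
qed simp

lemma proj_mem: "a \<in> edge_points G \<Longrightarrow> a \<in> proj G a"
  by (simp add: proj_def glue_rel_def)

lemma proj_network_point: "a \<in> edge_points G \<Longrightarrow> proj G a \<in> network_points G"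
  using network_points_conv_proj by blast

lemma endpoint_vertex: "a \<in> endpoints G \<Longrightarrow> proj G a \<in> vertices G"
  using partition proj_endpoint[OF partition] unfolding partition_on_def by (metis UnionE)

lemma interior_proj: "e \<in> edges G \<Longrightarrow> x \<in> edge_interior G e \<Longrightarrow> proj G (e, x) = {(e, x)}"
  using proj_interior[OF partition] .

text \<open>At such a radius, the coordinate neighbourhood of a point contains no endpoint other than
  the representatives of the point itself.\<close>

definition isolating :: "'e point \<Rightarrow> real \<Rightarrow> bool" where
  "isolating Z \<rho> \<longleftrightarrow> 0 < \<rho> \<and>
     (\<forall>e c d. (e, c) \<in> Z \<longrightarrow> (e, d) \<in> endpoints G \<longrightarrow> c \<noteq> d \<longrightarrow> \<rho> \<le> \<bar>c - d\<bar>)"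

lemma isolating_mono: "isolating Z \<rho> \<Longrightarrow> 0 < \<rho>' \<Longrightarrow> \<rho>' \<le> \<rho> \<Longrightarrow> isolating Z \<rho>'"
  unfolding isolating_def by (meson order_trans)

lemma isolating_exists:
  assumes "Z \<in> network_points G" obtains \<rho> where "isolating Z \<rho>"
  using assms
proof (cases rule: network_point_cases)
  case vertex
  have "isolating Z min_len"
    unfolding isolating_def using min_len(1) endpoints_distance vertex_subset[OF vertex] by blast
  then show ?thesis using that by blast
next
  case (interior e x)
  have x: "0 < x" "ereal x < len G e" using interior by (auto simp: edge_interior_def)
  obtain r where r: "0 < r" "ereal (x + r) \<le> len G e"
  proof (cases "len G e")
    case (real l)
    then show ?thesis using x that[of "l - x"] by simp
  next
    case PInf
    then show ?thesis using that[of 1] by simp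
  next
    case MInf
    then show ?thesis using x by simp
  qed
  have "isolating Z (min x r)"
    unfolding isolating_def
  proof (intro conjI allI impI)
    show "0 < min x r" using x r by simp
    fix e' c d assume *: "(e', c) \<in> Z" "(e', d) \<in> endpoints G" "c \<noteq> d"
    have c: "e' = e" "c = x" using * interior(1) by auto
    from endpoint_cases(3)[OF *(2)] show "min x r \<le> \<bar>c - d\<bar>"
    proof
      assume "d = 0" then show ?thesis using c x by simp
    next
      assume "ereal d = len G e'"
      then have "ereal (x + r) \<le> ereal d" using r(2) c by metis
      then have "x + r \<le> d" by simp
      then show ?thesis using c x r by simp
    qed
  qed
  then show ?thesis using that by blast
qed

lemma coord_nbhd_subset: "Z \<in> network_points G \<Longrightarrow> coord_nbhd G Z \<rho> \<subseteq> edge_points G"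
  using network_point_subset unfolding coord_nbhd_def edge_points_def by fastforce

lemma coord_nbhd_self: "Z \<in> network_points G \<Longrightarrow> 0 < \<rho> \<Longrightarrow> Z \<subseteq> coord_nbhd G Z \<rho>"
  using network_point_subset unfolding coord_nbhd_def edge_points_def by fastforce

text \<open>Gluing only affects endpoints, and at an isolating radius the only endpoints in the neighbourhood are
  the representatives of the point; hence the neighbourhood is a union of gluing classes and descends
  to an open set of the quotient.\<close>

lemma coord_nbhd_saturated:
  assumes Z: "Z \<in> network_points G" "isolating Z \<rho>"
    and ab: "a \<in> edge_points G" "b \<in> coord_nbhd G Z \<rho>" "proj G a = proj G b"
  shows "a \<in> coord_nbhd G Z \<rho>"
proof (cases "a = b")
  case False
  have bE: "b \<in> edge_points G" using ab(2) coord_nbhd_subset[OF Z(1)] by blast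
  have ain: "a \<in> proj G b" using ab proj_mem by metis
  then obtain n where n: "n \<in> vertices G" "a \<in> n" "b \<in> n"
    using False unfolding proj_def glue_rel_def by blast
  obtain e y c where b: "b = (e, y)" "(e, c) \<in> Z" "\<bar>y - c\<bar> < \<rho>"
    using ab(2) unfolding coord_nbhd_def by blast
  have "(e, y) \<in> endpoints G" using n b vertex_subset by blast
  then have "y = c" using Z(2) b unfolding isolating_def by (metis abs_minus_commute not_le)
  then have "b \<in> Z" using b by simp
  then have "proj G b = Z" using network_point_proj Z(1) by blast
  then have "a \<in> Z" using ain by simp
  then show ?thesis using coord_nbhd_self[OF Z(1)] Z(2) unfolding isolating_def by blast
qed (use ab in simp)

lemma preimage_coord_nbhd:
  assumes "Z \<in> network_points G" "isolating Z \<rho>"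
  shows "{a \<in> edge_points G. proj G a \<in> proj G ` coord_nbhd G Z \<rho>} = coord_nbhd G Z \<rho>"
  using coord_nbhd_saturated[OF assms] coord_nbhd_subset[OF assms(1)] by blast

lemma openin_coord_nbhd:
  assumes Z: "Z \<in> network_points G" "isolating Z \<rho>"
  shows "openin (network_topology G) (proj G ` coord_nbhd G Z \<rho>)"
proof -
  have "openin (top_of_set (edge G e)) {y. (e, y) \<in> coord_nbhd G Z \<rho>}" for e
  proof -
    have "{y. (e, y) \<in> coord_nbhd G Z \<rho>} = edge G e \<inter> (\<Union>c\<in>{c. (e, c) \<in> Z}. ball c \<rho>)"
      unfolding coord_nbhd_def by (auto simp: dist_real_def abs_minus_commute)
    then show ?thesis by (metis open_UN open_ball openin_open_Int)
  qed
  moreover have "coord_nbhd G Z \<rho> \<subseteq> Sigma (edges G) (edge G)"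
    using coord_nbhd_subset[OF Z(1)] by (simp add: edge_points_def)
  ultimately have "openin (edge_topology G) (coord_nbhd G Z \<rho>)"
    unfolding edge_topology_def openin_sum_topology by (simp add: comp_def)
  then show ?thesis
    unfolding openin_network_topology preimage_coord_nbhd[OF Z]
    using coord_nbhd_subset[OF Z(1)] network_points_conv_proj by blast
qed

lemma coord_nbhd_in_open:
  assumes N: "openin (network_topology G) N" "Z \<in> N"
  obtains \<rho> where "0 < \<rho>" "\<And>a. a \<in> coord_nbhd G Z \<rho> \<Longrightarrow> proj G a \<in> N"
proof -
  have Z: "Z \<in> network_points G" using N by (auto simp: openin_network_topology)
  have op: "openin (edge_topology G) {a \<in> edge_points G. proj G a \<in> N}"
    using N by (simp add: openin_network_topology)
  have "\<exists>r>0. \<forall>y\<in>edge G e. \<bar>y - c\<bar> < r \<longrightarrow> proj G (e, y) \<in> N" if ec: "(e, c) \<in> Z" for e c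
  proof -
    have e: "e \<in> edges G" "c \<in> edge G e" using ec network_point_subset[OF Z] by (auto simp: edge_points_def)
    have "openin (top_of_set (edge G e)) {y. (e, y) \<in> {a \<in> edge_points G. proj G a \<in> N}}"
      using op e(1) unfolding edge_topology_def openin_sum_topology by auto
    moreover have "c \<in> {y. (e, y) \<in> {a \<in> edge_points G. proj G a \<in> N}}"
      using network_point_proj[OF Z ec] network_point_subset[OF Z] ec N(2) by auto
    ultimately obtain r where "r > 0"
      "\<forall>y\<in>edge G e. dist y c < r \<longrightarrow> y \<in> {y. (e, y) \<in> {a \<in> edge_points G. proj G a \<in> N}}"
      unfolding openin_euclidean_subtopology_iff by blast
    then show ?thesis by (auto simp: dist_real_def)
  qed
  then have "\<forall>i\<in>Z. \<exists>r>0. \<forall>y\<in>edge G (fst i). \<bar>y - snd i\<bar> < r \<longrightarrow> proj G (fst i, y) \<in> N" by force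
  then obtain r where r: "\<And>i. i \<in> Z \<Longrightarrow> r i > 0"
    "\<And>i y. i \<in> Z \<Longrightarrow> y \<in> edge G (fst i) \<Longrightarrow> \<bar>y - snd i\<bar> < r i \<Longrightarrow> proj G (fst i, y) \<in> N"
    by metis
  let ?\<rho> = "Min (r ` Z)"
  have fin: "finite (r ` Z)" "r ` Z \<noteq> {}"
    using network_point_finite[OF Z] network_point_nonempty[OF Z] by auto
  show ?thesis
  proof (rule that[of ?\<rho>])
    show "0 < ?\<rho>" using fin r(1) by auto
    fix a assume "a \<in> coord_nbhd G Z ?\<rho>"
    then obtain e y c where a: "a = (e, y)" "y \<in> edge G e" "(e, c) \<in> Z" "\<bar>y - c\<bar> < ?\<rho>"
      unfolding coord_nbhd_def by blast
    have "?\<rho> \<le> r (e, c)" using fin(1) a(3) by simp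
    then show "proj G a \<in> N" using r(2)[OF a(3)] a by simp
  qed
qed

end


section \<open>Walks and the distance they define\<close>

text \<open>A finite chain of edge segments, starting at a point \<open>Z\<close>, of total length \<open>r\<close>. Walks play the part of
  paths in all estimates: they can be handled by induction, and since a walk can be traced by a path of
  the same length, their lengths bound the network distance from above.\<close>

inductive walk :: "'e network \<Rightarrow> 'e point \<Rightarrow> real \<Rightarrow> 'e \<times> real \<Rightarrow> bool" for G Z where
  start: "a \<in> Z \<Longrightarrow> walk G Z 0 a"
| along: "walk G Z r (e, x) \<Longrightarrow> y \<in> edge G e \<Longrightarrow> walk G Z (r + \<bar>x - y\<bar>) (e, y)"
| jump: "walk G Z r a \<Longrightarrow> n \<in> vertices G \<Longrightarrow> a \<in> n \<Longrightarrow> b \<in> n \<Longrightarrow> walk G Z r b"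

definition walk_dist :: "'e network \<Rightarrow> 'e point \<Rightarrow> 'e \<times> real \<Rightarrow> real" where
  "walk_dist G Z a = Inf {r. walk G Z r a}"

text \<open>The direction, in the coordinate of the edge, that points into the edge at its end \<open>c\<close>.\<close>

definition inward :: "real \<Rightarrow> real" where
  "inward c = (if c = 0 then 1 else - 1)"

lemma inward_cases: "inward c = 1 \<or> inward c = - 1"
  by (simp add: inward_def)

text \<open>A \<open>C\<^sup>1\<close> substitute for \<open>\<bar>s\<bar>\<close> with slopes in \<open>[-1, 1]\<close>, at most \<open>\<sigma>\<close> below it. It is applied to distances
  from a point, whose convex kink at that point cannot be touched from above by a smooth function.\<close>

definition soft :: "real \<Rightarrow> real \<Rightarrow> real" where
  "soft \<sigma> s = sqrt (\<sigma>\<^sup>2 + s\<^sup>2) - \<sigma>"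

definition soft' :: "real \<Rightarrow> real \<Rightarrow> real" where
  "soft' \<sigma> s = s / sqrt (\<sigma>\<^sup>2 + s\<^sup>2)"

definition C1_line :: "(real \<Rightarrow> real) \<Rightarrow> (real \<Rightarrow> real) \<Rightarrow> bool" where
  "C1_line g g' \<longleftrightarrow> (\<forall>y. (g has_real_derivative g' y) (at y)) \<and> continuous_on UNIV g'"

lemma soft_C1: assumes "0 < \<sigma>" shows "C1_line (soft \<sigma>) (soft' \<sigma>)"
proof -
  have pos: "0 < \<sigma>\<^sup>2 + s\<^sup>2" for s :: real
    using assms by (simp add: add_pos_nonneg)
  show ?thesis
    unfolding C1_line_def
  proof (intro conjI allI)
    fix s
    show "(soft \<sigma> has_real_derivative soft' \<sigma> s) (at s)"
      unfolding soft_def soft'_def using pos[of s]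
      by (auto intro!: derivative_eq_intros simp: field_simps)
    have "sqrt (\<sigma>\<^sup>2 + y\<^sup>2) \<noteq> 0" for y using pos[of y] by (metis less_irrefl real_sqrt_eq_0_iff)
    then show "continuous_on UNIV (soft' \<sigma>)"
      unfolding soft'_def by (intro continuous_intros) auto
  qed
qed

lemma soft'_bound: assumes "0 < \<sigma>" shows "\<bar>soft' \<sigma> s\<bar> \<le> 1"
proof -
  have "\<bar>s\<bar> \<le> sqrt (\<sigma>\<^sup>2 + s\<^sup>2)" by (rule real_le_rsqrt) simp
  moreover have "0 < sqrt (\<sigma>\<^sup>2 + s\<^sup>2)" using assms by (simp add: add_pos_nonneg)
  ultimately show ?thesis unfolding soft'_def by (simp add: abs_divide divide_le_eq)
qed

lemma soft_mono: "\<bar>s\<bar> \<le> \<bar>t\<bar> \<Longrightarrow> soft \<sigma> s \<le> soft \<sigma> t"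
  unfolding soft_def using abs_le_square_iff[of s t] by simp

lemma soft_0: "0 \<le> \<sigma> \<Longrightarrow> soft \<sigma> 0 = 0" by (simp add: soft_def)

lemma soft_nonneg: "0 \<le> \<sigma> \<Longrightarrow> 0 \<le> soft \<sigma> s"
  using soft_mono[of 0 s \<sigma>] soft_0[of \<sigma>] by simp

lemma soft_ge: "s \<le> soft \<sigma> s + \<sigma>"
proof -
  have "\<bar>s\<bar> \<le> sqrt (\<sigma>\<^sup>2 + s\<^sup>2)" by (rule real_le_rsqrt) simp
  then show ?thesis unfolding soft_def by linarith
qed

context network_graph
begin

lemma endpoint_abs:
  assumes "(e, c) \<in> endpoints G" "y \<in> edge G e"
  shows "\<bar>y - c\<bar> = inward c * (y - c)"
proof -
  have "0 \<le> y" "ereal y \<le> len G e" using assms(2) by (auto simp: edge_def)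
  moreover have "c \<noteq> 0 \<Longrightarrow> y \<le> c"
    using endpoint_cases(3)[OF assms(1)] \<open>ereal y \<le> len G e\<close> by (metis ereal_less_eq(3))
  ultimately show ?thesis by (auto simp: inward_def)
qed

lemma same_point_cases:
  assumes "Z \<in> network_points G" "a \<in> Z" "b \<in> Z"
  shows "a = b \<or> Z \<in> vertices G"
  using assms(1) by (cases rule: network_point_cases) (use assms in auto)

lemma walk_edge_points:
  assumes "walk G Z r a" "Z \<in> network_points G"
  shows "a \<in> edge_points G \<and> 0 \<le> r"
  using assms
proof (induction rule: walk.induct)
  case (start a)
  then show ?case using network_point_subset by auto
next
  case (jump r a n b)
  then show ?case using vertex_subset by (auto simp: endpoints_def)
qed (auto simp: edge_points_def)

lemma walk_trans:
  assumes "walk G Z r' a" "Z \<in> network_points G" "walk G Y r b" "b \<in> Z"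
  shows "walk G Y (r + r') a"
  using assms
proof (induction rule: walk.induct)
  case (start a)
  then show ?case using same_point_cases[of Z a b] walk.jump[of G Y r b Z a] by auto
next
  case (along r' e x y)
  then show ?case using walk.along[of G Y "r + r'" e x y] by (simp add: add.assoc)
next
  case (jump r' a n c)
  then show ?case using walk.jump by blast
qed

text \<open>Between two different vertices a walk covers a full edge, however many segments it uses. So a property
  \<open>Q r n\<close> of the vertices reached within length \<open>r\<close> holds along all walks once it is preserved by full
  edges, and the current segment starts either at the origin or at such a vertex.\<close>

lemma walk_invariant:
  assumes Z: "Z \<in> network_points G" and w: "walk G Z r a"
    and Q_start: "\<And>e c x n r. (e, c) \<in> Z \<Longrightarrow> n \<in> vertices G \<Longrightarrow> (e, x) \<in> n \<Longrightarrow> \<bar>x - c\<bar> \<le> r \<Longrightarrow> Q r n"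
    and Q_step: "\<And>e c x n n' r r'. Q r n \<Longrightarrow> n \<in> vertices G \<Longrightarrow> (e, c) \<in> n \<Longrightarrow> n' \<in> vertices G \<Longrightarrow>
        (e, x) \<in> n' \<Longrightarrow> min_len \<le> \<bar>x - c\<bar> \<Longrightarrow> r + \<bar>x - c\<bar> \<le> r' \<Longrightarrow> Q r' n'"
  shows "(\<exists>c. (fst a, c) \<in> Z \<and> \<bar>snd a - c\<bar> \<le> r) \<or>
    (\<exists>n r' c. n \<in> vertices G \<and> Q r' n \<and> (fst a, c) \<in> n \<and> r' + \<bar>snd a - c\<bar> \<le> r)"
  using w
proof (induction rule: walk.induct)
  case (start a)
  then have "(fst a, snd a) \<in> Z \<and> \<bar>snd a - snd a\<bar> \<le> 0" by simp
  then show ?case by blast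
next
  case (along r e x y)
  from along.IH show ?case
  proof (elim disjE exE conjE)
    fix c assume "(fst (e, x), c) \<in> Z" "\<bar>snd (e, x) - c\<bar> \<le> r"
    then have "(fst (e, y), c) \<in> Z \<and> \<bar>snd (e, y) - c\<bar> \<le> r + \<bar>x - y\<bar>" by auto
    then show ?thesis by blast
  next
    fix n r' c assume "n \<in> vertices G" "Q r' n" "(fst (e, x), c) \<in> n" "r' + \<bar>snd (e, x) - c\<bar> \<le> r"
    then have "n \<in> vertices G \<and> Q r' n \<and> (fst (e, y), c) \<in> n \<and> r' + \<bar>snd (e, y) - c\<bar> \<le> r + \<bar>x - y\<bar>"
      by auto
    then show ?thesis by blast
  qed
next
  case (jump r a n b)
  have "\<exists>r'\<le>r. Q r' n"
    using jump.IH
  proof (elim disjE exE conjE)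
    fix c assume "(fst a, c) \<in> Z" "\<bar>snd a - c\<bar> \<le> r"
    then have "Q r n" using Q_start[of "fst a" c n "snd a" r] jump by simp
    then show ?thesis by blast
  next
    fix n' r' c assume *: "n' \<in> vertices G" "Q r' n'" "(fst a, c) \<in> n'" "r' + \<bar>snd a - c\<bar> \<le> r"
    show ?thesis
    proof (cases "c = snd a")
      case True
      then have "a \<in> n'" using * by simp
      then have "n = n'" using proj_endpoint[OF partition] * jump by metis
      then have "r' \<le> r" "Q r' n" using * by auto
      then show ?thesis by blast
    next
      case False
      have "(fst a, c) \<in> endpoints G" "(fst a, snd a) \<in> endpoints G"
        using * jump vertex_subset by auto
      then have "min_len \<le> \<bar>snd a - c\<bar>" using endpoints_distance[of "fst a" "snd a" c] False by auto
      then have "Q r n" using Q_step[of r' n' "fst a" c n "snd a" r] * jump by simp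
      then show ?thesis by blast
    qed
  qed
  then obtain r' where "r' \<le> r" "Q r' n" by blast
  then have "n \<in> vertices G \<and> Q r' n \<and> (fst b, snd b) \<in> n \<and> r' + \<bar>snd b - snd b\<bar> \<le> r"
    using jump by simp
  then show ?case by blast
qed

text \<open>The points reached by walks contain each edge entirely or not at all, so they form a set that is both
  open and closed in the network; the network is connected.\<close>

lemma walk_exists:
  assumes Z: "Z \<in> network_points G" and a: "a \<in> edge_points G"
  shows "\<exists>r. walk G Z r a"
proof -
  define S where "S = {a \<in> edge_points G. \<exists>r. walk G Z r a}"
  have S_edge: "(e, y) \<in> S" if "(e, x) \<in> S" "y \<in> edge G e" for e x y
    using that walk.along[of G Z _ e x y] unfolding S_def edge_points_def by blast
  have S_glue: "b \<in> S" if "a \<in> S" "b \<in> edge_points G" "proj G a = proj G b" for a b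
  proof (cases "a = b")
    case False
    have "b \<in> proj G a" using that proj_mem by metis
    then obtain n where "n \<in> vertices G" "a \<in> n" "b \<in> n"
      using False unfolding proj_def glue_rel_def by blast
    then show ?thesis using walk.jump that unfolding S_def by blast
  qed (use that in simp)
  have pre: "{a \<in> edge_points G. proj G a \<in> proj G ` S} = S"
    using S_glue unfolding S_def by blast
  have pre': "{a \<in> edge_points G. proj G a \<in> network_points G - proj G ` S} = edge_points G - S"
    using pre proj_network_point by blast
  have all_or_none: "{x. (e, x) \<in> S} = edge G e \<or> {x. (e, x) \<in> S} = {}" for e
    using S_edge unfolding S_def edge_points_def by blast
  have "openin (top_of_set (edge G e)) {x. (e, x) \<in> S}" for e
    using all_or_none[of e] by auto
  moreover have "S \<subseteq> Sigma (edges G) (edge G)" by (auto simp: S_def edge_points_def)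
  ultimately have opS: "openin (edge_topology G) S"
    unfolding edge_topology_def openin_sum_topology by (simp add: comp_def)
  have "openin (top_of_set (edge G e)) {x. (e, x) \<in> edge_points G - S}" if "e \<in> edges G" for e
  proof -
    have "{x. (e, x) \<in> edge_points G - S} = edge G e - {x. (e, x) \<in> S}"
      using that by (auto simp: edge_points_def)
    then show ?thesis using all_or_none[of e] by auto
  qed
  moreover have "edge_points G - S \<subseteq> Sigma (edges G) (edge G)" by (auto simp: edge_points_def)
  ultimately have opC: "openin (edge_topology G) (edge_points G - S)"
    unfolding edge_topology_def openin_sum_topology by (simp add: comp_def)
  have op: "openin (network_topology G) (proj G ` S)"
    unfolding openin_network_topology pre using opS proj_network_point by (auto simp: S_def)
  have cl: "closedin (network_topology G) (proj G ` S)"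
    unfolding closedin_def topspace_network_topology openin_network_topology pre'
    using opC proj_network_point by (auto simp: S_def)
  have conn: "connected_space (network_topology G)"
    using is_network path_connected_imp_connected_space unfolding is_network_def by blast
  obtain z where "z \<in> Z" using network_point_nonempty[OF Z] by blast
  then have "z \<in> S" using walk.start network_point_subset[OF Z] unfolding S_def by blast
  then have "proj G ` S = network_points G"
    using conn op cl unfolding connected_space_clopen_in topspace_network_topology by blast
  then have "proj G a \<in> proj G ` S" using proj_network_point[OF a] by simp
  then have "a \<in> S" using pre a by blast
  then show ?thesis by (simp add: S_def)
qed

lemma walk_dist_le: "Z \<in> network_points G \<Longrightarrow> walk G Z r a \<Longrightarrow> walk_dist G Z a \<le> r"
  unfolding walk_dist_def by (rule cInf_lower) (auto simp: bdd_below_def dest: walk_edge_points)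

lemma walk_dist_less:
  assumes "Z \<in> network_points G" "a \<in> edge_points G" "walk_dist G Z a < r"
  obtains r' where "r' < r" "walk G Z r' a"
proof -
  have "{r. walk G Z r a} \<noteq> {}" using walk_exists[OF assms(1,2)] by blast
  from cInf_lessD[OF this assms(3)[unfolded walk_dist_def]] show ?thesis using that by blast
qed

lemma walk_dist_nonneg:
  assumes "Z \<in> network_points G" "a \<in> edge_points G" shows "0 \<le> walk_dist G Z a"
  unfolding walk_dist_def
  by (rule cInf_greatest) (use assms walk_exists walk_edge_points in auto)

lemma walk_dist_start: "Z \<in> network_points G \<Longrightarrow> a \<in> Z \<Longrightarrow> walk_dist G Z a = 0"
  using walk_dist_le[of Z 0 a] walk_dist_nonneg[of Z a] walk.start[of a Z G] network_point_subset[of Z]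
  by (meson order_antisym subsetD)

lemma walk_dist_along:
  assumes Z: "Z \<in> network_points G" and "(e, x) \<in> edge_points G" "(e, y) \<in> edge_points G"
  shows "walk_dist G Z (e, y) \<le> walk_dist G Z (e, x) + \<bar>x - y\<bar>"
proof (rule field_le_epsilon)
  fix d :: real assume "0 < d"
  then have "walk_dist G Z (e, x) < walk_dist G Z (e, x) + d" by simp
  then obtain r where "r < walk_dist G Z (e, x) + d" "walk G Z r (e, x)"
    using walk_dist_less[OF Z assms(2)] by blast
  moreover have "walk G Z (r + \<bar>x - y\<bar>) (e, y)"
    using walk.along[OF \<open>walk G Z r (e, x)\<close>] assms(3) by (simp add: edge_points_def)
  ultimately show "walk_dist G Z (e, y) \<le> walk_dist G Z (e, x) + \<bar>x - y\<bar> + d"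
    using walk_dist_le[OF Z] by fastforce
qed

lemma walk_dist_glue:
  assumes Z: "Z \<in> network_points G" and "n \<in> vertices G" "a \<in> n" "b \<in> n"
  shows "walk_dist G Z a = walk_dist G Z b"
proof -
  have "walk G Z r a \<longleftrightarrow> walk G Z r b" for r using walk.jump assms by blast
  then show ?thesis by (simp add: walk_dist_def)
qed

lemma walk_dist_point:
  assumes Z: "Z \<in> network_points G" and "Y \<in> network_points G" "a \<in> Y" "b \<in> Y"
  shows "walk_dist G Z a = walk_dist G Z b"
  using same_point_cases[OF assms(2-4)] walk_dist_glue[OF Z _ assms(3,4)] by auto

lemma walk_dist_triangle:
  assumes Y: "Y \<in> network_points G" and Z: "Z \<in> network_points G" "z \<in> Z" and a: "a \<in> edge_points G"
  shows "walk_dist G Y a \<le> walk_dist G Y z + walk_dist G Z a"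
proof (rule field_le_epsilon)
  fix d :: real assume d: "0 < d"
  have z: "z \<in> edge_points G" using network_point_subset Z by blast
  have lt: "walk_dist G Y z < walk_dist G Y z + d/2" "walk_dist G Z a < walk_dist G Z a + d/2" using d by auto
  obtain r where "r < walk_dist G Y z + d/2" "walk G Y r z"
    using walk_dist_less[OF Y z lt(1)] by blast
  moreover obtain r' where "r' < walk_dist G Z a + d/2" "walk G Z r' a"
    using walk_dist_less[OF Z(1) a lt(2)] by blast
  ultimately show "walk_dist G Y a \<le> walk_dist G Y z + walk_dist G Z a + d"
    using walk_dist_le[OF Y walk_trans[OF _ Z(1) _ Z(2)], of r' a r] by force
qed

lemma endpoints_edge_finite: "finite {c. (e, c) \<in> endpoints G}"
proof -
  have "{c. (e, c) \<in> endpoints G} \<subseteq> {0, real_of_ereal (len G e)}"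
    by (force dest: endpoint_cases(3) simp: eq_commute[of "ereal _" "len G e"])
  then show ?thesis using finite_subset by blast
qed

lemma zero_endpoint: "e \<in> edges G \<Longrightarrow> (e, 0) \<in> endpoints G"
  using zero_in_edge by (auto simp: endpoints_def edge_points_def)

text \<open>A shortest walk to a point of an edge enters that edge through one of its ends, unless it
  starts on it.\<close>

lemma walk_dist_entrance:
  assumes Z: "Z \<in> network_points G" and a: "(e, x) \<in> edge_points G"
  shows "(\<exists>c. (e, c) \<in> Z \<and> walk_dist G Z (e, x) = \<bar>x - c\<bar>) \<or>
    (\<exists>c. (e, c) \<in> endpoints G \<and> walk_dist G Z (e, x) = walk_dist G Z (e, c) + \<bar>x - c\<bar>)"
proof (rule ccontr)
  assume no: "\<not> ?thesis"
  let ?D = "walk_dist G Z"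
  let ?V = "(\<lambda>c. \<bar>x - c\<bar>) ` {c. (e, c) \<in> Z} \<union> (\<lambda>c. ?D (e, c) + \<bar>x - c\<bar>) ` {c. (e, c) \<in> endpoints G}"
  have "{c. (e, c) \<in> Z} \<subseteq> snd ` Z" by force
  then have "finite {c. (e, c) \<in> Z}" using network_point_finite[OF Z] finite_surj by metis
  then have fin: "finite ?V" using endpoints_edge_finite by simp
  have ne: "?V \<noteq> {}" using zero_endpoint a by (auto simp: edge_points_def)
  have "?D (e, x) < v" if v: "v \<in> ?V" for v
    using v
  proof
    assume "v \<in> (\<lambda>c. \<bar>x - c\<bar>) ` {c. (e, c) \<in> Z}"
    then obtain c where c: "(e, c) \<in> Z" "v = \<bar>x - c\<bar>" by blast
    then have "?D (e, x) \<le> v"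
      using walk_dist_along[OF Z _ a, of c] walk_dist_start[OF Z c(1)] network_point_subset[OF Z]
      by (auto simp: abs_minus_commute)
    then show ?thesis using no c by fastforce
  next
    assume "v \<in> (\<lambda>c. ?D (e, c) + \<bar>x - c\<bar>) ` {c. (e, c) \<in> endpoints G}"
    then obtain c where c: "(e, c) \<in> endpoints G" "v = ?D (e, c) + \<bar>x - c\<bar>" by blast
    then have "?D (e, x) \<le> v"
      using walk_dist_along[OF Z _ a, of c] by (auto simp: abs_minus_commute endpoints_def)
    then show ?thesis using no c by fastforce
  qed
  then have "?D (e, x) < Min ?V" using fin ne by simp
  then obtain r where r: "r < Min ?V" "walk G Z r (e, x)" using walk_dist_less[OF Z a] by blast
  have "(\<exists>c. (fst (e, x), c) \<in> Z \<and> \<bar>snd (e, x) - c\<bar> \<le> r) \<or>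
    (\<exists>n r' c. n \<in> vertices G \<and> (\<forall>a\<in>n. ?D a \<le> r') \<and> (fst (e, x), c) \<in> n \<and> r' + \<bar>snd (e, x) - c\<bar> \<le> r)"
  proof (rule walk_invariant[OF Z r(2)])
    fix e c x n and r :: real
    assume *: "(e, c) \<in> Z" "n \<in> vertices G" "(e, x) \<in> n" "\<bar>x - c\<bar> \<le> r"
    have "(e, x) \<in> edge_points G" using * vertex_subset by (auto simp: endpoints_def)
    then have "?D (e, x) \<le> r"
      using walk_dist_along[OF Z, of e c x] walk_dist_start[OF Z *(1)] network_point_subset[OF Z] *
      by (auto simp: abs_minus_commute)
    then show "\<forall>a\<in>n. ?D a \<le> r" using walk_dist_glue[OF Z *(2,3)] by metis
  next
    fix e c x n n' and r r' :: real
    assume *: "\<forall>a\<in>n. ?D a \<le> r" "n \<in> vertices G" "(e, c) \<in> n" "n' \<in> vertices G" "(e, x) \<in> n'"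
      "r + \<bar>x - c\<bar> \<le> r'"
    have "(e, x) \<in> edge_points G" "(e, c) \<in> edge_points G" using * vertex_subset by (auto simp: endpoints_def)
    then have "?D (e, x) \<le> r'"
      using walk_dist_along[OF Z, of e c x] * by (fastforce simp: abs_minus_commute)
    then show "\<forall>a\<in>n'. ?D a \<le> r'" using walk_dist_glue[OF Z *(4,5)] by metis
  qed
  then obtain v where v: "v \<in> ?V" "v \<le> r"
  proof (elim disjE exE conjE)
    fix c assume "(fst (e, x), c) \<in> Z" "\<bar>snd (e, x) - c\<bar> \<le> r"
    then show ?thesis using that[of "\<bar>x - c\<bar>"] by auto
  next
    fix n r' c assume *: "n \<in> vertices G" "\<forall>a\<in>n. ?D a \<le> r'" "(fst (e, x), c) \<in> n" "r' + \<bar>snd (e, x) - c\<bar> \<le> r"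
    then have "(e, c) \<in> endpoints G" "?D (e, c) + \<bar>x - c\<bar> \<le> r" using vertex_subset by fastforce+
    then show ?thesis using that[of "?D (e, c) + \<bar>x - c\<bar>"] by auto
  qed
  have "Min ?V \<le> v" using fin v(1) by (rule Min_le)
  then show False using v(2) r(1) by simp
qed

text \<open>The vertices reached from the edges that contain \<open>Z\<close> after crossing at most \<open>k\<close> full edges.\<close>

primrec vertices_near :: "'e point \<Rightarrow> nat \<Rightarrow> 'e point set" where
  "vertices_near Z 0 = {n \<in> vertices G. \<exists>e \<in> fst ` Z. \<exists>x. (e, x) \<in> n}"
| "vertices_near Z (Suc k) = {n \<in> vertices G. \<exists>e \<in> (\<Union>n'\<in>vertices_near Z k. fst ` n'). \<exists>x. (e, x) \<in> n}"

lemma vertices_over_finite: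
  assumes "finite F" shows "finite {n \<in> vertices G. \<exists>e \<in> F. \<exists>x. (e, x) \<in> n}"
proof -
  let ?B = "Sigma F (\<lambda>e. {c. (e, c) \<in> endpoints G})"
  have "finite (proj G ` ?B)" using assms endpoints_edge_finite by simp
  moreover have "{n \<in> vertices G. \<exists>e \<in> F. \<exists>x. (e, x) \<in> n} \<subseteq> proj G ` ?B"
  proof
    fix n assume "n \<in> {n \<in> vertices G. \<exists>e \<in> F. \<exists>x. (e, x) \<in> n}"
    then obtain e x where *: "n \<in> vertices G" "e \<in> F" "(e, x) \<in> n" by blast
    then have "(e, x) \<in> endpoints G" using vertex_subset by blast
    then have "(e, x) \<in> ?B" using * by simp
    moreover have "n = proj G (e, x)" using proj_endpoint[OF partition] * by simp
    ultimately show "n \<in> proj G ` ?B" by blast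
  qed
  ultimately show ?thesis using finite_subset by blast
qed

lemma vertices_near_finite:
  assumes "Z \<in> network_points G" shows "finite (vertices_near Z k)"
proof (induction k)
  case 0
  have "finite (fst ` Z)" using network_point_finite[OF assms] by simp
  then show ?case unfolding vertices_near.simps by (rule vertices_over_finite)
next
  case (Suc k)
  have "finite (fst ` n)" if "n \<in> vertices_near Z k" for n
  proof -
    have "n \<in> vertices G" using that by (cases k) auto
    then show ?thesis using network_point_finite vertex_network_point by blast
  qed
  then have "finite (\<Union>n\<in>vertices_near Z k. fst ` n)" using Suc by blast
  then show ?case unfolding vertices_near.simps by (rule vertices_over_finite)
qed

text \<open>Each full edge costs at least \<open>min_len\<close>, and each vertex has finitely many edge ends, so a bounded length
  gives access to finitely many edges. This is the source of compactness in all maximisations below.\<close>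

lemma walk_finite_edges:
  assumes Z: "Z \<in> network_points G"
  shows "finite {e. \<exists>x r. r \<le> R \<and> walk G Z r (e, x)}"
proof -
  let ?K = "nat \<lfloor>R / min_len\<rfloor>"
  let ?F = "fst ` Z \<union> (\<Union>k\<le>?K. \<Union>n\<in>vertices_near Z k. fst ` n)"
  have nv: "n \<in> vertices_near Z k \<Longrightarrow> n \<in> vertices G" for n k by (cases k) auto
  have fin: "finite ?F"
    using network_point_finite[OF Z] vertices_near_finite[OF Z] nv network_point_finite vertex_network_point
    by (intro finite_UnI finite_UN_I finite_imageI) auto
  have "e \<in> ?F" if w: "r \<le> R" "walk G Z r (e, x)" for e x r
  proof -
    have "(\<exists>c. (fst (e, x), c) \<in> Z \<and> \<bar>snd (e, x) - c\<bar> \<le> r) \<or>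
      (\<exists>n r' c. n \<in> vertices G \<and> (\<exists>k. real k * min_len \<le> r' \<and> n \<in> vertices_near Z k) \<and>
        (fst (e, x), c) \<in> n \<and> r' + \<bar>snd (e, x) - c\<bar> \<le> r)"
    proof (rule walk_invariant[OF Z w(2)])
      fix e c x n and r :: real
      assume *: "(e, c) \<in> Z" "n \<in> vertices G" "(e, x) \<in> n" "\<bar>x - c\<bar> \<le> r"
      then have "real 0 * min_len \<le> r \<and> n \<in> vertices_near Z 0" by force
      then show "\<exists>k. real k * min_len \<le> r \<and> n \<in> vertices_near Z k" by blast
    next
      fix e c x n n' and r r' :: real
      assume *: "\<exists>k. real k * min_len \<le> r \<and> n \<in> vertices_near Z k" "n \<in> vertices G" "(e, c) \<in> n"
        "n' \<in> vertices G" "(e, x) \<in> n'" "min_len \<le> \<bar>x - c\<bar>" "r + \<bar>x - c\<bar> \<le> r'"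
      then obtain k where k: "real k * min_len \<le> r" "n \<in> vertices_near Z k" by blast
      have "e \<in> (\<Union>n'\<in>vertices_near Z k. fst ` n')" using k(2) *(3) by force
      then have "n' \<in> vertices_near Z (Suc k)" using * by auto
      moreover have "real (Suc k) * min_len \<le> r'" using k(1) * by (simp add: algebra_simps)
      ultimately show "\<exists>k. real k * min_len \<le> r' \<and> n' \<in> vertices_near Z k" by blast
    qed
    then show ?thesis
    proof (elim disjE exE conjE)
      fix c assume "(fst (e, x), c) \<in> Z"
      then show ?thesis by force
    next
      fix n r' c k assume *: "(fst (e, x), c) \<in> n" "r' + \<bar>snd (e, x) - c\<bar> \<le> r" "real k * min_len \<le> r'"
        "n \<in> vertices_near Z k"
      then have "real k \<le> R / min_len" using w(1) min_len(1) by (simp add: pos_le_divide_eq)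
      then have "k \<le> ?K" by (simp add: le_nat_floor)
      moreover have "e \<in> fst ` n" using *(1) by force
      ultimately show ?thesis using *(4) by blast
    qed
  qed
  then have "{e. \<exists>x r. r \<le> R \<and> walk G Z r (e, x)} \<subseteq> ?F" by blast
  then show ?thesis using fin finite_subset by blast
qed

text \<open>An oscillation bound with an additive error \<open>\<epsilon>\<close> on each edge does not accumulate: on a full edge the
  error is at most \<open>\<epsilon> / min_len\<close> times its length, so only the first and the last, partially covered,
  edges contribute \<open>\<epsilon>\<close>.\<close>

lemma walk_oscillation:
  assumes Z: "Z \<in> network_points G" "z \<in> Z" and w: "walk G Z r a" and eps: "0 \<le> \<epsilon>" "0 \<le> L"
    and glue: "\<And>n a b. n \<in> network_points G \<Longrightarrow> a \<in> n \<Longrightarrow> b \<in> n \<Longrightarrow> v a = v b"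
    and osc: "\<And>e x y. e \<in> edges G \<Longrightarrow> x \<in> edge G e \<Longrightarrow> y \<in> edge G e \<Longrightarrow>
        \<bar>v (e, x) - v (e, y)\<bar> \<le> \<epsilon> + L * \<bar>x - y\<bar>"
  shows "\<bar>v a - v z\<bar> \<le> 2 * \<epsilon> + (L + \<epsilon> / min_len) * r"
proof -
  let ?L = "L + \<epsilon> / min_len"
  have L: "0 \<le> \<epsilon> / min_len" "L \<le> ?L" "0 \<le> ?L" using eps min_len(1) by auto
  have osc': "\<bar>v (e, x) - v (e, y)\<bar> \<le> \<epsilon> + L * \<bar>x - y\<bar>" if "(e, x) \<in> edge_points G" "(e, y) \<in> edge_points G" for e x y
    using osc that by (auto simp: edge_points_def)
  have "(\<exists>c. (fst a, c) \<in> Z \<and> \<bar>snd a - c\<bar> \<le> r) \<or>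
      (\<exists>n r' c. n \<in> vertices G \<and> (\<forall>b\<in>n. \<bar>v b - v z\<bar> \<le> \<epsilon> + ?L * r') \<and>
        (fst a, c) \<in> n \<and> r' + \<bar>snd a - c\<bar> \<le> r)"
  proof (rule walk_invariant[OF Z(1) w])
    fix e c x n and r :: real
    assume *: "(e, c) \<in> Z" "n \<in> vertices G" "(e, x) \<in> n" "\<bar>x - c\<bar> \<le> r"
    have "(e, x) \<in> edge_points G" "(e, c) \<in> edge_points G"
      using * vertex_subset network_point_subset[OF Z(1)] by (auto simp: endpoints_def)
    then have "\<bar>v (e, x) - v (e, c)\<bar> \<le> \<epsilon> + L * \<bar>x - c\<bar>" using osc' by blast
    also have "L * \<bar>x - c\<bar> \<le> ?L * r" using * L eps by (intro mult_mono) auto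
    finally have "\<bar>v (e, x) - v (e, c)\<bar> \<le> \<epsilon> + ?L * r" by simp
    then show "\<forall>b\<in>n. \<bar>v b - v z\<bar> \<le> \<epsilon> + ?L * r"
      using glue[OF Z(1) *(1) Z(2)] glue[OF vertex_network_point[OF *(2)] *(3)] by metis
  next
    fix e c x n n' and r r' :: real
    assume *: "\<forall>b\<in>n. \<bar>v b - v z\<bar> \<le> \<epsilon> + ?L * r" "n \<in> vertices G" "(e, c) \<in> n"
        "n' \<in> vertices G" "(e, x) \<in> n'" "min_len \<le> \<bar>x - c\<bar>" "r + \<bar>x - c\<bar> \<le> r'"
    have "(e, x) \<in> edge_points G" "(e, c) \<in> edge_points G"
      using * vertex_subset by (auto simp: endpoints_def)
    then have "\<bar>v (e, x) - v (e, c)\<bar> \<le> \<epsilon> + L * \<bar>x - c\<bar>" using osc' by blast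
    also have "\<epsilon> = (\<epsilon> / min_len) * min_len" using min_len(1) by simp
    also have "\<dots> \<le> (\<epsilon> / min_len) * \<bar>x - c\<bar>" using * L by (intro mult_left_mono) auto
    finally have "\<bar>v (e, x) - v (e, c)\<bar> \<le> ?L * \<bar>x - c\<bar>" by (simp add: algebra_simps)
    moreover have "\<bar>v (e, c) - v z\<bar> \<le> \<epsilon> + ?L * r" using * by blast
    moreover have "?L * r + ?L * \<bar>x - c\<bar> \<le> ?L * r'"
      using mult_left_mono[OF *(7) L(3)] by (simp add: algebra_simps)
    ultimately have "\<bar>v (e, x) - v z\<bar> \<le> \<epsilon> + ?L * r'" by linarith
    then show "\<forall>b\<in>n'. \<bar>v b - v z\<bar> \<le> \<epsilon> + ?L * r'"
      using glue[OF vertex_network_point[OF *(4)] *(5)] by metis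
  qed
  then show ?thesis
  proof (elim disjE exE conjE)
    fix c assume *: "(fst a, c) \<in> Z" "\<bar>snd a - c\<bar> \<le> r"
    have "\<bar>v a - v (fst a, c)\<bar> \<le> \<epsilon> + L * \<bar>snd a - c\<bar>"
      using osc'[of "fst a" "snd a" c] network_point_subset[OF Z(1)] *(1) walk_edge_points[OF w Z(1)] by auto
    also have "L * \<bar>snd a - c\<bar> \<le> ?L * r" using * L eps by (intro mult_mono) auto
    finally show ?thesis using glue[OF Z(1) *(1) Z(2)] eps by simp
  next
    fix n r' c assume *: "n \<in> vertices G" "\<forall>b\<in>n. \<bar>v b - v z\<bar> \<le> \<epsilon> + ?L * r'" "(fst a, c) \<in> n"
      "r' + \<bar>snd a - c\<bar> \<le> r"
    have "\<bar>v a - v (fst a, c)\<bar> \<le> \<epsilon> + L * \<bar>snd a - c\<bar>"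
      using osc'[of "fst a" "snd a" c] *(1,3) walk_edge_points[OF w Z(1)] vertex_subset by (auto simp: endpoints_def)
    also have "L * \<bar>snd a - c\<bar> \<le> ?L * \<bar>snd a - c\<bar>" using L by (intro mult_right_mono) auto
    finally have "\<bar>v a - v (fst a, c)\<bar> \<le> \<epsilon> + ?L * \<bar>snd a - c\<bar>" by simp
    moreover have "\<bar>v (fst a, c) - v z\<bar> \<le> \<epsilon> + ?L * r'" using * by blast
    moreover have "?L * r' + ?L * \<bar>snd a - c\<bar> \<le> ?L * r"
      using mult_left_mono[OF *(4) L(3)] by (simp add: algebra_simps)
    ultimately show ?thesis by linarith
  qed
qed

text \<open>Along an edge the distance from \<open>Z\<close> is the minimum of functions of slope \<open>\<plusminus>1\<close>, one for each entrance,
  and of \<open>\<bar>x - c\<bar>\<close> if \<open>Z\<close> lies on the edge. A minimum is touched from above by whichever function is active,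
  and \<open>soft\<close> smooths the last one.\<close>

lemma soft_dist_upper:
  assumes Z: "Z \<in> network_points G" and a: "(e, x) \<in> edge_points G"
  obtains m s where "s = 1 \<or> s = - 1"
    "soft \<sigma> (walk_dist G Z (e, x)) = soft \<sigma> (m + s * x)"
    "\<And>y. y \<in> edge G e \<Longrightarrow> soft \<sigma> (walk_dist G Z (e, y)) \<le> soft \<sigma> (m + s * y)"
proof -
  let ?D = "walk_dist G Z"
  have ed: "e \<in> edges G" "x \<in> edge G e" using a by (auto simp: edge_points_def)
  have nn: "0 \<le> ?D (e, y)" if "y \<in> edge G e" for y
    using walk_dist_nonneg[OF Z] that ed by (auto simp: edge_points_def)
  from walk_dist_entrance[OF Z a] show thesis
  proof (elim disjE exE conjE)
    fix c assume c: "(e, c) \<in> Z" "?D (e, x) = \<bar>x - c\<bar>"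
    show thesis
    proof (rule that[of 1 "- c"])
      show "soft \<sigma> (?D (e, x)) = soft \<sigma> (- c + 1 * x)" unfolding c(2) by (simp add: soft_def power2_commute)
      fix y assume y: "y \<in> edge G e"
      have "?D (e, y) \<le> \<bar>y - c\<bar>"
        using walk_dist_along[OF Z, of e c y] walk_dist_start[OF Z c(1)] network_point_subset[OF Z] c(1) y ed
        by (auto simp: edge_points_def abs_minus_commute)
      then show "soft \<sigma> (?D (e, y)) \<le> soft \<sigma> (- c + 1 * y)"
        using nn[OF y] by (intro soft_mono) auto
    qed simp
  next
    fix c assume c: "(e, c) \<in> endpoints G" "?D (e, x) = ?D (e, c) + \<bar>x - c\<bar>"
    show thesis
    proof (rule that[of "inward c" "?D (e, c) - inward c * c"])
      show "inward c = 1 \<or> inward c = - 1" by (rule inward_cases)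
      show "soft \<sigma> (?D (e, x)) = soft \<sigma> (?D (e, c) - inward c * c + inward c * x)"
        unfolding c(2) endpoint_abs[OF c(1) ed(2)] by (simp add: algebra_simps)
      fix y assume y: "y \<in> edge G e"
      have "?D (e, y) \<le> ?D (e, c) + inward c * (y - c)"
        using walk_dist_along[OF Z, of e c y] c(1) y ed endpoint_abs[OF c(1) y]
        by (auto simp: edge_points_def endpoints_def abs_minus_commute)
      then show "soft \<sigma> (?D (e, y)) \<le> soft \<sigma> (?D (e, c) - inward c * c + inward c * y)"
        using nn[OF y] by (intro soft_mono) (auto simp: algebra_simps)
    qed
  qed
qed

end


section \<open>The network distance is bounded by the lengths of walks\<close>

lemma sum_increments_division_le:
  fixes F :: "real \<Rightarrow> real"
  assumes D: "\<D> division_of \<Union>\<D>" "\<Union>\<D> \<subseteq> {0..1}" and F: "mono_on {0..1} F"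
  shows "(\<Sum>K\<in>\<D>. F (Sup K) - F (Inf K)) \<le> F 1 - F 0"
proof -
  obtain q where q: "\<D> \<subseteq> q" "q division_of cbox 0 (1::real)"
    using partial_division_extend_interval[OF D(1), of 0 1] D(2) by auto
  have nn: "0 \<le> F (Sup K) - F (Inf K)" if Kq: "K \<in> q" for K
  proof -
    obtain a b where "K = cbox a b" "K \<noteq> {}" "K \<subseteq> {0..1}"
      using division_ofD(2)[OF q(2) Kq] division_ofD(3)[OF q(2) Kq] division_ofD(4)[OF q(2) Kq]
      by auto
    then have "Sup K = b" "Inf K = a" "a \<le> b" "a \<in> {0..1}" "b \<in> {0..1}" by auto
    then show ?thesis using mono_onD[OF F, of a b] by simp
  qed
  have fin: "finite q" using q(2) by blast
  let ?p = "(\<lambda>K. (Inf K, K)) ` q"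
  have "?p tagged_division_of {0..1}"
    unfolding tagged_division_of
  proof (intro conjI allI impI)
    show "finite ?p" using fin by simp
    fix x K assume xK: "(x, K) \<in> ?p"
    then have K: "K \<in> q" "x = Inf K" by auto
    obtain a b where ab: "K = cbox a b" using division_ofD(4)[OF q(2) K(1)] by blast
    moreover have "K \<noteq> {}" using division_ofD(3)[OF q(2) K(1)] .
    ultimately show "x \<in> K" using K(2) by auto
    show "K \<subseteq> {0..1}" using division_ofD(2)[OF q(2) K(1)] by simp
    show "\<exists>a b. K = cbox a b" using ab by blast
  next
    fix x K y L assume "(x, K) \<in> ?p \<and> (y, L) \<in> ?p \<and> (x, K) \<noteq> (y, L)"
    then have K: "K \<in> q" "L \<in> q" "K \<noteq> L" by auto
    then show "interior K \<inter> interior L = {}" using division_ofD(5)[OF q(2) K(1)] by blast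
  next
    have "{K. \<exists>x. (x, K) \<in> ?p} = q" by auto
    then show "\<Union> {K. \<exists>x. (x, K) \<in> ?p} = {0..1}" using division_ofD(6)[OF q(2)] by simp
  qed
  then have "(\<Sum>(x, K)\<in>?p. F (Sup K) - F (Inf K)) = F 1 - F 0"
    using additive_tagged_division_1[of 0 1 ?p F] by simp
  moreover have "(\<Sum>(x, K)\<in>?p. F (Sup K) - F (Inf K)) = (\<Sum>K\<in>q. F (Sup K) - F (Inf K))"
    by (subst sum.reindex) (auto simp: inj_on_def)
  moreover have "(\<Sum>K\<in>\<D>. F (Sup K) - F (Inf K)) \<le> (\<Sum>K\<in>q. F (Sup K) - F (Inf K))"
    using nn q(1) fin by (intro sum_mono2) auto
  ultimately show ?thesis by simp
qed

text \<open>The length of a path is a supremum over divisions, but it suffices to exhibit one monotone function whose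
  increments dominate the displacements inside the open edges: such increments telescope. Majorants
  concatenate along with paths.\<close>

definition length_majorant :: "'e network \<Rightarrow> (real \<Rightarrow> 'e point) \<Rightarrow> (real \<Rightarrow> real) \<Rightarrow> bool" where
  "length_majorant G \<gamma> F \<longleftrightarrow> mono_on {0..1} F \<and>
     (\<forall>e\<in>edges G. \<forall>s t. 0 \<le> s \<longrightarrow> s \<le> t \<longrightarrow> t \<le> 1 \<longrightarrow>
        \<gamma> ` {s..t} \<subseteq> (\<lambda>x. proj G (e, x)) ` edge_interior G e \<longrightarrow>
        \<bar>edge_coord (\<gamma> t) - edge_coord (\<gamma> s)\<bar> \<le> F t - F s)"

lemma length_majorantD:
  assumes "length_majorant G \<gamma> F" "e \<in> edges G" "0 \<le> s" "s \<le> t" "t \<le> 1"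
    "\<gamma> ` {s..t} \<subseteq> (\<lambda>x. proj G (e, x)) ` edge_interior G e"
  shows "\<bar>edge_coord (\<gamma> t) - edge_coord (\<gamma> s)\<bar> \<le> F t - F s"
  using assms unfolding length_majorant_def by simp

lemma path_length_le:
  assumes "length_majorant G \<gamma> F"
  shows "path_length G \<gamma> \<le> ereal (F 1 - F 0)"
  unfolding path_length_def
proof (rule SUP_least)
  fix \<D> assume "\<D> \<in> {\<D>. \<D> division_of \<Union>\<D> \<and> \<Union>\<D> \<subseteq> {0..1} \<and>
    (\<forall>K\<in>\<D>. \<exists>e\<in>edges G. \<gamma> ` K \<subseteq> (\<lambda>x. proj G (e, x)) ` edge_interior G e)}"
  then have D: "\<D> division_of \<Union>\<D>" "\<Union>\<D> \<subseteq> {0..1}"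
    "\<And>K. K \<in> \<D> \<Longrightarrow> \<exists>e\<in>edges G. \<gamma> ` K \<subseteq> (\<lambda>x. proj G (e, x)) ` edge_interior G e" by auto
  have "(\<Sum>K\<in>\<D>. \<bar>edge_coord (\<gamma> (Sup K)) - edge_coord (\<gamma> (Inf K))\<bar>) \<le> (\<Sum>K\<in>\<D>. F (Sup K) - F (Inf K))"
  proof (rule sum_mono)
    fix K assume K: "K \<in> \<D>"
    obtain a b where "K = cbox a b" "K \<noteq> {}" using division_ofD(3,4)[OF D(1) K] by metis
    then have ab: "K = {a..b}" "a \<le> b" "Sup K = b" "Inf K = a" by auto
    moreover have "K \<subseteq> {0..1}" using D(2) K by blast
    ultimately have "0 \<le> a" "b \<le> 1" by auto
    moreover obtain e where "e \<in> edges G" "\<gamma> ` {a..b} \<subseteq> (\<lambda>x. proj G (e, x)) ` edge_interior G e"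
      using D(3)[OF K] ab(1) by auto
    ultimately show "\<bar>edge_coord (\<gamma> (Sup K)) - edge_coord (\<gamma> (Inf K))\<bar> \<le> F (Sup K) - F (Inf K)"
      unfolding ab(3,4) using length_majorantD[OF assms] ab(2) by blast
  qed
  also have "\<dots> \<le> F 1 - F 0"
    using sum_increments_division_le[OF D(1,2)] assms unfolding length_majorant_def by blast
  finally show "ereal (\<Sum>K\<in>\<D>. \<bar>edge_coord (\<gamma> (Sup K)) - edge_coord (\<gamma> (Inf K))\<bar>) \<le> ereal (F 1 - F 0)"
    by simp
qed

lemma path_length_nonneg: "0 \<le> path_length G \<gamma>"
proof -
  have "ereal (\<Sum>K\<in>{}. \<bar>edge_coord (\<gamma> (Sup K)) - edge_coord (\<gamma> (Inf K))\<bar>) \<le> path_length G \<gamma>"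
    unfolding path_length_def by (rule SUP_upper) simp
  then show ?thesis by (simp add: zero_ereal_def)
qed

context network_graph
begin

lemma segment_in_edge:
  assumes "x \<in> edge G e" "y \<in> edge G e" "0 \<le> \<tau>" "\<tau> \<le> 1"
  shows "x + \<tau> * (y - x) \<in> edge G e"
proof -
  have "x + \<tau> * (y - x) = (1 - \<tau>) *\<^sub>R x + \<tau> *\<^sub>R y" by (simp add: algebra_simps)
  then have "x + \<tau> * (y - x) \<in> closed_segment x y"
    unfolding closed_segment_def using assms by auto
  then show ?thesis
    using edge_convex[of x e y] edge_convex[of y e x] assms
    by (auto simp: closed_segment_eq_real_ivl split: if_splits)
qed

lemma edge_path:
  assumes e: "e \<in> edges G" and xy: "x \<in> edge G e" "y \<in> edge G e"
  shows "continuous_map (top_of_set {1/2..1}) (network_topology G) (\<lambda>t. proj G (e, x + (2 * t - 1) * (y - x)))"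
proof -
  have seg: "x + (2 * t - 1) * (y - x) \<in> edge G e" if t: "t \<in> {1/2..1}" for t :: real
    using segment_in_edge[OF xy] t by auto
  have "continuous_map (top_of_set {1/2..1}) (top_of_set (edge G e)) (\<lambda>t. x + (2 * t - 1) * (y - x))"
    using seg by (auto simp: continuous_map_in_subtopology intro!: continuous_intros)
  moreover have "continuous_map (top_of_set (edge G e)) (edge_topology G) (\<lambda>x. (e, x))"
    unfolding edge_topology_def using e by (rule continuous_map_component_injection)
  ultimately have "continuous_map (top_of_set {1/2..1}) (edge_topology G)
      ((\<lambda>x. (e, x)) \<circ> (\<lambda>t. x + (2 * t - 1) * (y - x)))"
    by (rule continuous_map_compose)
  from continuous_map_compose[OF this quotient_imp_continuous_map[OF quotient_map_proj]]
  show ?thesis by (simp add: comp_def)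
qed

lemma interior_coord:
  assumes "proj G (e, q) \<in> (\<lambda>x. proj G (e', x)) ` edge_interior G e'" "e' \<in> edges G" "(e, q) \<in> edge_points G"
  shows "edge_coord (proj G (e, q)) = q"
proof -
  obtain x where "x \<in> edge_interior G e'" "proj G (e, q) = proj G (e', x)" using assms(1) by blast
  then have "proj G (e, q) = {(e', x)}" using interior_proj assms(2) by simp
  then have "proj G (e, q) = {(e, q)}" using proj_mem[OF assms(3)] by auto
  then show ?thesis by (simp add: edge_coord_def)
qed

text \<open>A segment is appended by running through the path built so far on \<open>[0, 1/2]\<close> and through the segment on
  \<open>[1/2, 1]\<close>.\<close>

lemma walk_path:
  assumes Z: "Z \<in> network_points G" and w: "walk G Z r a"
  shows "\<exists>\<gamma> F. pathin (network_topology G) \<gamma> \<and> \<gamma> 0 = Z \<and> \<gamma> 1 = proj G a \<and>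
    length_majorant G \<gamma> F \<and> F 1 - F 0 = r"
  using w
proof (induction rule: walk.induct)
  case (start a)
  have "pathin (network_topology G) (\<lambda>_. Z)"
    using Z by (simp add: pathin_def topspace_network_topology)
  moreover have "length_majorant G (\<lambda>_. Z) (\<lambda>_. 0)"
    by (auto simp: length_majorant_def mono_on_def)
  moreover have "Z = proj G a" using network_point_proj[OF Z start] by simp
  ultimately show ?case by (intro exI[of _ "\<lambda>_. Z"] exI[of _ "\<lambda>_. 0"]) auto
next
  case (jump r a n b)
  then have "proj G a = proj G b" using proj_endpoint[OF partition] by metis
  then show ?case using jump.IH by simp
next
  case (along r e x y)
  then obtain \<gamma> F where g: "pathin (network_topology G) \<gamma>" "\<gamma> 0 = Z" "\<gamma> 1 = proj G (e, x)"
    "length_majorant G \<gamma> F" "F 1 - F 0 = r" by blast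
  have ed: "e \<in> edges G" "x \<in> edge G e" "y \<in> edge G e"
    using walk_edge_points[OF along.hyps(1) Z] along.hyps(2) by (auto simp: edge_points_def)
  define q where "q t = x + (2 * t - 1) * (y - x)" for t :: real
  define \<gamma>' where "\<gamma>' t = (if t \<le> 1/2 then \<gamma> (2 * t) else proj G (e, q t))" for t
  define F' where "F' t = (if t \<le> 1/2 then F (2 * t) else F 1 + (2 * t - 1) * \<bar>x - y\<bar>)" for t
  have late: "\<gamma>' t = proj G (e, q t)" "F' t = F 1 + (2 * t - 1) * \<bar>x - y\<bar>" if "1/2 \<le> t" for t
  proof -
    have "\<gamma>' t = proj G (e, q t) \<and> F' t = F 1 + (2 * t - 1) * \<bar>x - y\<bar>"
    proof (cases "t = 1/2")
      case True
      then have "2 * t = 1" "t \<le> 1/2" by auto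
      then show ?thesis using g(3) by (simp add: \<gamma>'_def F'_def q_def)
    next
      case False
      then have "\<not> t \<le> 1/2" using that by simp
      then show ?thesis by (simp only: \<gamma>'_def F'_def if_False simp_thms)
    qed
    then show "\<gamma>' t = proj G (e, q t)" "F' t = F 1 + (2 * t - 1) * \<bar>x - y\<bar>" by auto
  qed
  have qE: "(e, q t) \<in> edge_points G" if "1/2 \<le> t" "t \<le> 1" for t
    using segment_in_edge[OF ed(2,3), of "2 * t - 1"] ed(1) that by (simp add: q_def edge_points_def)
  have "pathin (network_topology G) \<gamma>'"
    unfolding pathin_def \<gamma>'_def
  proof (rule continuous_map_cases_le)
    have *: "subtopology (top_of_set {0..1}) {t \<in> topspace (top_of_set {0..1}). t \<le> 1/2} = top_of_set {0..1/2::real}"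
      by (simp add: subtopology_subtopology) (rule arg_cong[where f = top_of_set], auto)
    have "continuous_map (top_of_set {0..1/2}) (top_of_set {0..1::real}) (\<lambda>t. 2 * t)"
      by (auto simp: continuous_map_in_subtopology intro!: continuous_intros)
    from continuous_map_compose[OF this g(1)[unfolded pathin_def]]
    show "continuous_map (subtopology (top_of_set {0..1}) {t \<in> topspace (top_of_set {0..1}). t \<le> 1/2})
      (network_topology G) (\<lambda>t. \<gamma> (2 * t))" unfolding * by (simp add: comp_def)
    have **: "subtopology (top_of_set {0..1}) {t \<in> topspace (top_of_set {0..1}). 1/2 \<le> t} = top_of_set {1/2..1::real}"
      by (simp add: subtopology_subtopology) (rule arg_cong[where f = top_of_set], auto)
    show "continuous_map (subtopology (top_of_set {0..1}) {t \<in> topspace (top_of_set {0..1}). 1/2 \<le> t})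
      (network_topology G) (\<lambda>t. proj G (e, q t))"
      unfolding ** q_def by (rule edge_path[OF ed])
    show "\<gamma> (2 * t) = proj G (e, q t)" if "t = 1/2" for t
    proof -
      have "2 * t = 1" using that by simp
      then show ?thesis using g(3) by (simp add: q_def)
    qed
  qed auto
  moreover have "length_majorant G \<gamma>' F'"
    unfolding length_majorant_def
  proof (intro conjI ballI allI impI)
    have Fm: "F s \<le> F t" if "0 \<le> s" "s \<le> t" "t \<le> 1" for s t
      using g(4) that unfolding length_majorant_def by (auto intro: mono_onD)
    show "mono_on {0..1} F'"
    proof (rule mono_onI)
      fix s t :: real assume st: "s \<in> {0..1}" "t \<in> {0..1}" "s \<le> t"
      show "F' s \<le> F' t"
      proof (cases "1/2 \<le> s")
        case True
        then show ?thesis using late st by (auto intro!: mult_right_mono)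
      next
        case False
        then have s: "F' s = F (2 * s)" by (simp add: F'_def)
        show ?thesis
        proof (cases "t \<le> 1/2")
          case True
          then show ?thesis using s st Fm by (simp add: F'_def)
        next
          case f: False
          have "F (2 * s) \<le> F 1" using Fm[of "2 * s" 1] False st by simp
          moreover have "0 \<le> (2 * t - 1) * \<bar>x - y\<bar>" using f by simp
          ultimately show ?thesis using s late(2)[of t] f by linarith
        qed
      qed
    qed
    fix e' s t assume e': "e' \<in> edges G" and st: "0 \<le> s" "s \<le> t" "t \<le> 1"
      and sub: "\<gamma>' ` {s..t} \<subseteq> (\<lambda>x. proj G (e', x)) ` edge_interior G e'"
    let ?I = "(\<lambda>x. proj G (e', x)) ` edge_interior G e'"
    have early: "\<bar>edge_coord (\<gamma>' t) - edge_coord (\<gamma>' s)\<bar> \<le> F' t - F' s"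
      if "0 \<le> s" "s \<le> t" "t \<le> 1/2" "\<gamma>' ` {s..t} \<subseteq> ?I" for s t
    proof -
      have "\<gamma> ` {2 * s..2 * t} \<subseteq> ?I"
      proof
        fix z assume "z \<in> \<gamma> ` {2 * s..2 * t}"
        then obtain v where "v \<in> {2 * s..2 * t}" "z = \<gamma> v" by blast
        then have "z = \<gamma>' (v / 2)" "v / 2 \<in> {s..t}" using that by (auto simp: \<gamma>'_def)
        then show "z \<in> ?I" using that(4) by blast
      qed
      then have "\<bar>edge_coord (\<gamma> (2 * t)) - edge_coord (\<gamma> (2 * s))\<bar> \<le> F (2 * t) - F (2 * s)"
        using length_majorantD[OF g(4) e', of "2 * s" "2 * t"] that by simp
      then show ?thesis using that by (simp add: \<gamma>'_def F'_def)
    qed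
    have late': "\<bar>edge_coord (\<gamma>' t) - edge_coord (\<gamma>' s)\<bar> \<le> F' t - F' s"
      if st: "1/2 \<le> s" "s \<le> t" "t \<le> 1" "\<gamma>' ` {s..t} \<subseteq> ?I" for s t
    proof -
      have "proj G (e, q v) \<in> ?I" if "v \<in> {s..t}" for v
        using st that late(1)[of v] by (metis atLeastAtMost_iff image_subset_iff order_trans)
      then have coord: "edge_coord (\<gamma>' v) = q v" if "v \<in> {s..t}" for v
        using interior_coord[of e "q v" e'] qE[of v] e' late(1)[of v] st that by auto
      have "edge_coord (\<gamma>' t) = q t" "edge_coord (\<gamma>' s) = q s" using coord st by auto
      then have "edge_coord (\<gamma>' t) - edge_coord (\<gamma>' s) = 2 * (t - s) * (y - x)"
        using st by (simp add: q_def algebra_simps)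
      then have "\<bar>edge_coord (\<gamma>' t) - edge_coord (\<gamma>' s)\<bar> = 2 * (t - s) * \<bar>x - y\<bar>"
        using st by (simp add: abs_mult abs_minus_commute)
      then show ?thesis using late(2)[of s] late(2)[of t] st by (simp add: algebra_simps)
    qed
    show "\<bar>edge_coord (\<gamma>' t) - edge_coord (\<gamma>' s)\<bar> \<le> F' t - F' s"
    proof (cases "t \<le> 1/2 \<or> 1/2 \<le> s")
      case True
      then show ?thesis using early[of s t] late'[of s t] st sub by blast
    next
      case False
      then have "\<gamma>' ` {s..1/2} \<subseteq> ?I" "\<gamma>' ` {1/2..t} \<subseteq> ?I" using sub by auto
      then show ?thesis using early[of s "1/2"] late'[of "1/2" t] False st by linarith
    qed
  qed
  moreover have "\<gamma>' 0 = Z" "\<gamma>' 1 = proj G (e, y)" "F' 1 - F' 0 = r + \<bar>x - y\<bar>"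
    using g by (auto simp: \<gamma>'_def F'_def q_def)
  ultimately show ?case by blast
qed

lemma network_dist_le_walk:
  assumes Z: "Z \<in> network_points G" and w: "walk G Z r a"
  shows "network_dist G Z (proj G a) \<le> r"
proof -
  obtain \<gamma> F where g: "pathin (network_topology G) \<gamma>" "\<gamma> 0 = Z" "\<gamma> 1 = proj G a"
    "length_majorant G \<gamma> F" "F 1 - F 0 = r" using walk_path[OF assms] by blast
  let ?I = "INF \<gamma> \<in> {\<gamma>. pathin (network_topology G) \<gamma> \<and> \<gamma> 0 = Z \<and> \<gamma> 1 = proj G a}. path_length G \<gamma>"
  have "?I \<le> path_length G \<gamma>" using g by (intro INF_lower) auto
  also have "\<dots> \<le> ereal r" using path_length_le[OF g(4)] g(5) by simp
  finally have "?I \<le> ereal r" .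
  moreover have "0 \<le> ?I" by (intro INF_greatest path_length_nonneg)
  ultimately show ?thesis unfolding network_dist_def
    using real_of_ereal_positive_mono[of ?I "ereal r"] by simp
qed

lemma network_dist_le_walk_dist:
  assumes Z: "Z \<in> network_points G" and a: "a \<in> edge_points G"
  shows "network_dist G Z (proj G a) \<le> walk_dist G Z a"
proof (rule field_le_epsilon)
  fix d :: real assume "0 < d"
  then have "walk_dist G Z a < walk_dist G Z a + d" by simp
  then obtain r where "r < walk_dist G Z a + d" "walk G Z r a" using walk_dist_less[OF Z a] by blast
  then show "network_dist G Z (proj G a) \<le> walk_dist G Z a + d"
    using network_dist_le_walk[OF Z] by fastforce
qed

end


section \<open>Upper semicontinuous functions\<close>

definition usc_on :: "'a::topological_space set \<Rightarrow> ('a \<Rightarrow> real) \<Rightarrow> bool" where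
  "usc_on S f \<longleftrightarrow> (\<forall>x\<in>S. \<forall>c>f x. \<exists>A. open A \<and> x \<in> A \<and> (\<forall>y\<in>A \<inter> S. f y < c))"

lemma usc_onE:
  assumes "usc_on S f" "x \<in> S" "f x < c"
  obtains A where "open A" "x \<in> A" "\<And>y. y \<in> A \<Longrightarrow> y \<in> S \<Longrightarrow> f y < c"
proof -
  have "\<exists>A. open A \<and> x \<in> A \<and> (\<forall>y\<in>A \<inter> S. f y < c)"
    using assms unfolding usc_on_def by simp
  then show ?thesis using that by (elim exE conjE) simp
qed

lemma usc_on_add:
  assumes "usc_on S f" "usc_on S g" shows "usc_on S (\<lambda>x. f x + g x)"
  unfolding usc_on_def
proof (intro ballI allI impI)
  fix x c assume x: "x \<in> S" "f x + g x < c"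
  define d where "d = (c - (f x + g x)) / 2"
  have d: "0 < d" using x by (simp add: d_def)
  have lt: "f x < f x + d" "g x < g x + d" using d by auto
  obtain A where A: "open A" "x \<in> A" "\<And>y. y \<in> A \<Longrightarrow> y \<in> S \<Longrightarrow> f y < f x + d"
    using usc_onE[OF assms(1) x(1) lt(1)] by blast
  obtain B where B: "open B" "x \<in> B" "\<And>y. y \<in> B \<Longrightarrow> y \<in> S \<Longrightarrow> g y < g x + d"
    using usc_onE[OF assms(2) x(1) lt(2)] by blast
  have "f y + g y < c" if "y \<in> A \<inter> B \<inter> S" for y
    using A(3)[of y] B(3)[of y] that d_def by (simp add: field_simps)
  then show "\<exists>A. open A \<and> x \<in> A \<and> (\<forall>y\<in>A \<inter> S. f y + g y < c)"
    using A(1,2) B(1,2) by (intro exI[of _ "A \<inter> B"]) auto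
qed

lemma usc_on_continuous:
  assumes "continuous_on S f" shows "usc_on S f"
  unfolding usc_on_def
proof (intro ballI allI impI)
  fix x c assume x: "x \<in> S" "f x < c"
  then obtain A where "open A" "x \<in> A" "\<forall>y\<in>S. y \<in> A \<longrightarrow> f y \<in> {..<c}"
    using assms unfolding continuous_on_topological by (metis lessThan_iff open_lessThan)
  then show "\<exists>A. open A \<and> x \<in> A \<and> (\<forall>y\<in>A \<inter> S. f y < c)" by auto
qed

lemma usc_on_compose:
  assumes "usc_on S f" "continuous_on Q g" "g ` Q \<subseteq> S" shows "usc_on Q (\<lambda>x. f (g x))"
  unfolding usc_on_def
proof (intro ballI allI impI)
  fix x c assume x: "x \<in> Q" "f (g x) < c"
  then obtain A where A: "open A" "g x \<in> A" "\<And>y. y \<in> A \<Longrightarrow> y \<in> S \<Longrightarrow> f y < c"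
    using usc_onE[OF assms(1)] assms(3) by blast
  then obtain B where "open B" "x \<in> B" "\<forall>y\<in>Q. y \<in> B \<longrightarrow> g y \<in> A"
    using assms(2) x(1) unfolding continuous_on_topological by metis
  then show "\<exists>B. open B \<and> x \<in> B \<and> (\<forall>y\<in>B \<inter> Q. f (g y) < c)"
    using A(3) assms(3) by (intro exI[of _ B]) auto
qed

lemma usc_on_subset: "usc_on S f \<Longrightarrow> T \<subseteq> S \<Longrightarrow> usc_on T f"
  using usc_on_compose[of S f T "\<lambda>x. x"] by (simp add: continuous_on_id)

lemma usc_attains_max:
  assumes "compact S" "S \<noteq> {}" "usc_on S f"
  shows "\<exists>x. x \<in> S \<and> (\<forall>y\<in>S. f y \<le> f x)"
proof (rule ccontr)
  assume "\<not> ?thesis"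
  then have "\<forall>x\<in>S. \<exists>y\<in>S. f x < f y" by (meson not_le)
  then obtain m where m: "\<And>x. x \<in> S \<Longrightarrow> m x \<in> S \<and> f x < f (m x)" by metis
  have "\<forall>x\<in>S. \<exists>A. open A \<and> x \<in> A \<and> (\<forall>y\<in>A \<inter> S. f y < f (m x))"
    using assms(3) m unfolding usc_on_def by blast
  then obtain A where A: "\<And>x. x \<in> S \<Longrightarrow> open (A x) \<and> x \<in> A x \<and> (\<forall>y\<in>A x \<inter> S. f y < f (m x))"
    by metis
  obtain F where F: "F \<subseteq> S" "finite F" "S \<subseteq> (\<Union>x\<in>F. A x)"
    using compactE_image[OF assms(1), of S A] A by blast
  then have "F \<noteq> {}" using assms(2) by auto
  then have "Max ((\<lambda>x. f (m x)) ` F) \<in> (\<lambda>x. f (m x)) ` F" using F(2) by (intro Max_in) auto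
  then obtain z where z: "z \<in> F" "f (m z) = Max ((\<lambda>x. f (m x)) ` F)" by auto
  have "m z \<in> S" using m z(1) F(1) by blast
  then obtain x where x: "x \<in> F" "m z \<in> A x" using F(3) by blast
  have "f (m z) < f (m x)" using A[of x] x F(1) \<open>m z \<in> S\<close> by blast
  moreover have "f (m x) \<le> f (m z)" unfolding z(2) using x(1) F(2) by simp
  ultimately show False by simp
qed

lemma usc_sequence:
  assumes "usc_on S f" "x \<in> S" "\<And>k. X k \<in> S" "X \<longlonglongrightarrow> x" "f x < c"
  shows "\<forall>\<^sub>F k in sequentially. f (X k) < c"
proof -
  obtain A where "open A" "x \<in> A" "\<And>y. y \<in> A \<Longrightarrow> y \<in> S \<Longrightarrow> f y < c"
    using usc_onE[OF assms(1,2,5)] by blast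
  then show ?thesis
    using topological_tendstoD[OF assms(4), of A] assms(3) by (auto elim: eventually_mono)
qed

text \<open>Along a sequence of counterexamples \<open>k * P\<close> stays bounded, so a limit point lies on \<open>P = 0\<close>, where upper
  semicontinuity keeps the value at least \<open>m\<close>; only \<open>z0\<close> is left.\<close>

lemma penalisation:
  fixes F P :: "'a::metric_space \<Rightarrow> real"
  assumes K: "compact K" and F: "usc_on K F" and P: "continuous_on K P" "\<And>z. z \<in> K \<Longrightarrow> 0 \<le> P z"
    and strict: "\<And>z. z \<in> K \<Longrightarrow> P z = 0 \<Longrightarrow> z \<noteq> z0 \<Longrightarrow> F z < m"
    and r: "0 < r"
  shows "\<exists>N. \<forall>k\<ge>N. \<forall>z\<in>K. m \<le> F z - real k * P z \<longrightarrow> dist z z0 < r"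
proof (rule ccontr)
  assume "\<not> ?thesis"
  then have "\<forall>N. \<exists>k z. N \<le> k \<and> z \<in> K \<and> m \<le> F z - real k * P z \<and> r \<le> dist z z0"
    by (meson not_less)
  then obtain k z where kz: "\<And>N. N \<le> k N" "\<And>N. z N \<in> K" "\<And>N. m \<le> F (z N) - real (k N) * P (z N)"
    "\<And>N. r \<le> dist (z N) z0" by metis
  have "K \<noteq> {}" using kz(2) by auto
  from usc_attains_max[OF K this F] obtain B where B0: "\<forall>y\<in>K. F y \<le> B" by blast
  note B = B0[rule_format]
  obtain l s where l: "l \<in> K" "strict_mono s" "(z \<circ> s) \<longlonglongrightarrow> l"
    using K kz(2) unfolding compact_def by blast
  have zl: "(\<lambda>N. z (s N)) \<longlonglongrightarrow> l" using l(3) by (simp add: comp_def)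
  have "(\<lambda>N. P (z (s N))) \<longlonglongrightarrow> P l"
    using continuous_on_tendsto_compose[OF P(1) zl l(1)] kz(2) by simp
  moreover have "(\<lambda>N. P (z (s N))) \<longlonglongrightarrow> 0"
  proof (rule tendsto_sandwich[of "\<lambda>_. 0" _ _ "\<lambda>N. \<bar>B - m\<bar> * inverse (real N)"])
    show "\<forall>\<^sub>F N in sequentially. P (z (s N)) \<le> \<bar>B - m\<bar> * inverse (real N)"
    proof (rule eventually_sequentiallyI[of 1])
      fix N :: nat assume N: "1 \<le> N"
      have "real N * P (z (s N)) \<le> real (k (s N)) * P (z (s N))"
        using kz(1)[of "s N"] strict_mono_imp_increasing[OF l(2), of N] P(2)[OF kz(2)]
        by (intro mult_right_mono) auto
      also have "\<dots> \<le> \<bar>B - m\<bar>" using kz(3)[of "s N"] B[OF kz(2), of "s N"] by simp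
      finally show "P (z (s N)) \<le> \<bar>B - m\<bar> * inverse (real N)" using N by (simp add: field_simps)
    qed
    show "(\<lambda>N. \<bar>B - m\<bar> * inverse (real N)) \<longlonglongrightarrow> 0"
      using tendsto_mult_right_zero[OF lim_inverse_n] by blast
  qed (use P(2) kz(2) in auto)
  ultimately have "P l = 0" using LIMSEQ_unique by blast
  moreover have "r \<le> dist l z0"
    using kz(4) by (intro tendsto_lowerbound[OF tendsto_dist[OF zl tendsto_const]]) auto
  then have "l \<noteq> z0" using r by auto
  ultimately have "F l < m" using strict l(1) by blast
  then have "\<forall>\<^sub>F N in sequentially. F (z (s N)) < m"
    using usc_sequence[OF F l(1) _ zl] kz(2) by blast
  then obtain N where "F (z (s N)) < m" by (meson eventually_sequentially order_refl)
  moreover have "0 \<le> real (k (s N)) * P (z (s N))" using P(2)[OF kz(2)] by simp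
  ultimately show False using kz(3)[of "s N"] by simp
qed


section \<open>Semicontinuous envelopes in coordinates\<close>

text \<open>The upper envelope as a real function of the edge coordinates. The lower envelope of \<open>w\<close> is handled as
  the upper envelope of \<open>-w\<close>.\<close>

definition upper_env :: "'e network \<Rightarrow> real \<Rightarrow> (real \<Rightarrow> 'e point \<Rightarrow> real) \<Rightarrow> real \<Rightarrow> 'e \<times> real \<Rightarrow> real" where
  "upper_env G T u t a = real_of_ereal (usc_env G T u t (proj G a))"

lemma lsc_env_uminus: "lsc_env G T w t z = - usc_env G T (\<lambda>t z. - w t z) t z"
proof -
  have "(\<lambda>(s, y). ereal (- w s y)) = (\<lambda>p. - (case p of (s, y) \<Rightarrow> ereal (w s y)))" by auto
  then show ?thesis unfolding lsc_env_def usc_env_def by (simp add: ereal_Limsup_uminus)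
qed

lemma locally_bounded_uminus: "locally_bounded G T w \<Longrightarrow> locally_bounded G T (\<lambda>t z. - w t z)"
  by (simp add: locally_bounded_def)

context network_graph
begin

lemma topspace_cylinder: "topspace (cylinder G T) = {0..<T} \<times> network_points G"
  by (simp add: cylinder_def topspace_network_topology)

lemma usc_env_ge:
  assumes "t \<in> {0..<T}" "z \<in> network_points G" shows "ereal (u t z) \<le> usc_env G T u t z"
  unfolding usc_env_def Limsup_def
proof (rule INF_greatest)
  fix P assume "P \<in> {P. eventually P (nhdsin (cylinder G T) (t, z))}"
  then have "P (t, z)" using assms by (auto simp: eventually_nhdsin topspace_cylinder)
  then show "ereal (u t z) \<le> (SUP x\<in>Collect P. case x of (s, y) \<Rightarrow> ereal (u s y))"
    by (intro SUP_upper2[of "(t, z)"]) auto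
qed

lemma usc_env_le:
  assumes tz: "t \<in> {0..<T}" "z \<in> network_points G"
    and \<rho>: "isolating z \<rho>"
    and le: "\<And>s b. s \<in> {0..<T} \<Longrightarrow> b \<in> coord_nbhd G z \<rho> \<Longrightarrow> u s (proj G b) \<le> B"
  shows "usc_env G T u t z \<le> ereal B"
proof -
  let ?O = "{0..<T} \<times> proj G ` coord_nbhd G z \<rho>"
  have "openin (cylinder G T) ?O"
    unfolding cylinder_def openin_prod_Times_iff using openin_coord_nbhd[OF tz(2) \<rho>] by simp
  moreover obtain a where "a \<in> z" using network_point_nonempty[OF tz(2)] by blast
  then have "(t, z) \<in> ?O"
    using network_point_proj[OF tz(2)] coord_nbhd_self[OF tz(2)] \<rho> tz(1) unfolding isolating_def by blast
  ultimately have "\<forall>\<^sub>F (s, y) in nhdsin (cylinder G T) (t, z). u s y \<le> B"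
    unfolding eventually_nhdsin using le by (intro disjI2 exI[of _ ?O]) auto
  then show ?thesis unfolding usc_env_def by (intro Limsup_bounded) (auto elim: eventually_mono)
qed

lemma usc_env_finite:
  assumes u: "locally_bounded G T u" and tz: "t \<in> {0..<T}" "z \<in> network_points G"
  shows "\<bar>usc_env G T u t z\<bar> \<noteq> \<infinity>"
proof -
  obtain B where "\<forall>\<^sub>F (s, y) in nhdsin (cylinder G T) (t, z). \<bar>u s y\<bar> \<le> B"
    using u tz unfolding locally_bounded_def by blast
  then have "usc_env G T u t z \<le> ereal B"
    unfolding usc_env_def by (intro Limsup_bounded) (auto elim: eventually_mono)
  then show ?thesis using usc_env_ge[OF tz, of u] by (cases "usc_env G T u t z") auto
qed

lemma upper_env_eq:
  assumes "locally_bounded G T u" "t \<in> {0..<T}" "a \<in> edge_points G"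
  shows "usc_env G T u t (proj G a) = ereal (upper_env G T u t a)"
  using usc_env_finite[OF assms(1,2) proj_network_point[OF assms(3)]]
  by (simp add: upper_env_def ereal_real')

lemma upper_env_ge:
  assumes "locally_bounded G T u" "t \<in> {0..<T}" "a \<in> edge_points G"
  shows "u t (proj G a) \<le> upper_env G T u t a"
  using usc_env_ge[OF assms(2) proj_network_point[OF assms(3)], of u]
  unfolding upper_env_eq[OF assms] by simp

lemma upper_env_point:
  assumes "z \<in> network_points G" "a \<in> z" "b \<in> z"
  shows "upper_env G T u t a = upper_env G T u t b"
  using network_point_proj[OF assms(1)] assms by (simp add: upper_env_def)

lemma upper_env_usc:
  assumes u: "locally_bounded G T u" and e: "e \<in> edges G"
  shows "usc_on ({0..<T} \<times> edge G e) (\<lambda>(t, x). upper_env G T u t (e, x))"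
  unfolding usc_on_def
proof (intro ballI allI impI)
  fix p c assume "p \<in> {0..<T} \<times> edge G e" and lt: "(case p of (t, x) \<Rightarrow> upper_env G T u t (e, x)) < c"
  then obtain t x where p: "p = (t, x)" "t \<in> {0..<T}" "x \<in> edge G e" by auto
  have a: "(e, x) \<in> edge_points G" using p e by (simp add: edge_points_def)
  let ?z = "proj G (e, x)"
  have z: "?z \<in> network_points G" using proj_network_point[OF a] .
  obtain c' where c': "upper_env G T u t (e, x) < c'" "c' < c" using lt p(1) dense by auto
  have "usc_env G T u t ?z < ereal c'" using upper_env_eq[OF u p(2) a] c' by simp
  then have "\<forall>\<^sub>F (s, y) in nhdsin (cylinder G T) (t, ?z). u s y < c'"
    unfolding usc_env_def by (drule_tac Limsup_lessD) (auto elim: eventually_mono)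
  then obtain O' where O': "openin (cylinder G T) O'" "(t, ?z) \<in> O'" "\<And>s y. (s, y) \<in> O' \<Longrightarrow> u s y < c'"
    unfolding eventually_nhdsin using p(2) z by (auto simp: topspace_cylinder)
  have "\<forall>s y. (s, y) \<in> O' \<longrightarrow> (\<exists>V N. openin (top_of_set {0..<T}) V \<and> openin (network_topology G) N \<and>
      s \<in> V \<and> y \<in> N \<and> V \<times> N \<subseteq> O')"
    using O'(1) unfolding cylinder_def openin_prod_topology_alt .
  from this[rule_format, OF O'(2)] obtain V N where VN: "openin (top_of_set {0..<T}) V"
    "openin (network_topology G) N" "t \<in> V" "?z \<in> N" "V \<times> N \<subseteq> O'"
    by (elim exE conjE)
  obtain V' where V': "open V'" "V = {0..<T} \<inter> V'" using VN(1) by (auto simp: openin_open)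
  obtain \<rho> where \<rho>: "0 < \<rho>" "\<And>b. b \<in> coord_nbhd G ?z \<rho> \<Longrightarrow> proj G b \<in> N"
    using coord_nbhd_in_open[OF VN(2,4)] by blast
  have "upper_env G T u s (e, y) < c" if sy: "(s, y) \<in> V' \<times> ball x \<rho>" "s \<in> {0..<T}" "y \<in> edge G e" for s y
  proof -
    have "(e, y) \<in> coord_nbhd G ?z \<rho>"
      using sy proj_mem[OF a] by (auto simp: coord_nbhd_def dist_real_def abs_minus_commute)
    then have in_O: "(s, proj G (e, y)) \<in> O'" using \<rho>(2) V' VN(5) sy by blast
    then have "\<forall>\<^sub>F (s, y) in nhdsin (cylinder G T) (s, proj G (e, y)). u s y < c'"
      unfolding eventually_nhdsin using O' by (intro disjI2 exI[of _ O']) auto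
    then have "usc_env G T u s (proj G (e, y)) \<le> ereal c'"
      unfolding usc_env_def by (intro Limsup_bounded) (auto elim: eventually_mono)
    then show ?thesis using upper_env_eq[OF u sy(2), of "(e, y)"] sy(3) e c'(2) by (simp add: edge_points_def)
  qed
  then show "\<exists>A. open A \<and> p \<in> A \<and> (\<forall>q\<in>A \<inter> {0..<T} \<times> edge G e. (case q of (t, x) \<Rightarrow> upper_env G T u t (e, x)) < c)"
    using V' VN(3) \<rho>(1) p by (intro exI[of _ "V' \<times> ball x \<rho>"]) (auto intro: open_Times)
qed

lemma upper_env_growth:
  assumes u: "locally_bounded G T u" and t: "t \<in> {0..<T}" and a: "a \<in> edge_points G"
    and x0: "x0 \<in> network_points G" and C: "0 < C"
    and le: "\<And>t x. t \<in> {0..<T} \<Longrightarrow> x \<in> network_points G \<Longrightarrow> u t x \<le> C * (1 + network_dist G x0 x)"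
  shows "upper_env G T u t a \<le> C * (1 + walk_dist G x0 a)"
proof (rule field_le_epsilon)
  fix d :: real assume d: "0 < d"
  let ?z = "proj G a"
  have z: "?z \<in> network_points G" using proj_network_point[OF a] .
  obtain \<rho>0 where \<rho>0: "isolating ?z \<rho>0" using isolating_exists[OF z] by blast
  define \<rho> where "\<rho> = min \<rho>0 (d / C)"
  have \<rho>: "isolating ?z \<rho>" "\<rho> \<le> d / C"
    using isolating_mono[OF \<rho>0, of \<rho>] \<rho>0 d C by (auto simp: \<rho>_def isolating_def)
  have "u s (proj G b) \<le> C * (1 + walk_dist G x0 a) + d" if sb: "s \<in> {0..<T}" "b \<in> coord_nbhd G ?z \<rho>" for s b
  proof -
    obtain e y c where b: "b = (e, y)" "y \<in> edge G e" "(e, c) \<in> ?z" "\<bar>y - c\<bar> < \<rho>"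
      using sb(2) unfolding coord_nbhd_def by blast
    have ec: "(e, c) \<in> edge_points G" using b(3) network_point_subset[OF z] by blast
    then have bE: "b \<in> edge_points G" using b by (simp add: edge_points_def)
    have "network_dist G x0 (proj G b) \<le> walk_dist G x0 b" using network_dist_le_walk_dist[OF x0 bE] .
    also have "\<dots> \<le> walk_dist G x0 (e, c) + \<bar>c - y\<bar>"
      using walk_dist_along[OF x0 ec] bE b(1) by blast
    also have "walk_dist G x0 (e, c) = walk_dist G x0 a"
      using walk_dist_point[OF x0 z b(3) proj_mem[OF a]] .
    finally have "network_dist G x0 (proj G b) \<le> walk_dist G x0 a + d / C" using b(4) \<rho>(2) by linarith
    then have "C * (1 + network_dist G x0 (proj G b)) \<le> C * (1 + (walk_dist G x0 a + d / C))"
      using C by (intro mult_left_mono) auto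
    also have "\<dots> = C * (1 + walk_dist G x0 a) + d" using C by (simp add: field_simps)
    finally show ?thesis using le[OF sb(1) proj_network_point[OF bE]] by linarith
  qed
  then have "usc_env G T u t ?z \<le> ereal (C * (1 + walk_dist G x0 a) + d)"
    by (rule usc_env_le[OF t z \<rho>(1)])
  then show "upper_env G T u t a \<le> C * (1 + walk_dist G x0 a) + d"
    using upper_env_eq[OF u t a] by simp
qed

end


section \<open>Local test functions\<close>

text \<open>Nested squares of positive parts: \<open>2 - s\<^sup>2\<close> is at least \<open>1\<close> for \<open>\<bar>s\<bar> \<le> 1\<close> and nonpositive for \<open>\<bar>s\<bar> \<ge> 2\<close>, which
  makes the function exactly \<open>1\<close> and exactly \<open>0\<close> there, and \<open>x \<mapsto> (max 0 x)\<^sup>2\<close> is \<open>C\<^sup>1\<close>.\<close>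

definition cutoff :: "real \<Rightarrow> real" where
  "cutoff s = 1 - (max 0 (1 - (max 0 (2 - s\<^sup>2))\<^sup>2))\<^sup>2"

definition cutoff' :: "real \<Rightarrow> real" where
  "cutoff' s = - 8 * max 0 (1 - (max 0 (2 - s\<^sup>2))\<^sup>2) * max 0 (2 - s\<^sup>2) * s"

lemma square_pos_part_deriv: "((\<lambda>x. (max 0 x)\<^sup>2) has_real_derivative 2 * max 0 x) (at (x::real))"
proof -
  consider "x < 0" | "x = 0" | "0 < x" by linarith
  then show ?thesis
  proof cases
    case 1
    have "((\<lambda>x. 0) has_real_derivative 0) (at x)" by simp
    then have "((\<lambda>x. (max 0 x)\<^sup>2) has_real_derivative 0) (at x)"
      by (rule has_field_derivative_transform_within_open[of _ _ _ "{..<0}"]) (use 1 in auto)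
    then show ?thesis using 1 by simp
  next
    case 2
    have "((\<lambda>h::real. max 0 h) \<longlongrightarrow> max 0 0) (at 0)" by (intro tendsto_intros)
    moreover have "\<forall>\<^sub>F h::real in at 0. max 0 h = ((max 0 (0 + h))\<^sup>2 - (max 0 0)\<^sup>2) / h"
      by (simp add: eventually_at_filter power2_eq_square max_def)
    ultimately have "((\<lambda>h::real. ((max 0 (0 + h))\<^sup>2 - (max 0 0)\<^sup>2) / h) \<longlongrightarrow> 0) (at 0)"
      by (simp add: Lim_transform_eventually)
    then show ?thesis unfolding 2 by (simp add: DERIV_def)
  next
    case 3
    have "((\<lambda>x. x\<^sup>2) has_real_derivative 2 * x) (at x)" by (auto intro!: derivative_eq_intros)
    then have "((\<lambda>x. (max 0 x)\<^sup>2) has_real_derivative 2 * x) (at x)"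
      by (rule has_field_derivative_transform_within_open[of _ _ _ "{0<..}"]) (use 3 in auto)
    then show ?thesis using 3 by simp
  qed
qed

lemma cutoff_C1: "C1_line cutoff cutoff'"
  unfolding C1_line_def
proof (intro conjI allI)
  fix s :: real
  have "((\<lambda>s. 2 - s\<^sup>2) has_real_derivative - 2 * s) (at s)"
    by (auto intro!: derivative_eq_intros)
  from DERIV_chain2[OF square_pos_part_deriv this]
  have "((\<lambda>s. (max 0 (2 - s\<^sup>2))\<^sup>2) has_real_derivative 2 * max 0 (2 - s\<^sup>2) * (- 2 * s)) (at s)" .
  from DERIV_diff[OF DERIV_const[of 1] this]
  have "((\<lambda>s. 1 - (max 0 (2 - s\<^sup>2))\<^sup>2) has_real_derivative - (2 * max 0 (2 - s\<^sup>2) * (- 2 * s))) (at s)"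
    by simp
  from DERIV_diff[OF DERIV_const[of 1] DERIV_chain2[OF square_pos_part_deriv this]]
  have "(cutoff has_real_derivative 0 - (2 * max 0 (1 - (max 0 (2 - s\<^sup>2))\<^sup>2) *
      - (2 * max 0 (2 - s\<^sup>2) * (- 2 * s)))) (at s)"
    unfolding cutoff_def[abs_def] .
  then show "(cutoff has_real_derivative cutoff' s) (at s)" by (simp add: cutoff'_def algebra_simps)
  show "continuous_on UNIV cutoff'" unfolding cutoff'_def by (intro continuous_intros)
qed

lemma cutoff_one: assumes "\<bar>s\<bar> \<le> 1" shows "cutoff s = 1"
proof -
  have "s\<^sup>2 \<le> 1" using assms by (simp add: abs_square_le_1)
  then have "1 \<le> (max 0 (2 - s\<^sup>2))\<^sup>2" by (simp add: one_le_power)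
  then show ?thesis by (simp add: cutoff_def)
qed

lemma cutoff_zero: assumes "2 \<le> \<bar>s\<bar>" shows "cutoff s = 0"
proof -
  have "2\<^sup>2 \<le> s\<^sup>2" using assms abs_le_square_iff[of 2 s] by simp
  then show ?thesis by (simp add: cutoff_def)
qed

lemma C1_line_scale:
  assumes "C1_line f f'" shows "C1_line (\<lambda>y. f ((y - c) / r)) (\<lambda>y. f' ((y - c) / r) / r)"
proof -
  have "((\<lambda>y. (y - c) * inverse r) has_real_derivative inverse r) (at y)" for y
    by (auto intro!: derivative_eq_intros)
  then have "((\<lambda>y. f ((y - c) * inverse r)) has_real_derivative f' ((y - c) * inverse r) * inverse r) (at y)" for y
    by (rule DERIV_chain2[rotated]) (use assms in \<open>simp add: C1_line_def\<close>)
  moreover have "continuous_on UNIV (\<lambda>y. f' ((y - c) * inverse r))"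
    using assms unfolding C1_line_def
    by (elim conjE, rule_tac continuous_on_compose2[of UNIV f']) (auto intro!: continuous_intros)
  then have "continuous_on UNIV (\<lambda>y. f' ((y - c) * inverse r) * inverse r)"
    by (rule continuous_on_mult_right)
  ultimately show ?thesis by (simp add: C1_line_def divide_inverse)
qed

lemma C1_line_mult:
  assumes "C1_line f f'" "C1_line g g'" shows "C1_line (\<lambda>y. f y * g y) (\<lambda>y. f' y * g y + f y * g' y)"
proof -
  have "continuous_on UNIV f" "continuous_on UNIV g"
    using assms unfolding C1_line_def by (auto intro: DERIV_continuous_on)
  then show ?thesis using assms unfolding C1_line_def
    by (auto intro!: derivative_eq_intros continuous_intros)
qed

lemma C1_line_sum:
  assumes "\<And>i. i \<in> I \<Longrightarrow> C1_line (f i) (f' i)"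
  shows "C1_line (\<lambda>y. \<Sum>i\<in>I. f i y) (\<lambda>y. \<Sum>i\<in>I. f' i y)"
  using assms unfolding C1_line_def by (auto intro!: DERIV_sum continuous_on_sum)

lemma C1_line_add:
  "C1_line f f' \<Longrightarrow> C1_line g g' \<Longrightarrow> C1_line (\<lambda>y. f y + g y) (\<lambda>y. f' y + g' y)"
  unfolding C1_line_def by (auto intro!: derivative_eq_intros continuous_intros)

lemma C1_line_cmult:
  "C1_line f f' \<Longrightarrow> C1_line (\<lambda>y. k * f y) (\<lambda>y. k * f' y)"
  unfolding C1_line_def by (auto intro!: derivative_eq_intros continuous_intros)

lemma C1_line_uminus: "C1_line f f' \<Longrightarrow> C1_line (\<lambda>y. - f y) (\<lambda>y. - f' y)"
  using C1_line_cmult[of f f' "-1"] by simp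

text \<open>The function \<open>V\<close> is touched from above at \<open>(t, z)\<close> by a function of time plus one function of the coordinate
  for each representative of \<open>z\<close>. Such separable tests suffice for the whole proof, and their continuity
  does not involve products of quotient topologies.\<close>

definition upper_test ::
  "'e network \<Rightarrow> real \<Rightarrow> (real \<Rightarrow> 'e \<times> real \<Rightarrow> real) \<Rightarrow> real \<Rightarrow> 'e point \<Rightarrow> (real \<Rightarrow> real) \<Rightarrow> (real \<Rightarrow> real)
    \<Rightarrow> ('e \<times> real \<Rightarrow> real \<Rightarrow> real) \<Rightarrow> ('e \<times> real \<Rightarrow> real \<Rightarrow> real) \<Rightarrow> bool" where
  "upper_test G T V t z b b' g g' \<longleftrightarrow>
     (\<forall>s\<in>{0<..<T}. (b has_real_derivative b' s) (at s)) \<and> continuous_on {0<..<T} b' \<and>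
     (\<forall>i\<in>z. C1_line (g i) (g' i) \<and> g i (snd i) = 0) \<and>
     (\<exists>\<rho>>0. \<forall>s\<in>{0<..<T}. \<forall>i\<in>z. \<forall>y\<in>edge G (fst i). \<bar>s - t\<bar> < \<rho> \<longrightarrow> \<bar>y - snd i\<bar> < \<rho> \<longrightarrow>
        V s (fst i, y) \<le> V t i + (b s - b t) + g i y)"

context network_graph
begin

text \<open>The space parts of a test, cut off so that they vanish at all endpoints, hence define a function on the
  network.\<close>

definition glued :: "'e point \<Rightarrow> real \<Rightarrow> ('e \<times> real \<Rightarrow> real \<Rightarrow> real) \<Rightarrow> 'e \<times> real \<Rightarrow> real" where
  "glued z r g a = (\<Sum>i\<in>{i\<in>z. fst i = fst a}. cutoff ((snd a - snd i) / r) * g i (snd a))"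

lemma glued_endpoint:
  assumes "isolating z (3 * r)" "\<And>i. i \<in> z \<Longrightarrow> g i (snd i) = 0" "a \<in> endpoints G" "0 < r"
  shows "glued z r g a = 0"
  unfolding glued_def
proof (rule sum.neutral, rule ballI)
  fix i assume i: "i \<in> {i \<in> z. fst i = fst a}"
  show "cutoff ((snd a - snd i) / r) * g i (snd a) = 0"
  proof (cases "snd i = snd a")
    case True
    then have "g i (snd a) = 0" using assms(2)[of i] i by simp
    then show ?thesis by simp
  next
    case False
    have "i = (fst a, snd i)" using i by (simp add: prod_eq_iff)
    then have "(fst a, snd i) \<in> z" "(fst a, snd a) \<in> endpoints G" using assms(3) i by auto
    then have "3 * r \<le> \<bar>snd i - snd a\<bar>" using False assms(1) unfolding isolating_def by blast
    then have "2 \<le> \<bar>(snd a - snd i) / r\<bar>" using assms(4) by (simp add: le_divide_eq abs_minus_commute)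
    then show ?thesis by (simp add: cutoff_zero)
  qed
qed

lemma glued_near:
  assumes z: "z \<in> network_points G" "isolating z (3 * r)" "0 < r" and i: "i \<in> z" "\<bar>y - snd i\<bar> < r"
  shows "glued z r g (fst i, y) = g i y"
proof -
  have fin: "finite {j \<in> z. fst j = fst i}" using network_point_finite[OF z(1)] by simp
  have "cutoff ((y - snd j) / r) * g j y = 0" if j: "j \<in> {j \<in> z. fst j = fst i} - {i}" for j
  proof -
    have ij: "j \<in> z" "fst j = fst i" "snd j \<noteq> snd i" using j by (auto simp: prod_eq_iff)
    then have "z \<in> vertices G" using same_point_cases[OF z(1), of i j] i(1) by auto
    then have "(fst i, snd j) \<in> endpoints G" using vertex_subset ij by (metis prod.collapse subsetD)
    moreover have "(fst i, snd i) \<in> z" using i by simp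
    ultimately have "3 * r \<le> \<bar>snd i - snd j\<bar>" using z(2) ij(3) unfolding isolating_def by metis
    then have "2 * r \<le> \<bar>y - snd j\<bar>" using i(2) by linarith
    then have "2 \<le> \<bar>(y - snd j) / r\<bar>" using z(3) by (simp add: le_divide_eq)
    then show ?thesis by (simp add: cutoff_zero)
  qed
  then have "(\<Sum>j\<in>{j \<in> z. fst j = fst i} - {i}. cutoff ((y - snd j) / r) * g j y) = 0"
    by (intro sum.neutral ballI)
  moreover have "cutoff ((y - snd i) / r) = 1" using i(2) z(3) by (intro cutoff_one) (simp add: divide_le_eq)
  ultimately show ?thesis
    unfolding glued_def using sum.remove[OF fin, of i "\<lambda>j. cutoff ((y - snd j) / r) * g j y"] i(1)
    by simp
qed

lemma edge_limit_point:
  assumes "e \<in> edges G" "x \<in> edge G e" shows "at x within edge G e \<noteq> bot"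
proof -
  have "is_interval (edge G e)" unfolding is_interval_1 using edge_convex by blast
  then have "connected (edge G e)" by (simp add: is_interval_connected)
  moreover have "min_len \<in> edge G e" using min_len(1) min_len(2)[OF assms(1)] by (simp add: edge_def)
  then have "\<nexists>a. edge G e = {a}" using zero_in_edge[OF assms(1)] min_len(1) by fastforce
  ultimately have "x islimpt edge G e" using assms(2) connected_imp_perfect by blast
  then show ?thesis by (simp add: trivial_limit_within)
qed

lemma continuous_map_network:
  assumes "\<And>e. e \<in> edges G \<Longrightarrow> continuous_on (edge G e) (\<lambda>x. f (proj G (e, x)))"
  shows "continuous_map (network_topology G) euclideanreal f"
proof -
  have "continuous_map (edge_topology G) euclideanreal (f \<circ> proj G)"
    unfolding continuous_map_def topspace_edge_topology
  proof (intro conjI allI impI)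
    fix U :: "real set" assume "openin euclideanreal U"
    then have U: "open U" by simp
    let ?S = "{a \<in> edge_points G. (f \<circ> proj G) a \<in> U}"
    have "openin (top_of_set (edge G e)) {x. (e, x) \<in> ?S}" if e: "e \<in> edges G" for e
    proof -
      have "{x. (e, x) \<in> ?S} = edge G e \<inter> (\<lambda>x. f (proj G (e, x))) -` U"
        using e by (auto simp: edge_points_def)
      then show ?thesis using continuous_openin_preimage_gen[OF assms[OF e] U] by simp
    qed
    moreover have "?S \<subseteq> Sigma (edges G) (edge G)" by (auto simp: edge_points_def)
    ultimately show "openin (edge_topology G) ?S"
      unfolding edge_topology_def openin_sum_topology by (simp add: comp_def)
  qed auto
  then show ?thesis using continuous_compose_quotient_map_eq[OF quotient_map_proj] by blast
qed

lemma separable_test_function: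
  assumes z: "z \<in> network_points G" "isolating z (3 * r)" "0 < r"
    and b0: "\<forall>s\<in>{0<..<T}. (b has_real_derivative b' s) (at s)" "continuous_on {0<..<T} b'"
    and g0: "\<forall>i\<in>z. C1_line (g i) (g' i)" "\<forall>i\<in>z. g i (snd i) = 0"
  shows "\<exists>\<phi>. test_function G T \<phi> \<and>
    (\<forall>s. \<forall>i\<in>z. \<forall>y\<in>edge G (fst i). \<bar>y - snd i\<bar> < r \<longrightarrow> \<phi> s (proj G (fst i, y)) = b s + g i y) \<and>
    (\<forall>t\<in>{0<..<T}. deriv (\<lambda>s. \<phi> s z) t = b' t) \<and>
    (\<forall>t. \<forall>i\<in>z. edge_gradient G (\<phi> t) i = g' i (snd i))"
proof -
  note b = b0(1)[rule_format] b0(2) and g = g0[rule_format]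
  define \<gamma> where "\<gamma> = glued z r g"
  define \<phi> where "\<phi> s Z = b s + \<gamma> (SOME a. a \<in> Z)" for s :: real and Z
  have \<phi>: "\<phi> s (proj G a) = b s + \<gamma> a" if a: "a \<in> edge_points G" for s a
  proof -
    let ?a = "SOME b. b \<in> proj G a"
    have mem: "?a \<in> proj G a" using proj_mem[OF a] by (rule someI)
    from same_point_cases[OF proj_network_point[OF a] mem proj_mem[OF a]]
    have "\<gamma> ?a = \<gamma> a"
    proof
      assume "proj G a \<in> vertices G"
      then have "?a \<in> endpoints G" "a \<in> endpoints G" using vertex_subset mem proj_mem[OF a] by blast+
      then have "\<gamma> ?a = 0" "\<gamma> a = 0" unfolding \<gamma>_def
        using glued_endpoint[where z = z and r = r and g = g] z(2,3) g(2) by blast+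
      then show ?thesis by simp
    qed simp
    then show ?thesis by (simp add: \<phi>_def)
  qed
  have C1: "C1_line (\<lambda>y. \<gamma> (e, y)) (\<lambda>y. \<Sum>i\<in>{i\<in>z. fst i = e}.
      cutoff' ((y - snd i) / r) / r * g i y + cutoff ((y - snd i) / r) * g' i y)" for e
    unfolding \<gamma>_def glued_def fst_conv snd_conv
    using g(1) by (intro C1_line_sum C1_line_mult C1_line_scale cutoff_C1) auto
  define \<gamma>' where "\<gamma>' e y = (\<Sum>i\<in>{i\<in>z. fst i = e}.
      cutoff' ((y - snd i) / r) / r * g i y + cutoff ((y - snd i) / r) * g' i y)" for e y
  have \<gamma>': "C1_line (\<lambda>y. \<gamma> (e, y)) (\<gamma>' e)" for e using C1[of e] unfolding \<gamma>'_def[abs_def] .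
  have d\<gamma>: "((\<lambda>y. \<gamma> (e, y)) has_real_derivative \<gamma>' e y) (at y)" for e y
    using \<gamma>' unfolding C1_line_def by blast
  have on_edge: "\<phi> s (proj G (e, x)) = b s + \<gamma> (e, x)" if "e \<in> edges G" "x \<in> edge G e" for s e x
    using \<phi> that by (simp add: edge_points_def)
  show ?thesis
  proof (rule exI[of _ \<phi>], intro conjI allI ballI impI)
    show "test_function G T \<phi>"
      unfolding test_function_def
    proof (intro conjI ballI)
      have "continuous_map (network_topology G) euclideanreal (\<lambda>Z. \<gamma> (SOME a. a \<in> Z))"
      proof (rule continuous_map_network)
        fix e assume e: "e \<in> edges G"
        have "continuous_on (edge G e) (\<lambda>x. \<gamma> (e, x))"
          using d\<gamma> by (intro DERIV_continuous_on) (auto intro: has_field_derivative_at_within)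
        then show "continuous_on (edge G e) (\<lambda>x. \<gamma> (SOME a. a \<in> proj G (e, x)))"
          using on_edge[OF e] unfolding \<phi>_def by (simp cong: continuous_on_cong)
      qed
      moreover have "continuous_on {0<..<T} b"
        using b(1) by (intro DERIV_continuous_on) (auto intro: has_field_derivative_at_within)
      ultimately have "continuous_map (open_cylinder G T) euclideanreal (\<lambda>p. b (fst p) + \<gamma> (SOME a. a \<in> snd p))"
        unfolding open_cylinder_def
        by (intro continuous_map_add continuous_map_compose[OF continuous_map_fst, unfolded comp_def]
            continuous_map_compose[OF continuous_map_snd, unfolded comp_def]) auto
      then show "continuous_map (open_cylinder G T) euclideanreal (\<lambda>(t, z). \<phi> t z)"
        by (simp add: \<phi>_def case_prod_unfold)
      fix e assume e: "e \<in> edges G"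
      let ?S = "{0<..<T} \<times> edge G e"
      show "C1_on ?S (\<lambda>(t, x). \<phi> t (proj G (e, x)))"
        unfolding C1_on_def
      proof (rule exI[of _ "\<lambda>p. b' (fst p)"], rule exI[of _ "\<lambda>p. \<gamma>' e (snd p)"], intro conjI ballI)
        show "continuous_on ?S (\<lambda>p. b' (fst p))"
          by (rule continuous_on_compose2[OF b(2)]) (auto intro: continuous_intros)
        show "continuous_on ?S (\<lambda>p. \<gamma>' e (snd p))"
          by (rule continuous_on_compose2[of UNIV "\<gamma>' e"])
            (use \<gamma>' in \<open>auto simp: C1_line_def intro: continuous_intros\<close>)
        fix p assume p: "p \<in> ?S"
        have 1: "((\<lambda>p. b (fst p)) has_derivative (\<lambda>h. b' (fst p) * fst h)) (at p within ?S)"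
          by (rule has_derivative_compose[OF has_derivative_fst[OF has_derivative_ident], of b "(*) (b' (fst p))"])
            (use b(1)[of "fst p"] p in \<open>auto simp: has_field_derivative_def\<close>)
        have 2: "((\<lambda>p. \<gamma> (e, snd p)) has_derivative (\<lambda>h. \<gamma>' e (snd p) * snd h)) (at p within ?S)"
          by (rule has_derivative_compose[OF has_derivative_snd[OF has_derivative_ident],
                of "\<lambda>y. \<gamma> (e, y)" "(*) (\<gamma>' e (snd p))"])
            (use d\<gamma>[of e "snd p"] in \<open>auto simp: has_field_derivative_def\<close>)
        have "((\<lambda>p. b (fst p) + \<gamma> (e, snd p)) has_derivative
            (\<lambda>h. b' (fst p) * fst h + \<gamma>' e (snd p) * snd h)) (at p within ?S)"
          by (rule has_derivative_add[OF 1 2])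
        then show "((\<lambda>(t, x). \<phi> t (proj G (e, x))) has_derivative
            (\<lambda>(h, k). b' (fst p) * h + \<gamma>' e (snd p) * k)) (at p within ?S)"
          unfolding case_prod_unfold
          by (rule has_derivative_transform[OF p, rotated]) (use on_edge[OF e] in auto)
      qed
    qed
  next
    fix s i y assume "i \<in> z" "y \<in> edge G (fst i)" "\<bar>y - snd i\<bar> < r"
    moreover from this have "fst i \<in> edges G" using network_point_subset[OF z(1)] by (auto simp: edge_points_def)
    ultimately show "\<phi> s (proj G (fst i, y)) = b s + g i y"
      using on_edge glued_near[OF z] by (simp add: \<gamma>_def)
  next
    fix t assume t: "t \<in> {0<..<T}"
    have "((\<lambda>s. \<phi> s z) has_real_derivative b' t) (at t)"
      unfolding \<phi>_def using b(1)[OF t] by (auto intro!: derivative_eq_intros)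
    then show "deriv (\<lambda>s. \<phi> s z) t = b' t" by (rule DERIV_imp_deriv)
  next
    fix t i assume i: "i \<in> z"
    obtain e c where ec: "i = (e, c)" by force
    have E: "e \<in> edges G" "c \<in> edge G e" using i ec network_point_subset[OF z(1)] by (auto simp: edge_points_def)
    have "(g i has_real_derivative g' i c) (at c)" using g(1)[OF i] by (simp add: C1_line_def)
    then have "((\<lambda>y. \<gamma> (e, y)) has_real_derivative g' i c) (at c)"
      by (rule has_field_derivative_transform_within_open[of _ _ _ "ball c r"])
        (use glued_near[OF z i] ec z(3) in \<open>auto simp: \<gamma>_def dist_real_def abs_minus_commute\<close>)
    then have "((\<lambda>y. b t + \<gamma> (e, y)) has_vector_derivative g' i c) (at c within edge G e)"
      by (auto simp: has_real_derivative_iff_has_vector_derivative[symmetric]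
          intro!: derivative_eq_intros intro: has_field_derivative_at_within)
    then have "((\<lambda>y. \<phi> t (proj G (e, y))) has_vector_derivative g' i c) (at c within edge G e)"
      by (rule has_vector_derivative_transform[OF E(2), rotated]) (use on_edge[OF E(1)] in auto)
    then show "edge_gradient G (\<phi> t) i = g' i (snd i)"
      using vector_derivative_within[OF edge_limit_point[OF E]] by (simp add: edge_gradient_def ec)
  qed
qed

lemma network_hamiltonian_cong:
  assumes z: "z \<in> network_points G" and eq: "\<And>i. i \<in> z \<Longrightarrow> p i = q i"
  shows "network_hamiltonian G H p0 A t z p = network_hamiltonian G H p0 A t z q"
  using z
proof (cases rule: network_point_cases)
  case vertex
  have "(\<lambda>e. H_minus H p0 e t 0 (p (e, 0))) ` edges_minus G z = (\<lambda>e. H_minus H p0 e t 0 (q (e, 0))) ` edges_minus G z"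
    using eq by (intro image_cong) (auto simp: edges_minus_def)
  moreover have "(\<lambda>e. let l = real_of_ereal (len G e) in H_plus H p0 e t l (p (e, l))) ` edges_plus G z =
      (\<lambda>e. let l = real_of_ereal (len G e) in H_plus H p0 e t l (q (e, l))) ` edges_plus G z"
    using eq by (intro image_cong) (auto simp: edges_plus_def Let_def)
  ultimately show ?thesis using vertex by (simp add: network_hamiltonian_def flux_def)
next
  case (interior e x)
  then show ?thesis using eq interior_not_vertex by (simp add: network_hamiltonian_def)
qed

lemma eventually_near_point:
  assumes t: "t \<in> {0<..<T}" and z: "z \<in> network_points G" and \<rho>: "isolating z \<rho>"
    and P: "\<And>s i y. s \<in> {0<..<T} \<Longrightarrow> \<bar>s - t\<bar> < \<rho> \<Longrightarrow> i \<in> z \<Longrightarrow> y \<in> edge G (fst i) \<Longrightarrow>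
      \<bar>y - snd i\<bar> < \<rho> \<Longrightarrow> P s (proj G (fst i, y))"
  shows "\<forall>\<^sub>F (s, y) in nhdsin (open_cylinder G T) (t, z). P s y"
proof -
  let ?V = "{0<..<T} \<inter> ball t \<rho>"
  let ?O = "?V \<times> proj G ` coord_nbhd G z \<rho>"
  have "openin (open_cylinder G T) ?O"
    unfolding open_cylinder_def openin_prod_Times_iff
    using openin_coord_nbhd[OF z \<rho>] by (auto intro: openin_open_Int)
  moreover obtain a where "a \<in> z" using network_point_nonempty[OF z] by blast
  then have "(t, z) \<in> ?O"
  proof -
    have "0 < \<rho>" using \<rho> by (simp add: isolating_def)
    then have "a \<in> coord_nbhd G z \<rho>" "t \<in> ball t \<rho>" using coord_nbhd_self[OF z] \<open>a \<in> z\<close> by auto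
    moreover have "z = proj G a" using network_point_proj[OF z \<open>a \<in> z\<close>] by simp
    ultimately show ?thesis using t by blast
  qed
  moreover have "P s y" if sy: "(s, y) \<in> ?O" for s y
  proof -
    obtain e x c where "y = proj G (e, x)" "x \<in> edge G e" "(e, c) \<in> z" "\<bar>x - c\<bar> < \<rho>"
      using sy unfolding coord_nbhd_def by auto
    then show ?thesis using P[of s "(e, c)" x] sy by (auto simp: dist_real_def abs_minus_commute)
  qed
  ultimately show ?thesis unfolding eventually_nhdsin by (intro disjI2 exI[of _ ?O]) auto
qed

lemma upper_testE:
  assumes "upper_test G T V t z b b' g g'"
  obtains \<rho> where "0 < \<rho>"
    "\<And>s i y. s \<in> {0<..<T} \<Longrightarrow> i \<in> z \<Longrightarrow> y \<in> edge G (fst i) \<Longrightarrow> \<bar>s - t\<bar> < \<rho> \<Longrightarrow> \<bar>y - snd i\<bar> < \<rho> \<Longrightarrow>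
      V s (fst i, y) \<le> V t i + (b s - b t) + g i y"
    "\<And>s. s \<in> {0<..<T} \<Longrightarrow> (b has_real_derivative b' s) (at s)" "continuous_on {0<..<T} b'"
    "\<And>i. i \<in> z \<Longrightarrow> C1_line (g i) (g' i)" "\<And>i. i \<in> z \<Longrightarrow> g i (snd i) = 0"
  using assms unfolding upper_test_def by (elim exE conjE) metis

lemma isolating_radius:
  assumes "z \<in> network_points G" "0 < \<rho>"
  obtains r where "0 < r" "r \<le> \<rho>" "isolating z r" "isolating z (3 * r)"
proof -
  obtain \<rho>0 where \<rho>0: "isolating z \<rho>0" using isolating_exists[OF assms(1)] by blast
  define r where "r = min \<rho> (\<rho>0 / 3)"
  have "0 < r" "r \<le> \<rho>" "3 * r \<le> \<rho>0" using \<rho>0 assms(2) by (auto simp: r_def isolating_def)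
  then show thesis using that[of r] isolating_mono[OF \<rho>0] by simp
qed

text \<open>The definition of sub-solution asks for tests on the whole network. A local test becomes one by cutting
  off its space part, which leaves its derivatives at the point unchanged.\<close>

lemma subsolution_test:
  assumes sub: "subsolution_interior G H p0 A T u" and t: "t \<in> {0<..<T}" and z: "z \<in> network_points G"
    and test: "upper_test G T (upper_env G T u) t z b b' g g'"
  shows "b' t + network_hamiltonian G H p0 A t z (\<lambda>i. g' i (snd i)) \<le> 0"
proof -
  have u: "locally_bounded G T u" using sub by (simp add: subsolution_interior_def)
  let ?U = "upper_env G T u"
  obtain \<rho> where \<rho>: "0 < \<rho>"
    "\<And>s i y. s \<in> {0<..<T} \<Longrightarrow> i \<in> z \<Longrightarrow> y \<in> edge G (fst i) \<Longrightarrow> \<bar>s - t\<bar> < \<rho> \<Longrightarrow> \<bar>y - snd i\<bar> < \<rho> \<Longrightarrow>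
      ?U s (fst i, y) \<le> ?U t i + (b s - b t) + g i y"
    and b: "\<And>s. s \<in> {0<..<T} \<Longrightarrow> (b has_real_derivative b' s) (at s)" "continuous_on {0<..<T} b'"
    and g: "\<And>i. i \<in> z \<Longrightarrow> C1_line (g i) (g' i)" "\<And>i. i \<in> z \<Longrightarrow> g i (snd i) = 0"
    using upper_testE[OF test] by blast
  obtain r where r: "0 < r" "r \<le> \<rho>" "isolating z r" "isolating z (3 * r)"
    using isolating_radius[OF z \<rho>(1)] by blast
  obtain i0 where i0: "i0 \<in> z" using network_point_nonempty[OF z] by blast
  have U0: "?U t i = ?U t i0" if "i \<in> z" for i using upper_env_point[OF z that i0] .
  have zE: "i \<in> edge_points G" if "i \<in> z" for i using network_point_subset[OF z] that by blast
  have b2: "((\<lambda>s. ?U t i0 + (b s - b t)) has_real_derivative b' s) (at s)" if "s \<in> {0<..<T}" for s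
    using b(1)[OF that] by (auto intro!: derivative_eq_intros)
  have ball: "\<forall>s\<in>{0<..<T}. ((\<lambda>s. ?U t i0 + (b s - b t)) has_real_derivative b' s) (at s)"
    "\<forall>i\<in>z. C1_line (g i) (g' i)" "\<forall>i\<in>z. g i (snd i) = 0" using b2 g by auto
  obtain \<phi> where \<phi>0: "test_function G T \<phi>"
    "\<forall>s. \<forall>i\<in>z. \<forall>y\<in>edge G (fst i). \<bar>y - snd i\<bar> < r \<longrightarrow>
      \<phi> s (proj G (fst i, y)) = ?U t i0 + (b s - b t) + g i y"
    "\<forall>t\<in>{0<..<T}. deriv (\<lambda>s. \<phi> s z) t = b' t"
    "\<forall>t. \<forall>i\<in>z. edge_gradient G (\<phi> t) i = g' i (snd i)"
    using separable_test_function[where g = g and g' = g', OF z r(4,1) ball(1) b(2) ball(2,3)]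
    by (elim exE conjE)
  note \<phi> = \<phi>0(1) \<phi>0(2)[rule_format] \<phi>0(3)[rule_format] \<phi>0(4)[rule_format]
  have "\<forall>\<^sub>F (s, y) in nhdsin (open_cylinder G T) (t, z). usc_env G T u s y \<le> ereal (\<phi> s y)"
  proof (rule eventually_near_point[OF t z r(3)])
    fix s i y assume *: "s \<in> {0<..<T}" "\<bar>s - t\<bar> < r" "i \<in> z" "y \<in> edge G (fst i)" "\<bar>y - snd i\<bar> < r"
    have "(fst i, y) \<in> edge_points G" using zE[OF *(3)] *(4) by (auto simp: edge_points_def)
    then have "usc_env G T u s (proj G (fst i, y)) = ereal (?U s (fst i, y))"
      using upper_env_eq[OF u] *(1) by simp
    moreover have "?U s (fst i, y) \<le> ?U t i0 + (b s - b t) + g i y"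
      using \<rho>(2)[of s i y] * r(2) U0[OF *(3)] by simp
    ultimately show "usc_env G T u s (proj G (fst i, y)) \<le> ereal (\<phi> s (proj G (fst i, y)))"
      using \<phi>(2)[OF *(3-5)] by simp
  qed
  moreover have "usc_env G T u t z = ereal (\<phi> t z)"
    using upper_env_eq[OF u _ zE[OF i0], of t] network_point_proj[OF z i0] t
      \<phi>(2)[OF i0, of "snd i0" t] zE[OF i0] g(2)[OF i0] r(1) by (auto simp: edge_points_def)
  ultimately have "deriv (\<lambda>s. \<phi> s z) t + network_hamiltonian G H p0 A t z (edge_gradient G (\<phi> t)) \<le> 0"
    using sub \<phi>(1) t z unfolding subsolution_interior_def by blast
  then show ?thesis
    using \<phi>(3)[OF t] network_hamiltonian_cong[OF z \<phi>(4)] by simp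
qed

lemma supersolution_test:
  assumes sup: "supersolution_interior G H p0 A T w" and t: "t \<in> {0<..<T}" and z: "z \<in> network_points G"
    and test: "upper_test G T (upper_env G T (\<lambda>t z. - w t z)) t z b b' g g'"
  shows "b' t \<le> network_hamiltonian G H p0 A t z (\<lambda>i. - g' i (snd i))"
proof -
  let ?w = "\<lambda>t z. - w t z"
  have u: "locally_bounded G T ?w"
    using sup locally_bounded_uminus by (auto simp: supersolution_interior_def)
  let ?U = "upper_env G T ?w"
  obtain \<rho> where \<rho>: "0 < \<rho>"
    "\<And>s i y. s \<in> {0<..<T} \<Longrightarrow> i \<in> z \<Longrightarrow> y \<in> edge G (fst i) \<Longrightarrow> \<bar>s - t\<bar> < \<rho> \<Longrightarrow> \<bar>y - snd i\<bar> < \<rho> \<Longrightarrow>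
      ?U s (fst i, y) \<le> ?U t i + (b s - b t) + g i y"
    and b: "\<And>s. s \<in> {0<..<T} \<Longrightarrow> (b has_real_derivative b' s) (at s)" "continuous_on {0<..<T} b'"
    and g: "\<And>i. i \<in> z \<Longrightarrow> C1_line (g i) (g' i)" "\<And>i. i \<in> z \<Longrightarrow> g i (snd i) = 0"
    using upper_testE[OF test] by blast
  obtain r where r: "0 < r" "r \<le> \<rho>" "isolating z r" "isolating z (3 * r)"
    using isolating_radius[OF z \<rho>(1)] by blast
  obtain i0 where i0: "i0 \<in> z" using network_point_nonempty[OF z] by blast
  have U0: "?U t i = ?U t i0" if "i \<in> z" for i using upper_env_point[OF z that i0] .
  have zE: "i \<in> edge_points G" if "i \<in> z" for i using network_point_subset[OF z] that by blast
  have b2: "((\<lambda>s. - ?U t i0 - (b s - b t)) has_real_derivative - b' s) (at s)" if "s \<in> {0<..<T}" for s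
    using b(1)[OF that] by (auto intro!: derivative_eq_intros)
  have b3: "continuous_on {0<..<T} (\<lambda>s. - b' s)" using b(2) by (intro continuous_intros)
  have g2: "C1_line (\<lambda>y. - g i y) (\<lambda>y. - g' i y)" "- g i (snd i) = 0" if "i \<in> z" for i
    using g that C1_line_uminus by auto
  have ball: "\<forall>s\<in>{0<..<T}. ((\<lambda>s. - ?U t i0 - (b s - b t)) has_real_derivative - b' s) (at s)"
    "\<forall>i\<in>z. C1_line (\<lambda>y. - g i y) (\<lambda>y. - g' i y)" "\<forall>i\<in>z. - g i (snd i) = 0"
    using b2 g2 by auto
  obtain \<phi> where \<phi>0: "test_function G T \<phi>"
    "\<forall>s. \<forall>i\<in>z. \<forall>y\<in>edge G (fst i). \<bar>y - snd i\<bar> < r \<longrightarrow>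
      \<phi> s (proj G (fst i, y)) = - ?U t i0 - (b s - b t) + - g i y"
    "\<forall>t\<in>{0<..<T}. deriv (\<lambda>s. \<phi> s z) t = - b' t"
    "\<forall>t. \<forall>i\<in>z. edge_gradient G (\<phi> t) i = - g' i (snd i)"
    using separable_test_function[where g = "\<lambda>i y. - g i y" and g' = "\<lambda>i y. - g' i y", OF z r(4,1) ball(1) b3 ball(2,3)]
    by (elim exE conjE)
  note \<phi> = \<phi>0(1) \<phi>0(2)[rule_format] \<phi>0(3)[rule_format] \<phi>0(4)[rule_format]
  have "\<forall>\<^sub>F (s, y) in nhdsin (open_cylinder G T) (t, z). lsc_env G T w s y \<ge> ereal (\<phi> s y)"
  proof (rule eventually_near_point[OF t z r(3)])
    fix s i y assume *: "s \<in> {0<..<T}" "\<bar>s - t\<bar> < r" "i \<in> z" "y \<in> edge G (fst i)" "\<bar>y - snd i\<bar> < r"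
    have "(fst i, y) \<in> edge_points G" using zE[OF *(3)] *(4) by (auto simp: edge_points_def)
    then have "usc_env G T ?w s (proj G (fst i, y)) = ereal (?U s (fst i, y))"
      using upper_env_eq[OF u] *(1) by simp
    moreover have "?U s (fst i, y) \<le> ?U t i0 + (b s - b t) + g i y"
      using \<rho>(2)[of s i y] * r(2) U0[OF *(3)] by simp
    ultimately show "lsc_env G T w s (proj G (fst i, y)) \<ge> ereal (\<phi> s (proj G (fst i, y)))"
      using \<phi>(2)[OF *(3-5)] by (simp add: lsc_env_uminus)
  qed
  moreover have "lsc_env G T w t z = ereal (\<phi> t z)"
    using upper_env_eq[OF u _ zE[OF i0], of t] network_point_proj[OF z i0] t
      \<phi>(2)[OF i0, of "snd i0" t] zE[OF i0] g(2)[OF i0] r(1) by (auto simp: edge_points_def lsc_env_uminus)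
  ultimately have "deriv (\<lambda>s. \<phi> s z) t + network_hamiltonian G H p0 A t z (edge_gradient G (\<phi> t)) \<ge> 0"
    using sup \<phi>(1) t z unfolding supersolution_interior_def by blast
  then show ?thesis
    using \<phi>(3)[OF t] network_hamiltonian_cong[OF z \<phi>(4)] by simp
qed

end


section \<open>Maxima on the network\<close>

lemma time_penalty_deriv:
  "s < T \<Longrightarrow> ((\<lambda>s. \<eta> / (T - s)) has_real_derivative \<eta> / (T - s)\<^sup>2) (at s)" for s T \<eta> :: real
  by (auto intro!: derivative_eq_intros simp: power2_eq_square)

lemma time_penalty_continuous: "continuous_on {0<..<T} (\<lambda>s. \<eta> / (T - s)\<^sup>2)" for T \<eta> :: real
  by (auto intro!: continuous_intros)

context network_graph
begin

lemma edge_cases: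
  assumes "e \<in> edges G"
  obtains (bounded) l where "0 < l" "len G e = ereal l" "edge G e = {0..l}" "edge_interior G e = {0<..<l}"
    | (unbounded) "len G e = \<infinity>" "edge G e = {0..}" "edge_interior G e = {0<..}"
proof (cases "len G e")
  case (real l)
  have "0 < l" using min_len(1) min_len(2)[OF assms] real by simp
  moreover have "edge G e = {0..l}" "edge_interior G e = {0<..<l}"
    using real by (auto simp: edge_def edge_interior_def)
  ultimately show thesis using that(1) real by blast
next
  case PInf
  then show thesis using that(2) by (auto simp: edge_def edge_interior_def)
next
  case MInf
  then show thesis using min_len(2)[OF assms] by simp
qed

lemma edge_closed: "e \<in> edges G \<Longrightarrow> closed (edge G e)"
  by (cases rule: edge_cases) auto

lemma edge_closure_interior: "e \<in> edges G \<Longrightarrow> closure (edge_interior G e) = edge G e"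
  by (cases rule: edge_cases) auto

lemma walk_dist_continuous:
  assumes "Z \<in> network_points G" "e \<in> edges G"
  shows "continuous_on (edge G e) (\<lambda>x. walk_dist G Z (e, x))"
  unfolding continuous_on_iff
proof (intro ballI allI impI)
  fix x and d :: real assume x: "x \<in> edge G e" and d: "0 < d"
  have "dist (walk_dist G Z (e, y)) (walk_dist G Z (e, x)) < d" if "y \<in> edge G e" "dist y x < d" for y
    using walk_dist_along[OF assms(1), of e x y] walk_dist_along[OF assms(1), of e y x] that x assms(2)
    by (auto simp: edge_points_def dist_real_def)
  then show "\<exists>r>0. \<forall>y\<in>edge G e. dist y x < r \<longrightarrow> dist (walk_dist G Z (e, y)) (walk_dist G Z (e, x)) < d"
    using d by blast
qed

lemma sublevel_compact:
  assumes Z: "Z \<in> network_points G" and e: "e \<in> edges G"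
  shows "compact {x \<in> edge G e. walk_dist G Z (e, x) \<le> R}"
proof -
  let ?S = "{x \<in> edge G e. walk_dist G Z (e, x) \<le> R}"
  let ?c = "{c. (e, c) \<in> endpoints G} \<union> snd ` Z"
  have fin: "finite ?c" using endpoints_edge_finite network_point_finite[OF Z] by simp
  have "closed ?S"
  proof -
    have "?S = edge G e \<inter> (\<lambda>x. walk_dist G Z (e, x)) -` {..R}" by auto
    then show ?thesis
      using continuous_closed_preimage[OF walk_dist_continuous[OF Z e] edge_closed[OF e] closed_atMost[of R]]
      by simp
  qed
  moreover have "bounded ?S"
    unfolding bounded_iff
  proof (intro exI ballI)
    fix x assume x: "x \<in> ?S"
    then have a: "(e, x) \<in> edge_points G" using e by (simp add: edge_points_def)
    obtain c where c: "c \<in> ?c" "\<bar>x - c\<bar> \<le> R"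
      using walk_dist_entrance[OF Z a]
    proof (elim disjE exE conjE)
      fix c assume "(e, c) \<in> Z" "walk_dist G Z (e, x) = \<bar>x - c\<bar>"
      then show thesis using that[of c] x by force
    next
      fix c assume c: "(e, c) \<in> endpoints G" "walk_dist G Z (e, x) = walk_dist G Z (e, c) + \<bar>x - c\<bar>"
      then have "0 \<le> walk_dist G Z (e, c)" using walk_dist_nonneg[OF Z] by (auto simp: endpoints_def)
      then show thesis using that[of c] x c by force
    qed
    then have "\<bar>c\<bar> \<le> (\<Sum>c\<in>?c. \<bar>c\<bar>)" using fin by (intro member_le_sum) auto
    then show "norm x \<le> (\<Sum>c\<in>?c. \<bar>c\<bar>) + R" using c by simp
  qed
  ultimately show ?thesis by (simp add: compact_eq_bounded_closed)
qed

text \<open>The sublevel set of the distance is covered by finitely many compact pieces of edges; \<open>p\<close> stands for the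
  time variables.\<close>

lemma attains_max_sublevel:
  fixes F :: "'p::metric_space \<Rightarrow> 'e \<times> real \<Rightarrow> real"
  assumes Z: "Z \<in> network_points G" and P: "compact P"
    and usc: "\<And>e. e \<in> edges G \<Longrightarrow> usc_on (P \<times> edge G e) (\<lambda>q. F (fst q) (e, snd q))"
    and ne: "p1 \<in> P" "a1 \<in> edge_points G" "walk_dist G Z a1 \<le> R"
  obtains p a where "p \<in> P" "a \<in> edge_points G" "walk_dist G Z a \<le> R"
    "\<And>q b. q \<in> P \<Longrightarrow> b \<in> edge_points G \<Longrightarrow> walk_dist G Z b \<le> R \<Longrightarrow> F q b \<le> F p a"
proof -
  let ?S = "\<lambda>e. {x \<in> edge G e. walk_dist G Z (e, x) \<le> R}"
  let ?E = "{e \<in> edges G. ?S e \<noteq> {}}"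
  have "?E \<subseteq> {e. \<exists>x r. r \<le> R + 1 \<and> walk G Z r (e, x)}"
  proof
    fix e assume "e \<in> ?E"
    then obtain x where x: "e \<in> edges G" "x \<in> edge G e" "walk_dist G Z (e, x) \<le> R" by blast
    then have "(e, x) \<in> edge_points G" "walk_dist G Z (e, x) < R + 1" by (auto simp: edge_points_def)
    then obtain r where "r < R + 1" "walk G Z r (e, x)" using walk_dist_less[OF Z] by blast
    then have "r \<le> R + 1 \<and> walk G Z r (e, x)" by simp
    then show "e \<in> {e. \<exists>x r. r \<le> R + 1 \<and> walk G Z r (e, x)}" by blast
  qed
  then have finE: "finite ?E" using walk_finite_edges[OF Z] finite_subset by blast
  have "\<forall>e\<in>?E. \<exists>m. m \<in> P \<times> ?S e \<and> (\<forall>q\<in>P \<times> ?S e. F (fst q) (e, snd q) \<le> F (fst m) (e, snd m))"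
  proof
    fix e assume e: "e \<in> ?E"
    have "compact (P \<times> ?S e)" using P sublevel_compact[OF Z] e by (auto intro: compact_Times)
    moreover have "P \<times> ?S e \<noteq> {}" using e ne(1) by blast
    moreover have "usc_on (P \<times> ?S e) (\<lambda>q. F (fst q) (e, snd q))"
      using usc[of e] e by (auto intro: usc_on_subset)
    ultimately show "\<exists>m. m \<in> P \<times> ?S e \<and> (\<forall>q\<in>P \<times> ?S e. F (fst q) (e, snd q) \<le> F (fst m) (e, snd m))"
      using usc_attains_max[of "P \<times> ?S e" "\<lambda>q. F (fst q) (e, snd q)"] by simp
  qed
  then obtain m where m: "\<forall>e\<in>?E. m e \<in> P \<times> ?S e \<and> (\<forall>q\<in>P \<times> ?S e. F (fst q) (e, snd q) \<le> F (fst (m e)) (e, snd (m e)))"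
    by (rule bchoice[THEN exE])
  let ?f = "\<lambda>e. F (fst (m e)) (e, snd (m e))"
  obtain e1 x1 where a1: "a1 = (e1, x1)" by force
  then have "e1 \<in> ?E" using ne by (auto simp: edge_points_def)
  then have "Max (?f ` ?E) \<in> ?f ` ?E" using finE by (intro Max_in) auto
  then obtain e where e: "e \<in> ?E" "?f e = Max (?f ` ?E)" by (elim imageE) (rule that, simp_all)
  show thesis
  proof (rule that[of "fst (m e)" "(e, snd (m e))"])
    show "fst (m e) \<in> P" "(e, snd (m e)) \<in> edge_points G" "walk_dist G Z (e, snd (m e)) \<le> R"
      using m e(1) by (auto simp: edge_points_def mem_Times_iff)
    fix q b assume q: "q \<in> P" "b \<in> edge_points G" "walk_dist G Z b \<le> R"
    obtain e' x where b: "b = (e', x)" by force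
    have e': "e' \<in> ?E" "x \<in> ?S e'" using q b by (auto simp: edge_points_def)
    then have "F q b \<le> ?f e'" using m q(1) b by force
    also have "\<dots> \<le> ?f e" unfolding e(2) using e'(1) finE by (intro Max_ge) auto
    finally show "F q b \<le> F (fst (m e)) (e, snd (m e))" .
  qed
qed

text \<open>The upper tests of the smoothed distance from \<open>Z\<close>, collected over the representatives of a point \<open>Y\<close>.\<close>

lemma soft_dist_tests:
  assumes Z: "Z \<in> network_points G" and Y: "Y \<in> network_points G" and \<sigma>: "0 < \<sigma>"
  shows "\<exists>h h'. \<forall>i\<in>Y. C1_line (h i) (h' i) \<and> h i (snd i) = 0 \<and> \<bar>h' i (snd i)\<bar> \<le> (1::real) \<and>
    (\<forall>y\<in>edge G (fst i). soft \<sigma> (walk_dist G Z (fst i, y)) \<le> soft \<sigma> (walk_dist G Z i) + h i y)"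
proof -
  have "\<exists>k k'. C1_line k k' \<and> k (snd i) = 0 \<and> \<bar>k' (snd i)\<bar> \<le> 1 \<and>
    (\<forall>y\<in>edge G (fst i). soft \<sigma> (walk_dist G Z (fst i, y)) \<le> soft \<sigma> (walk_dist G Z i) + k y)" if i: "i \<in> Y" for i
  proof -
    have iE: "(fst i, snd i) \<in> edge_points G" using i network_point_subset[OF Y] by auto
    obtain m s where ms: "s = 1 \<or> s = - 1"
      "soft \<sigma> (walk_dist G Z (fst i, snd i)) = soft \<sigma> (m + s * snd i)"
      "\<And>y. y \<in> edge G (fst i) \<Longrightarrow> soft \<sigma> (walk_dist G Z (fst i, y)) \<le> soft \<sigma> (m + s * y)"
      by (rule soft_dist_upper[OF Z iE, of \<sigma>]) (rule that)
    let ?k = "\<lambda>y. soft \<sigma> (m + s * y) - soft \<sigma> (m + s * snd i)"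
    let ?k' = "\<lambda>y. soft' \<sigma> (m + s * y) * s"
    have d: "((\<lambda>y. m + s * y) has_real_derivative s) (at y)" for y
      by (auto intro!: derivative_eq_intros)
    have soft_d: "(soft \<sigma> has_real_derivative soft' \<sigma> x) (at x)" for x
      using soft_C1[OF \<sigma>] by (simp add: C1_line_def)
    have "((\<lambda>y. soft \<sigma> (m + s * y)) has_real_derivative ?k' y) (at y)" for y
      by (rule DERIV_chain2[OF soft_d d])
    from DERIV_diff[OF this DERIV_const]
    have "(?k has_real_derivative ?k' y) (at y)" for y by simp
    moreover have "continuous_on UNIV (soft' \<sigma>)" using soft_C1[OF \<sigma>] by (simp add: C1_line_def)
    then have "continuous_on UNIV (\<lambda>y. soft' \<sigma> (m + s * y))"
      by (rule continuous_on_compose2) (auto intro!: continuous_intros)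
    then have "continuous_on UNIV ?k'" by (rule continuous_on_mult_right)
    ultimately have "C1_line ?k ?k'" by (simp add: C1_line_def)
    moreover have "\<bar>?k' (snd i)\<bar> \<le> 1" using soft'_bound[OF \<sigma>] ms(1) by auto
    ultimately show ?thesis using ms(2,3) by (intro exI[of _ ?k] exI[of _ ?k']) (auto simp: algebra_simps)
  qed
  then have "\<forall>i\<in>Y. \<exists>k k'. C1_line k k' \<and> k (snd i) = 0 \<and> \<bar>k' (snd i)\<bar> \<le> 1 \<and>
    (\<forall>y\<in>edge G (fst i). soft \<sigma> (walk_dist G Z (fst i, y)) \<le> soft \<sigma> (walk_dist G Z i) + k y)" by (rule ballI)
  from bchoice[OF this] obtain h where "\<forall>i\<in>Y. \<exists>k'. C1_line (h i) k' \<and> h i (snd i) = 0 \<and> \<bar>k' (snd i)\<bar> \<le> 1 \<and>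
    (\<forall>y\<in>edge G (fst i). soft \<sigma> (walk_dist G Z (fst i, y)) \<le> soft \<sigma> (walk_dist G Z i) + h i y)" ..
  from bchoice[OF this] obtain h' where "\<forall>i\<in>Y. C1_line (h i) (h' i) \<and> h i (snd i) = 0 \<and> \<bar>h' i (snd i)\<bar> \<le> 1 \<and>
    (\<forall>y\<in>edge G (fst i). soft \<sigma> (walk_dist G Z (fst i, y)) \<le> soft \<sigma> (walk_dist G Z i) + h i y)" ..
  then show ?thesis by (intro exI)
qed


section \<open>Linear growth from the initial datum\<close>

text \<open>Compare \<open>V\<close> with the barrier \<open>v z + \<epsilon> + \<alpha> soft D + K t\<close> centred at \<open>Z\<close>, where \<open>D\<close> is the distance from \<open>Z\<close>. As
  \<open>\<alpha>\<close> exceeds the growth rate \<open>C\<close>, a maximum of the difference exists. The barrier has slopes at most \<open>\<alpha>\<close>,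
  so at positive times a test by it would force a time derivative at most \<open>K\<close>; at time \<open>0\<close> it lies above
  the initial datum. Since \<open>\<alpha>\<close> and \<open>K\<close> are the same for all centres, the bound read off at the centre is
  uniform, and this gives at once a bound on \<open>U + V\<close> and its smallness for small times.\<close>

lemma barrier:
  fixes V :: "real \<Rightarrow> 'e \<times> real \<Rightarrow> real"
  assumes T: "0 < T"
    and V_usc: "\<And>e. e \<in> edges G \<Longrightarrow> usc_on ({0..<T} \<times> edge G e) (\<lambda>(t, x). V t (e, x))"
    and V_point: "\<And>z a b t. z \<in> network_points G \<Longrightarrow> a \<in> z \<Longrightarrow> b \<in> z \<Longrightarrow> V t a = V t b"
    and x0: "x0 \<in> network_points G" and C: "0 < C"
    and V_growth: "\<And>t a. t \<in> {0..<T} \<Longrightarrow> a \<in> edge_points G \<Longrightarrow> V t a \<le> C * (1 + walk_dist G x0 a)"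
    and V_0: "\<And>a. a \<in> edge_points G \<Longrightarrow> V 0 a \<le> v a"
    and v: "\<And>a. a \<in> edge_points G \<Longrightarrow> v a \<le> v z + \<epsilon> + L * walk_dist G Z a"
    and z: "Z \<in> network_points G" "z \<in> Z"
    and \<alpha>: "L \<le> \<alpha>" "C + 1 \<le> \<alpha>" and K: "0 \<le> K"
    and test: "\<And>t Y b b' g g'. t \<in> {0<..<T} \<Longrightarrow> Y \<in> network_points G \<Longrightarrow>
      upper_test G T V t Y b b' g g' \<Longrightarrow> (\<And>i. i \<in> Y \<Longrightarrow> \<bar>g' i (snd i)\<bar> \<le> \<alpha>) \<Longrightarrow> b' t \<le> K"
    and t: "t \<in> {0..<T}"
  shows "V t z \<le> v z + \<epsilon> + K * t"
proof (rule field_le_epsilon)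
  fix d :: real assume d: "0 < d"
  define \<sigma> where "\<sigma> = d / \<alpha>"
  have \<alpha>0: "0 < \<alpha>" using \<alpha>(2) C by simp
  have \<sigma>: "0 < \<sigma>" "\<alpha> * \<sigma> = d" using d \<alpha>0 by (auto simp: \<sigma>_def)
  have zE: "z \<in> edge_points G" using network_point_subset[OF z(1)] z(2) by blast
  let ?D = "walk_dist G Z"
  have Dz: "?D z = 0" using walk_dist_start[OF z] .
  have D0: "0 \<le> ?D a" if "a \<in> edge_points G" for a using walk_dist_nonneg[OF z(1) that] .
  have v': "v a \<le> v z + \<epsilon> + d + \<alpha> * soft \<sigma> (?D a)" if a: "a \<in> edge_points G" for a
  proof -
    have "L * ?D a \<le> \<alpha> * ?D a" using \<alpha>(1) D0[OF a] by (rule mult_right_mono)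
    also have "\<dots> \<le> \<alpha> * (soft \<sigma> (?D a) + \<sigma>)" using soft_ge \<alpha>0 by (intro mult_left_mono) auto
    finally show ?thesis using v[OF a] \<sigma>(2) by (simp add: algebra_simps)
  qed
  show "V t z \<le> v z + \<epsilon> + K * t + d"
  proof (rule ccontr)
    assume "\<not> ?thesis"
    then have gap: "v z + \<epsilon> + d < V t z - K * t" by simp
    define \<eta> where "\<eta> = (V t z - K * t - (v z + \<epsilon> + d)) / 2 * (T - t)"
    have \<eta>: "0 < \<eta>" "\<eta> / (T - t) = (V t z - K * t - (v z + \<epsilon> + d)) / 2"
      using gap t by (auto simp: \<eta>_def simp del: times_divide_eq_left)
    define F where "F s a = V s a - \<alpha> * soft \<sigma> (?D a) - (K * s + \<eta> / (T - s))" for s a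
    define f1 where "f1 = F t z"
    have f1: "v z + \<epsilon> + d < f1"
      unfolding f1_def F_def Dz using \<eta>(2) gap soft_0[of \<sigma>] \<sigma>(1) by simp (simp add: field_simps)
    \<comment> \<open>Where the penalised difference is at least \<open>f1\<close>, the distance and the time penalty are bounded.\<close>
    define B where "B = C * (1 + walk_dist G x0 z) + d - f1"
    have upper: "?D a + \<eta> / (T - s) \<le> B" if s: "s \<in> {0..<T}" and a: "a \<in> edge_points G" and F: "f1 \<le> F s a" for s a
    proof -
      have "V s a \<le> C * (1 + walk_dist G x0 a)" using V_growth[OF s a] .
      also have "\<dots> \<le> C * (1 + (walk_dist G x0 z + ?D a))"
        using walk_dist_triangle[OF x0 z a] C by (intro mult_left_mono) auto
      finally have 1: "V s a \<le> C * (1 + walk_dist G x0 z) + C * ?D a" by (simp add: algebra_simps)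
      have "(C + 1) * ?D a \<le> \<alpha> * ?D a" using \<alpha>(2) D0[OF a] by (rule mult_right_mono)
      also have "\<dots> \<le> \<alpha> * (soft \<sigma> (?D a) + \<sigma>)" using soft_ge \<alpha>0 by (intro mult_left_mono) auto
      finally have 2: "C * ?D a + ?D a \<le> \<alpha> * soft \<sigma> (?D a) + d" using \<sigma>(2) by (simp add: algebra_simps)
      have "0 \<le> K * s" using K s by simp
      then show ?thesis using F 1 2 unfolding F_def B_def by linarith
    qed
    have tB: "\<eta> / (T - t) \<le> B" using upper[OF t zE] Dz by (simp add: f1_def)
    have "0 < \<eta> / (T - t)" using \<eta>(1) t by simp
    then have B: "0 < B" using tB by linarith
    define \<tau> where "\<tau> = \<eta> / B"
    have \<tau>: "0 < \<tau>" using \<eta>(1) B by (simp add: \<tau>_def)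
    have late: "s \<le> T - \<tau>" if s: "s \<in> {0..<T}" and "\<eta> / (T - s) \<le> B" for s
    proof -
      have "\<eta> \<le> B * (T - s)" using that by (simp add: pos_divide_le_eq)
      then show ?thesis using B by (simp add: \<tau>_def field_simps)
    qed
    have sub: "{0..T - \<tau>} \<subseteq> {0..<T}" using \<tau> by auto
    have "usc_on ({0..T - \<tau>} \<times> edge G e) (\<lambda>q. F (fst q) (e, snd q))" if e: "e \<in> edges G" for e
    proof -
      let ?P = "{0..T - \<tau>} \<times> edge G e"
      have 1: "usc_on ?P (\<lambda>q. V (fst q) (e, snd q))"
        using usc_on_subset[OF V_usc[OF e], of ?P] sub by (auto simp: case_prod_unfold)
      have "continuous_on (edge G e) (\<lambda>x. ?D (e, x))" using walk_dist_continuous[OF z(1) e] .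
      then have Dc: "continuous_on ?P (\<lambda>q. ?D (e, snd q))"
        by (rule continuous_on_compose2) (auto intro: continuous_intros)
      have "continuous_on UNIV (soft \<sigma>)"
        using soft_C1[OF \<sigma>(1)] unfolding C1_line_def by (auto intro: DERIV_continuous_on)
      then have "continuous_on ?P (\<lambda>q. soft \<sigma> (?D (e, snd q)))"
        by (rule continuous_on_compose2) (use Dc in auto)
      moreover have "T - fst q \<noteq> 0" if "q \<in> ?P" for q using that \<tau> by auto
      then have "continuous_on ?P (\<lambda>q. K * fst q + \<eta> / (T - fst q))"
        by (intro continuous_intros ballI)
      ultimately have "continuous_on ?P (\<lambda>q. - \<alpha> * soft \<sigma> (?D (e, snd q)) - (K * fst q + \<eta> / (T - fst q)))"
        by (intro continuous_on_diff continuous_on_mult_left)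
      from usc_on_add[OF 1 usc_on_continuous[OF this]]
      show ?thesis unfolding F_def by (simp add: algebra_simps)
    qed
    moreover have "t \<in> {0..T - \<tau>}" using late[OF t tB] t by simp
    moreover have "?D z \<le> B" using Dz B by simp
    ultimately obtain s a where sa: "s \<in> {0..T - \<tau>}" "a \<in> edge_points G" "?D a \<le> B"
      "\<And>q b. q \<in> {0..T - \<tau>} \<Longrightarrow> b \<in> edge_points G \<Longrightarrow> ?D b \<le> B \<Longrightarrow> F q b \<le> F s a"
      using attains_max_sublevel[OF z(1) compact_Icc, of 0 "T - \<tau>" F t z B] zE by blast
    have s: "s \<in> {0..<T}" using sa(1) sub by blast
    have "f1 \<le> F s a" unfolding f1_def using sa(4)[OF \<open>t \<in> {0..T - \<tau>}\<close> zE \<open>?D z \<le> B\<close>] .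
    have max: "F q b \<le> F s a" if q: "q \<in> {0..<T}" "b \<in> edge_points G" for q b
    proof (cases "f1 \<le> F q b")
      case True
      have "0 < \<eta> / (T - q)" using \<eta>(1) q(1) by simp
      then have "?D b \<le> B" "\<eta> / (T - q) \<le> B" using upper[OF q True] D0[OF q(2)] by linarith+
      then show ?thesis using sa(4)[of q b] late[OF q(1)] q by simp
    next
      case False
      then show ?thesis using \<open>f1 \<le> F s a\<close> by simp
    qed
    have "s \<noteq> 0"
    proof
      assume "s = 0"
      then have "F s a \<le> v a - \<alpha> * soft \<sigma> (?D a) - \<eta> / T" using V_0[OF sa(2)] by (simp add: F_def)
      moreover have "0 < \<eta> / T" using \<eta>(1) T by simp
      ultimately show False using v'[OF sa(2)] \<open>f1 \<le> F s a\<close> f1 by linarith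
    qed
    then have s0: "s \<in> {0<..<T}" using s by simp
    let ?Y = "proj G a"
    have Y: "?Y \<in> network_points G" using proj_network_point[OF sa(2)] .
    obtain h h' where h: "\<forall>i\<in>?Y. C1_line (h i) (h' i) \<and> h i (snd i) = 0 \<and> \<bar>h' i (snd i)\<bar> \<le> (1::real) \<and>
      (\<forall>y\<in>edge G (fst i). soft \<sigma> (?D (fst i, y)) \<le> soft \<sigma> (?D i) + h i y)"
      using soft_dist_tests[OF z(1) Y \<sigma>(1)] by blast
    define b where "b s = K * s + \<eta> / (T - s)" for s
    define b' where "b' s = K + \<eta> / (T - s)\<^sup>2" for s
    have "upper_test G T V s ?Y b b' (\<lambda>i y. \<alpha> * h i y) (\<lambda>i y. \<alpha> * h' i y)"
      unfolding upper_test_def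
    proof (intro conjI ballI exI[of _ "1::real"] impI)
      show "(b has_real_derivative b' s) (at s)" if "s \<in> {0<..<T}" for s
        unfolding b_def b'_def
        using DERIV_add[OF DERIV_cmult[OF DERIV_ident, of K] time_penalty_deriv[of s T \<eta>]] that by simp
      show "continuous_on {0<..<T} b'" unfolding b'_def
        by (intro continuous_on_add continuous_on_const time_penalty_continuous)
      fix q i y assume q: "q \<in> {0<..<T}" and i: "i \<in> ?Y" and y: "y \<in> edge G (fst i)"
      have iE: "i \<in> edge_points G" using i network_point_subset[OF Y] by blast
      then have iy: "(fst i, y) \<in> edge_points G" using y by (auto simp: edge_points_def)
      have "V s a = V s i" "?D a = ?D i"
        using V_point[OF Y proj_mem[OF sa(2)] i] walk_dist_point[OF z(1) Y proj_mem[OF sa(2)] i] by auto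
      moreover have "F q (fst i, y) \<le> F s a" using max[of q] q iy by auto
      moreover have "\<alpha> * soft \<sigma> (?D (fst i, y)) \<le> \<alpha> * (soft \<sigma> (?D i) + h i y)"
        using h i y \<alpha>0 by (intro mult_left_mono) auto
      ultimately show "V q (fst i, y) \<le> V s i + (b q - b s) + \<alpha> * h i y"
        unfolding F_def b_def by (simp add: algebra_simps)
    qed (use h in \<open>auto intro: C1_line_cmult\<close>)
    moreover have "\<bar>\<alpha> * h' i (snd i)\<bar> \<le> \<alpha>" if "i \<in> ?Y" for i
      using h that \<alpha>0 mult_left_mono[of "\<bar>h' i (snd i)\<bar>" 1 \<alpha>] by (simp add: abs_mult)
    ultimately have "b' s \<le> K" using test[OF s0 Y] by blast
    moreover have "0 < \<eta> / (T - s)\<^sup>2" using \<eta>(1) s by simp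
    ultimately show False by (simp add: b'_def)
  qed
qed

end


section \<open>Elementary bounds on the Hamiltonians\<close>

text \<open>\<open>H e t c (clip c (p0 e t c) p)\<close> is the part of the Hamiltonian at the end \<open>c\<close> of \<open>e\<close> which
  is nonincreasing in the inward slope.\<close>

definition clip :: "real \<Rightarrow> real \<Rightarrow> real \<Rightarrow> real" where
  "clip c q p = (if c = 0 then min p q else max p q)"

text \<open>The segment is divided into steps shorter than \<open>\<delta>\<close>.\<close>

lemma oscillation_linear:
  assumes convex: "\<And>\<tau>. 0 \<le> \<tau> \<Longrightarrow> \<tau> \<le> 1 \<Longrightarrow> x + \<tau> * (y - x) \<in> S"
    and osc: "\<And>x y. x \<in> S \<Longrightarrow> y \<in> S \<Longrightarrow> \<bar>x - y\<bar> < \<delta> \<Longrightarrow> \<bar>f x - f y\<bar> \<le> \<epsilon>"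
    and "0 < \<delta>" "0 < \<epsilon>"
  shows "\<bar>f x - f y\<bar> \<le> \<epsilon> + 2 * \<epsilon> / \<delta> * \<bar>x - (y::real)\<bar>"
proof -
  define N where "N = nat \<lfloor>2 * \<bar>x - y\<bar> / \<delta>\<rfloor> + 1"
  have N: "2 * \<bar>x - y\<bar> / \<delta> < real N" "real N \<le> 2 * \<bar>x - y\<bar> / \<delta> + 1" "0 < N"
    using assms(3) unfolding N_def by (auto, linarith+)
  have "\<bar>f x - f (x + real k / real N * (y - x))\<bar> \<le> real k * \<epsilon>" if "k \<le> N" for k
    using that
  proof (induction k)
    case (Suc k)
    let ?a = "x + real k / real N * (y - x)" and ?b = "x + real (Suc k) / real N * (y - x)"
    have S: "?a \<in> S" "?b \<in> S"
      using Suc.prems by (auto intro!: convex simp del: of_nat_Suc times_divide_eq_left)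
    have "?a - ?b = (x - y) / real N" using N(3) by (simp add: field_simps)
    then have 1: "\<bar>?a - ?b\<bar> = \<bar>x - y\<bar> / real N" by (simp add: abs_divide)
    have "2 * \<bar>x - y\<bar> < real N * \<delta>" using N(1) assms(3) by (simp add: pos_divide_less_eq)
    then have "\<bar>x - y\<bar> < \<delta> * real N"
      using le_less_trans[of "\<bar>x - y\<bar>" "2 * \<bar>x - y\<bar>"] by (simp add: mult.commute)
    then have "\<bar>?a - ?b\<bar> < \<delta>" unfolding 1 using N(3) by (simp add: pos_divide_less_eq)
    then have "\<bar>f ?a - f ?b\<bar> \<le> \<epsilon>" using osc S by blast
    moreover have "\<bar>f x - f ?a\<bar> \<le> real k * \<epsilon>" using Suc by simp
    ultimately show ?case by (simp add: algebra_simps del: times_divide_eq_left)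
  qed simp
  from this[of N] have "\<bar>f x - f y\<bar> \<le> real N * \<epsilon>" using N(3) by simp
  also have "\<dots> \<le> (2 * \<bar>x - y\<bar> / \<delta> + 1) * \<epsilon>" using N(2) assms(4) by (intro mult_right_mono) auto
  finally show ?thesis by (simp add: algebra_simps)
qed

context network_graph
begin

lemma network_hamiltonian_interior:
  assumes "e \<in> edges G" "x \<in> edge_interior G e"
  shows "network_hamiltonian G H p0 A t {(e, x)} p = H e t x (p (e, x))"
  using interior_not_vertex[OF assms(2)] by (simp add: network_hamiltonian_def)

lemma edges_plus_iff:
  assumes n: "n \<in> vertices G"
  shows "e \<in> edges_plus G n \<longleftrightarrow> len G e \<noteq> \<infinity> \<and> (e, real_of_ereal (len G e)) \<in> n"
  using vertex_subset[OF n] by (auto simp: edges_plus_def endpoints_def edge_points_def)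

lemma flux_bounds:
  assumes n: "n \<in> vertices G"
  shows "A n t \<le> network_hamiltonian G H p0 A t n p"
    and "(e, c) \<in> n \<Longrightarrow> H e t c (clip c (p0 e t c) (p (e, c))) \<le> network_hamiltonian G H p0 A t n p"
    and "network_hamiltonian G H p0 A t n p = A n t \<or>
      (\<exists>e c. (e, c) \<in> n \<and> network_hamiltonian G H p0 A t n p = H e t c (clip c (p0 e t c) (p (e, c))))"
proof -
  let ?f = "\<lambda>e. H_minus H p0 e t 0 (p (e, 0))"
  let ?g = "\<lambda>e. let l = real_of_ereal (len G e) in H_plus H p0 e t l (p (e, l))"
  let ?S = "insert (A n t) (?f ` edges_minus G n \<union> ?g ` edges_plus G n)"
  have NH: "network_hamiltonian G H p0 A t n p = Max ?S"
    using n by (simp add: network_hamiltonian_def flux_def)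
  have "edges_minus G n \<subseteq> fst ` n" "edges_plus G n \<subseteq> fst ` n"
    by (force simp: edges_minus_def edges_plus_def)+
  then have fin: "finite ?S"
    using network_point_finite[OF vertex_network_point[OF n]] finite_subset by blast
  have f: "?f e = H e t 0 (clip 0 (p0 e t 0) (p (e, 0)))" for e
    by (simp add: H_minus_def clip_def min_def)
  have g: "?g e = H e t l (clip l (p0 e t l) (p (e, l)))" if "l = real_of_ereal (len G e)" "l \<noteq> 0" for e l
    using that by (auto simp: H_plus_def clip_def max_def Let_def)
  have plus0: "real_of_ereal (len G e) \<noteq> 0" if "e \<in> edges G" "len G e \<noteq> \<infinity>" for e
    using min_len(1) min_len(2)[OF that(1)] that(2) by (cases "len G e") auto
  show "A n t \<le> network_hamiltonian G H p0 A t n p"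
    unfolding NH using fin by (intro Max_ge) auto
  show "H e t c (clip c (p0 e t c) (p (e, c))) \<le> network_hamiltonian G H p0 A t n p" if ec: "(e, c) \<in> n"
  proof -
    have end_pt: "(e, c) \<in> endpoints G" using vertex_subset[OF n] ec by blast
    have "H e t c (clip c (p0 e t c) (p (e, c))) \<in> ?S"
    proof (cases "c = 0")
      case True
      then have "e \<in> edges_minus G n" using ec endpoint_cases[OF end_pt] by (simp add: edges_minus_def)
      then have "?f e \<in> ?S" by (intro insertI2 UnI1 imageI)
      then show ?thesis using True unfolding f[of e] by simp
    next
      case False
      then have c: "ereal c = len G e" using endpoint_cases(3)[OF end_pt] by blast
      then have l: "c = real_of_ereal (len G e)" by (metis real_of_ereal.simps(1))
      have "len G e \<noteq> \<infinity>" using c[symmetric] by simp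
      then have "e \<in> edges_plus G n" using ec l by (simp add: edges_plus_iff[OF n])
      then have "?g e \<in> ?S" by (intro insertI2 UnI2 imageI)
      then show ?thesis unfolding g[OF l False] .
    qed
    then show ?thesis unfolding NH using fin by (intro Max_ge)
  qed
  have "Max ?S \<in> ?S" using fin by (intro Max_in) auto
  then have "Max ?S = A n t \<or> (\<exists>e c. (e, c) \<in> n \<and> Max ?S = H e t c (clip c (p0 e t c) (p (e, c))))"
    (is ?Q)
  proof (elim insertE UnE imageE)
    assume "Max ?S = A n t"
    then show ?Q by (rule disjI1)
  next
    fix e assume "Max ?S = ?f e" "e \<in> edges_minus G n"
    then have "(e, 0) \<in> n \<and> Max ?S = H e t 0 (clip 0 (p0 e t 0) (p (e, 0)))"
      unfolding f[of e] edges_minus_def by (elim CollectE conjE) (intro conjI)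
    then show ?Q by (intro disjI2 exI)
  next
    fix e assume e: "Max ?S = ?g e" "e \<in> edges_plus G n"
    let ?l = "real_of_ereal (len G e)"
    have "(e, ?l) \<in> n" "?l \<noteq> 0" using e(2) plus0 by (auto simp: edges_plus_def)
    then have "(e, ?l) \<in> n \<and> Max ?S = H e t ?l (clip ?l (p0 e t ?l) (p (e, ?l)))"
      using g[OF refl, of e] e(1) by (metis (no_types, lifting))
    then show ?Q by (intro disjI2 exI)
  qed
  then show "network_hamiltonian G H p0 A t n p = A n t \<or>
      (\<exists>e c. (e, c) \<in> n \<and> network_hamiltonian G H p0 A t n p = H e t c (clip c (p0 e t c) (p (e, c))))"
    unfolding NH .
qed

lemma H4_monotone:
  assumes "H4 G H p0" "n \<in> vertices G" "(e, c) \<in> n" "0 \<le> t"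
  shows "p \<le> q \<Longrightarrow> q \<le> p0 e t c \<Longrightarrow> H e t c q \<le> H e t c p"
    and "p0 e t c \<le> p \<Longrightarrow> p \<le> q \<Longrightarrow> H e t c p \<le> H e t c q"
    and "H e t c (p0 e t c) \<le> H e t c p"
    and "H e t c (clip c (p0 e t c) p) \<le> H e t c p"
proof -
  have m: "antimono_on {..p0 e t c} (H e t c)" "mono_on {p0 e t c..} (H e t c)"
    using assms(1)[unfolded H4_def, rule_format, OF assms(2,3)] assms(4) by auto
  show 1: "H e t c q \<le> H e t c p" if "p \<le> q" "q \<le> p0 e t c" for p q
    using m(1) that by (auto simp: monotone_on_def)
  show 2: "H e t c p \<le> H e t c q" if "p0 e t c \<le> p" "p \<le> q" for p q
    using m(2) that by (auto simp: monotone_on_def)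
  show 3: "H e t c (p0 e t c) \<le> H e t c p" for p
    using 1[of p "p0 e t c"] 2[of "p0 e t c" p] by linarith
  show "H e t c (clip c (p0 e t c) p) \<le> H e t c p"
    using 3[of p] by (auto simp: clip_def min_def max_def)
qed

lemma H_continuous_space:
  assumes "H0 G H" "e \<in> edges G" "0 \<le> t" shows "continuous_on (edge G e) (\<lambda>x. H e t x p)"
proof -
  have "continuous_on ({0..} \<times> edge G e \<times> UNIV) (\<lambda>(t, x, q). H e t x q)"
    using assms by (auto simp: H0_def)
  then have "continuous_on (edge G e) (\<lambda>x. (\<lambda>(t, x, q). H e t x q) (t, x, p))"
    by (rule continuous_on_compose2) (use assms in \<open>auto intro!: continuous_intros\<close>)
  then show ?thesis by simp
qed

lemma H2_on_edge:
  assumes "H0 G H" "H2 G H" "0 < T" "0 < L"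
  obtains C where "0 < C" "\<And>e x t p. e \<in> edges G \<Longrightarrow> x \<in> edge G e \<Longrightarrow> t \<in> {0..T} \<Longrightarrow> \<bar>p\<bar> \<le> L \<Longrightarrow> \<bar>H e t x p\<bar> \<le> C"
proof -
  have "\<exists>C>0. \<forall>e\<in>edges G. \<forall>x\<in>edge_interior G e. \<forall>t\<in>{0..T}. \<forall>p. \<bar>p\<bar> \<le> L \<longrightarrow> \<bar>H e t x p\<bar> \<le> C"
    using assms(2-4) unfolding H2_def by blast
  then obtain C where C: "0 < C" "\<forall>e\<in>edges G. \<forall>x\<in>edge_interior G e. \<forall>t\<in>{0..T}. \<forall>p. \<bar>p\<bar> \<le> L \<longrightarrow> \<bar>H e t x p\<bar> \<le> C"
    by blast
  have "\<bar>H e t x p\<bar> \<le> C" if e: "e \<in> edges G" "x \<in> edge G e" "t \<in> {0..T}" "\<bar>p\<bar> \<le> L" for e x t p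
  proof (rule continuous_le_on_closure[where S = "edge_interior G e" and f = "\<lambda>x. \<bar>H e t x p\<bar>"])
    show "continuous_on (closure (edge_interior G e)) (\<lambda>x. \<bar>H e t x p\<bar>)"
      unfolding edge_closure_interior[OF e(1)]
      using H_continuous_space[OF assms(1) e(1)] e(3) by (intro continuous_intros) auto
    show "x \<in> closure (edge_interior G e)" using e by (simp add: edge_closure_interior)
    show "\<bar>H e t y p\<bar> \<le> C" if "y \<in> edge_interior G e" for y using C(2) e that by blast
  qed
  then show thesis using that C(1) by blast
qed

text \<open>From below at a vertex, the flux limiter alone bounds the Hamiltonian. From above, clipping a slope can only
  decrease \<open>H\<close>.\<close>

lemma network_hamiltonian_bounded:
  assumes H: "H0 G H" "H2 G H" "H4 G H p0" and A: "A1 G A" and T: "0 < T" and \<alpha>: "0 < \<alpha>"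
  obtains K where "0 \<le> K" "\<And>t z p. t \<in> {0..T} \<Longrightarrow> z \<in> network_points G \<Longrightarrow> (\<And>i. i \<in> z \<Longrightarrow> \<bar>p i\<bar> \<le> \<alpha>) \<Longrightarrow>
    \<bar>network_hamiltonian G H p0 A t z p\<bar> \<le> K"
proof -
  obtain C where C: "0 < C" "\<And>e x t p. e \<in> edges G \<Longrightarrow> x \<in> edge G e \<Longrightarrow> t \<in> {0..T} \<Longrightarrow> \<bar>p\<bar> \<le> \<alpha> \<Longrightarrow> \<bar>H e t x p\<bar> \<le> C"
    using H2_on_edge[OF H(1,2) T \<alpha>] by blast
  obtain CA where CA: "0 < CA" "\<And>n t. n \<in> vertices G \<Longrightarrow> t \<in> {0..T} \<Longrightarrow> \<bar>A n t\<bar> \<le> CA"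
    using A T unfolding A1_def by blast
  have "\<bar>network_hamiltonian G H p0 A t z p\<bar> \<le> max C CA"
    if t: "t \<in> {0..T}" and z: "z \<in> network_points G" and p: "\<And>i. i \<in> z \<Longrightarrow> \<bar>p i\<bar> \<le> \<alpha>" for t z p
    using z
  proof (cases rule: network_point_cases)
    case vertex
    have "H e t c (clip c (p0 e t c) (p (e, c))) \<le> C" if ec: "(e, c) \<in> z" for e c
    proof -
      have "e \<in> edges G" "c \<in> edge G e" using ec network_point_subset[OF z] by (auto simp: edge_points_def)
      then have "\<bar>H e t c (p (e, c))\<bar> \<le> C" using C(2) t p[OF ec] by blast
      then show ?thesis using H4_monotone(4)[OF H(3) vertex ec, of t "p (e, c)"] t by simp
    qed
    then have "network_hamiltonian G H p0 A t z p \<le> max C CA"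
      using flux_bounds(3)[OF vertex, where A = A and t = t and H = H and ?p0.0 = p0 and p = p] CA(2)[OF vertex t]
      by (elim disjE exE conjE) (force simp: abs_le_iff le_max_iff_disj)+
    moreover have "- max C CA \<le> network_hamiltonian G H p0 A t z p"
      using flux_bounds(1)[OF vertex, where A = A and t = t and H = H and ?p0.0 = p0 and p = p] CA(2)[OF vertex t]
      max.cobounded2[of CA C] by linarith
    ultimately show ?thesis by (simp add: abs_le_iff)
  next
    case (interior e x)
    then have "\<bar>H e t x (p (e, x))\<bar> \<le> C" using C(2) t p interior_in_edge by blast
    then show ?thesis using network_hamiltonian_interior interior by simp
  qed
  then show thesis using that[of "max C CA"] C(1) by auto
qed

lemma initial_datum_oscillation:
  assumes u0: "uniformly_continuous_on_network G u0" and \<epsilon>: "0 < \<epsilon>"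
  obtains L where "0 \<le> L" "\<And>e x y. e \<in> edges G \<Longrightarrow> x \<in> edge G e \<Longrightarrow> y \<in> edge G e \<Longrightarrow>
    \<bar>u0 (proj G (e, x)) - u0 (proj G (e, y))\<bar> \<le> \<epsilon> + L * \<bar>x - y\<bar>"
proof -
  obtain \<delta> where \<delta>: "0 < \<delta>" "\<And>x y. x \<in> network_points G \<Longrightarrow> y \<in> network_points G \<Longrightarrow>
    network_dist G x y < \<delta> \<Longrightarrow> \<bar>u0 x - u0 y\<bar> < \<epsilon>"
    using u0 \<epsilon> unfolding uniformly_continuous_on_network_def by meson
  have small: "\<bar>u0 (proj G (e, x)) - u0 (proj G (e, y))\<bar> \<le> \<epsilon>"
    if e: "e \<in> edges G" "x \<in> edge G e" "y \<in> edge G e" "\<bar>x - y\<bar> < \<delta>" for e x y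
  proof -
    have E: "(e, x) \<in> edge_points G" "(e, y) \<in> edge_points G" using e by (auto simp: edge_points_def)
    have "walk G (proj G (e, x)) (0 + \<bar>x - y\<bar>) (e, y)"
      using walk.along[OF walk.start[OF proj_mem[OF E(1)]] e(3)] .
    then have "network_dist G (proj G (e, x)) (proj G (e, y)) < \<delta>"
      using network_dist_le_walk[OF proj_network_point[OF E(1)]] e(4) by fastforce
    then show ?thesis using \<delta>(2) proj_network_point E by (simp add: less_imp_le)
  qed
  have "\<bar>u0 (proj G (e, x)) - u0 (proj G (e, y))\<bar> \<le> \<epsilon> + 2 * \<epsilon> / \<delta> * \<bar>x - y\<bar>"
    if "e \<in> edges G" "x \<in> edge G e" "y \<in> edge G e" for e x y
    using oscillation_linear[of x y "edge G e" \<delta> "\<lambda>x. u0 (proj G (e, x))" \<epsilon>]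
      segment_in_edge[OF that(2,3)] small[OF that(1)] \<delta>(1) \<epsilon> by blast
  then show thesis using that[of "2 * \<epsilon> / \<delta>"] \<epsilon> \<delta>(1) by simp
qed

lemma initial_datum_growth:
  assumes u0: "uniformly_continuous_on_network G u0" and \<epsilon>: "0 < \<epsilon>"
  obtains L where "0 \<le> L" "\<And>Z a. Z \<in> network_points G \<Longrightarrow> a \<in> edge_points G \<Longrightarrow>
    \<bar>u0 (proj G a) - u0 Z\<bar> \<le> \<epsilon> + L * walk_dist G Z a"
proof -
  have e4: "0 < \<epsilon> / 4" using \<epsilon> by simp
  obtain L where L: "0 \<le> L" "\<And>e x y. e \<in> edges G \<Longrightarrow> x \<in> edge G e \<Longrightarrow> y \<in> edge G e \<Longrightarrow>
    \<bar>u0 (proj G (e, x)) - u0 (proj G (e, y))\<bar> \<le> \<epsilon> / 4 + L * \<bar>x - y\<bar>"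
    using initial_datum_oscillation[OF u0 e4] by blast
  let ?L = "L + \<epsilon> / 4 / min_len"
  have L': "0 \<le> ?L" using L(1) \<epsilon> min_len(1) by simp
  have "\<bar>u0 (proj G a) - u0 Z\<bar> \<le> \<epsilon> + ?L * walk_dist G Z a" if Z: "Z \<in> network_points G" and a: "a \<in> edge_points G" for Z a
  proof -
    obtain z where z: "z \<in> Z" using network_point_nonempty[OF Z] by blast
    define d where "d = \<epsilon> / 4 / (?L + 1)"
    have d: "0 < d" using \<epsilon> L' by (simp add: d_def)
    have "walk_dist G Z a < walk_dist G Z a + d" using d by simp
    then obtain r where r: "r < walk_dist G Z a + d" "walk G Z r a" using walk_dist_less[OF Z a] by blast
    have glue: "u0 (proj G a) = u0 (proj G b)" if "n \<in> network_points G" "a \<in> n" "b \<in> n" for n a b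
      using network_point_proj that by metis
    have "\<bar>u0 (proj G a) - u0 (proj G z)\<bar> \<le> 2 * (\<epsilon> / 4) + ?L * r"
    proof (rule walk_oscillation[OF Z z r(2)])
      show "0 \<le> \<epsilon> / 4" "0 \<le> L" using e4 L(1) by auto
    qed (rule glue L(2); assumption)+
    also have "?L * r \<le> ?L * (walk_dist G Z a + d)" using r(1) L' by (intro mult_left_mono) auto
    also have "?L * (walk_dist G Z a + d) = ?L * walk_dist G Z a + ?L * d" by (rule distrib_left)
    also have "?L * d \<le> (?L + 1) * d" using d by (intro mult_right_mono) auto
    also have "(?L + 1) * d = \<epsilon> / 4"
      unfolding d_def using L' by (subst times_divide_eq_right, subst nonzero_mult_div_cancel_left) auto
    finally show ?thesis using network_point_proj[OF Z z] \<epsilon> by simp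
  qed
  then show thesis using that[OF L'] by blast
qed

lemma subsolution_barrier:
  assumes H: "H0 G H" "H2 G H" "H4 G H p0" and A: "A1 G A" and T: "0 < T"
    and u0: "uniformly_continuous_on_network G u0"
    and sub: "subsolution G H p0 A T u0 u" and C: "0 < C" and x0: "x0 \<in> network_points G"
    and growth: "\<And>t x. t \<in> {0..<T} \<Longrightarrow> x \<in> network_points G \<Longrightarrow> u t x \<le> C * (1 + network_dist G x0 x)"
    and \<epsilon>: "0 < \<epsilon>"
  obtains K where "0 \<le> K" "\<And>t a. t \<in> {0..<T} \<Longrightarrow> a \<in> edge_points G \<Longrightarrow>
    upper_env G T u t a \<le> u0 (proj G a) + \<epsilon> + K * t"
proof -
  have int: "subsolution_interior G H p0 A T u" and init: "\<And>z. z \<in> network_points G \<Longrightarrow> usc_env G T u 0 z \<le> ereal (u0 z)"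
    using sub by (auto simp: subsolution_def)
  have u: "locally_bounded G T u" using int by (simp add: subsolution_interior_def)
  obtain L where L: "0 \<le> L" "\<And>Z a. Z \<in> network_points G \<Longrightarrow> a \<in> edge_points G \<Longrightarrow>
    \<bar>u0 (proj G a) - u0 Z\<bar> \<le> \<epsilon> + L * walk_dist G Z a" using initial_datum_growth[OF u0 \<epsilon>] by blast
  define \<alpha> where "\<alpha> = max L (C + 1)"
  have \<alpha>: "L \<le> \<alpha>" "C + 1 \<le> \<alpha>" "0 < \<alpha>" using C by (auto simp: \<alpha>_def)
  obtain K where K: "0 \<le> K" "\<And>t z p. t \<in> {0..T} \<Longrightarrow> z \<in> network_points G \<Longrightarrow> (\<And>i. i \<in> z \<Longrightarrow> \<bar>p i\<bar> \<le> \<alpha>) \<Longrightarrow>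
    \<bar>network_hamiltonian G H p0 A t z p\<bar> \<le> K" using network_hamiltonian_bounded[OF H A T \<alpha>(3)] by blast
  have "upper_env G T u t a \<le> u0 (proj G a) + \<epsilon> + K * t" if t: "t \<in> {0..<T}" and a: "a \<in> edge_points G" for t a
  proof (rule barrier[where v = "\<lambda>a. u0 (proj G a)" and L = L,
        OF T _ _ x0 C _ _ _ proj_network_point[OF a] proj_mem[OF a] \<alpha>(1,2) K(1) _ t])
    show "usc_on ({0..<T} \<times> edge G e) (\<lambda>(t, x). upper_env G T u t (e, x))" if "e \<in> edges G" for e
      using upper_env_usc[OF u that] .
    show "upper_env G T u t b = upper_env G T u t c" if "z \<in> network_points G" "b \<in> z" "c \<in> z" for z b c t
      using upper_env_point[OF that] .
    show "upper_env G T u t b \<le> C * (1 + walk_dist G x0 b)" if "t \<in> {0..<T}" "b \<in> edge_points G" for t b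
      using upper_env_growth[OF u that x0 C growth] .
    show "upper_env G T u 0 b \<le> u0 (proj G b)" if "b \<in> edge_points G" for b
      using init[OF proj_network_point[OF that]] upper_env_eq[OF u _ that, of 0] T by simp
    show "u0 (proj G b) \<le> u0 (proj G a) + \<epsilon> + L * walk_dist G (proj G a) b" if "b \<in> edge_points G" for b
      using L(2)[OF proj_network_point[OF a] that] by linarith
    show "b' t \<le> K" if t: "t \<in> {0<..<T}" and Y: "Y \<in> network_points G"
      and test: "upper_test G T (upper_env G T u) t Y b b' g g'" and s: "\<And>i. i \<in> Y \<Longrightarrow> \<bar>g' i (snd i)\<bar> \<le> \<alpha>" for t Y b b' g g'
      using subsolution_test[OF int t Y test] K(2)[OF _ Y s, of t] t by fastforce
  qed
  then show thesis using that K(1) by blast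
qed

lemma supersolution_barrier:
  assumes H: "H0 G H" "H2 G H" "H4 G H p0" and A: "A1 G A" and T: "0 < T"
    and u0: "uniformly_continuous_on_network G u0"
    and sup: "supersolution G H p0 A T u0 w" and C: "0 < C" and x0: "x0 \<in> network_points G"
    and growth: "\<And>t x. t \<in> {0..<T} \<Longrightarrow> x \<in> network_points G \<Longrightarrow> - C * (1 + network_dist G x0 x) \<le> w t x"
    and \<epsilon>: "0 < \<epsilon>"
  obtains K where "0 \<le> K" "\<And>t a. t \<in> {0..<T} \<Longrightarrow> a \<in> edge_points G \<Longrightarrow>
    upper_env G T (\<lambda>t z. - w t z) t a \<le> - u0 (proj G a) + \<epsilon> + K * t"
proof -
  let ?w = "\<lambda>t z. - w t z"
  have int: "supersolution_interior G H p0 A T w" and init: "\<And>z. z \<in> network_points G \<Longrightarrow> ereal (u0 z) \<le> lsc_env G T w 0 z"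
    using sup by (auto simp: supersolution_def)
  have u: "locally_bounded G T ?w" using int locally_bounded_uminus by (auto simp: supersolution_interior_def)
  obtain L where L: "0 \<le> L" "\<And>Z a. Z \<in> network_points G \<Longrightarrow> a \<in> edge_points G \<Longrightarrow>
    \<bar>u0 (proj G a) - u0 Z\<bar> \<le> \<epsilon> + L * walk_dist G Z a" using initial_datum_growth[OF u0 \<epsilon>] by blast
  define \<alpha> where "\<alpha> = max L (C + 1)"
  have \<alpha>: "L \<le> \<alpha>" "C + 1 \<le> \<alpha>" "0 < \<alpha>" using C by (auto simp: \<alpha>_def)
  obtain K where K: "0 \<le> K" "\<And>t z p. t \<in> {0..T} \<Longrightarrow> z \<in> network_points G \<Longrightarrow> (\<And>i. i \<in> z \<Longrightarrow> \<bar>p i\<bar> \<le> \<alpha>) \<Longrightarrow>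
    \<bar>network_hamiltonian G H p0 A t z p\<bar> \<le> K" using network_hamiltonian_bounded[OF H A T \<alpha>(3)] by blast
  have growth': "?w t x \<le> C * (1 + network_dist G x0 x)" if "t \<in> {0..<T}" "x \<in> network_points G" for t x
    using growth[OF that] by simp
  have "upper_env G T ?w t a \<le> - u0 (proj G a) + \<epsilon> + K * t" if t: "t \<in> {0..<T}" and a: "a \<in> edge_points G" for t a
  proof (rule barrier[where v = "\<lambda>a. - u0 (proj G a)" and L = L,
        OF T _ _ x0 C _ _ _ proj_network_point[OF a] proj_mem[OF a] \<alpha>(1,2) K(1) _ t])
    show "usc_on ({0..<T} \<times> edge G e) (\<lambda>(t, x). upper_env G T ?w t (e, x))" if "e \<in> edges G" for e
      using upper_env_usc[OF u that] .
    show "upper_env G T ?w t b = upper_env G T ?w t c" if "z \<in> network_points G" "b \<in> z" "c \<in> z" for z b c t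
      using upper_env_point[OF that] .
    show "upper_env G T ?w t b \<le> C * (1 + walk_dist G x0 b)" if "t \<in> {0..<T}" "b \<in> edge_points G" for t b
      using upper_env_growth[OF u that x0 C growth'] .
    show "upper_env G T ?w 0 b \<le> - u0 (proj G b)" if b: "b \<in> edge_points G" for b
    proof -
      have "ereal (u0 (proj G b)) \<le> - ereal (upper_env G T ?w 0 b)"
        using init[OF proj_network_point[OF b]] upper_env_eq[OF u _ b, of 0] T by (simp add: lsc_env_uminus)
      then show ?thesis by simp
    qed
    show "- u0 (proj G b) \<le> - u0 (proj G a) + \<epsilon> + L * walk_dist G (proj G a) b" if "b \<in> edge_points G" for b
      using L(2)[OF proj_network_point[OF a] that] by linarith
    show "b' t \<le> K" if t: "t \<in> {0<..<T}" and Y: "Y \<in> network_points G"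
      and test: "upper_test G T (upper_env G T ?w) t Y b b' g g'" and s: "\<And>i. i \<in> Y \<Longrightarrow> \<bar>g' i (snd i)\<bar> \<le> \<alpha>" for t Y b b' g g'
    proof -
      have "\<bar>- g' i (snd i)\<bar> \<le> \<alpha>" if "i \<in> Y" for i using s[OF that] by simp
      then have "\<bar>network_hamiltonian G H p0 A t Y (\<lambda>i. - g' i (snd i))\<bar> \<le> K" using K(2)[OF _ Y] t by simp
      then show ?thesis using supersolution_test[OF int t Y test] by linarith
    qed
  qed
  then show thesis using that K(1) by blast
qed

end


section \<open>A penalised maximum and its interior analysis\<close>

lemma dist4:
  fixes t s x y :: real
  assumes "dist (t, s, x, y) (t', s', x', y') < r"
  shows "\<bar>t - t'\<bar> < r" "\<bar>s - s'\<bar> < r" "\<bar>x - x'\<bar> < r" "\<bar>y - y'\<bar> < r"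
proof -
  have 1: "dist (s, x, y) (s', x', y') < r" using dist_snd_le[of "(t, s, x, y)" "(t', s', x', y')"] assms by simp
  have 2: "dist (x, y) (x', y') < r" using dist_snd_le[of "(s, x, y)" "(s', x', y')"] 1 by simp
  show "\<bar>t - t'\<bar> < r" using dist_fst_le[of "(t, s, x, y)" "(t', s', x', y')"] assms by (simp add: dist_real_def)
  show "\<bar>s - s'\<bar> < r" using dist_fst_le[of "(s, x, y)" "(s', x', y')"] 1 by (simp add: dist_real_def)
  show "\<bar>x - x'\<bar> < r" using dist_fst_le[of "(x, y)" "(x', y')"] 2 by (simp add: dist_real_def)
  show "\<bar>y - y'\<bar> < r" using dist_snd_le[of "(x, y)" "(x', y')"] 2 by (simp add: dist_real_def)
qed

text \<open>The time part of all tests below: the doubling penalty with the other time frozen at \<open>c\<close>, the penalty that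
  confines the maximum to times before \<open>T\<close>, and a term that makes the maximum strict at \<open>d\<close>.\<close>

definition time_part :: "real \<Rightarrow> real \<Rightarrow> real \<Rightarrow> real \<Rightarrow> real \<Rightarrow> real \<Rightarrow> real" where
  "time_part T \<nu> \<eta> c d t = (t - c)\<^sup>2 / (2 * \<nu>) + \<eta> / (T - t) + (t - d)\<^sup>2"

definition time_part' :: "real \<Rightarrow> real \<Rightarrow> real \<Rightarrow> real \<Rightarrow> real \<Rightarrow> real \<Rightarrow> real" where
  "time_part' T \<nu> \<eta> c d t = (t - c) / \<nu> + \<eta> / (T - t)\<^sup>2 + 2 * (t - d)"

lemma time_part_deriv:
  assumes "t < T" shows "(time_part T \<nu> \<eta> c d has_real_derivative time_part' T \<nu> \<eta> c d t) (at t)"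
proof -
  have "((\<lambda>t. (t - c)\<^sup>2 / (2 * \<nu>)) has_real_derivative (2 * (t - c)) / (2 * \<nu>)) (at t)"
    by (rule DERIV_cdivide) (auto intro!: derivative_eq_intros)
  moreover have "((\<lambda>t. (t - d)\<^sup>2) has_real_derivative 2 * (t - d)) (at t)"
    by (auto intro!: derivative_eq_intros)
  ultimately have "((\<lambda>t. (t - c)\<^sup>2 / (2 * \<nu>) + \<eta> / (T - t) + (t - d)\<^sup>2) has_real_derivative
      (2 * (t - c)) / (2 * \<nu>) + \<eta> / (T - t)\<^sup>2 + 2 * (t - d)) (at t)"
    using time_penalty_deriv[OF assms] by (intro DERIV_add)
  moreover have "(2 * (t - c)) / (2 * \<nu>) = (t - c) / \<nu>" by (rule mult_divide_mult_cancel_left) simp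
  ultimately show ?thesis unfolding time_part_def[abs_def] time_part'_def by simp
qed

lemma time_part'_continuous: "continuous_on {0<..<T} (time_part' T \<nu> \<eta> c d)"
  unfolding time_part'_def[abs_def] divide_inverse[of "_ - c"] 
  by (intro continuous_on_add time_penalty_continuous continuous_intros)

text \<open>The space part of all tests below, a quadratic polynomial in the signed distance \<open>v (\<xi> - c)\<close> from \<open>c\<close>: a linear
  term, the doubling penalty with the other point frozen at \<open>m\<close>, and a term that makes the maximum strict.\<close>

definition quad :: "real \<Rightarrow> real \<Rightarrow> real \<Rightarrow> real \<Rightarrow> real \<Rightarrow> real \<Rightarrow> real" where
  "quad a k m v c \<xi> = a * (v * (\<xi> - c)) + k * (v * (\<xi> - c) - m)\<^sup>2 + (v * (\<xi> - c))\<^sup>2"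

definition quad' :: "real \<Rightarrow> real \<Rightarrow> real \<Rightarrow> real \<Rightarrow> real \<Rightarrow> real \<Rightarrow> real" where
  "quad' a k m v c \<xi> = v * (a + 2 * k * (v * (\<xi> - c) - m) + 2 * (v * (\<xi> - c)))"

lemma quad_C1: "C1_line (quad a k m v c) (quad' a k m v c)"
  unfolding C1_line_def
proof (intro conjI allI)
  fix \<xi>
  have "((\<lambda>\<xi>. v * (\<xi> - c)) has_real_derivative v) (at \<xi>)"
    by (auto intro!: derivative_eq_intros)
  moreover have "((\<lambda>r. a * r + k * (r - m)\<^sup>2 + r\<^sup>2) has_real_derivative a + 2 * k * (r - m) + 2 * r) (at r)" for r
    by (auto intro!: derivative_eq_intros)
  ultimately have "((\<lambda>\<xi>. a * (v * (\<xi> - c)) + k * (v * (\<xi> - c) - m)\<^sup>2 + (v * (\<xi> - c))\<^sup>2) has_real_derivative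
      (a + 2 * k * (v * (\<xi> - c) - m) + 2 * (v * (\<xi> - c))) * v) (at \<xi>)"
    by (intro DERIV_chain2[where f = "\<lambda>r. a * r + k * (r - m)\<^sup>2 + r\<^sup>2"])
  then show "(quad a k m v c has_real_derivative quad' a k m v c \<xi>) (at \<xi>)"
    unfolding quad_def[abs_def] quad'_def by (simp add: mult.commute)
  show "continuous_on UNIV (quad' a k m v c)"
    unfolding quad'_def[abs_def] by (intro continuous_intros)
qed

context network_graph
begin

lemma doubled_usc:
  assumes u: "locally_bounded G T u" and w: "locally_bounded G T w"
    and e: "e \<in> edges G" "e' \<in> edges G" and f: "continuous_on K f" "f ` K \<subseteq> {0..<T} \<times> edge G e"
    and g: "continuous_on K g" "g ` K \<subseteq> {0..<T} \<times> edge G e'" and r: "continuous_on K r"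
  shows "usc_on K (\<lambda>z. upper_env G T u (fst (f z)) (e, snd (f z)) + upper_env G T w (fst (g z)) (e', snd (g z)) - r z)"
proof -
  have 1: "usc_on K (\<lambda>z. upper_env G T u (fst (f z)) (e, snd (f z)))"
    using usc_on_compose[OF upper_env_usc[OF u e(1)] f] by (simp add: case_prod_unfold)
  have 2: "usc_on K (\<lambda>z. upper_env G T w (fst (g z)) (e', snd (g z)))"
    using usc_on_compose[OF upper_env_usc[OF w e(2)] g] by (simp add: case_prod_unfold)
  have "continuous_on K (\<lambda>z. - r z)" using r by (intro continuous_intros)
  from usc_on_add[OF usc_on_add[OF 1 2] usc_on_continuous[OF this]] show ?thesis by simp
qed

lemma soft_dist_continuous:
  assumes "Z \<in> network_points G" "0 < \<sigma>" "e \<in> edges G"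
  shows "continuous_on (edge G e) (\<lambda>x. soft \<sigma> (walk_dist G Z (e, x)))"
proof -
  have "continuous_on UNIV (soft \<sigma>)"
    using soft_C1[OF assms(2)] unfolding C1_line_def by (auto intro: DERIV_continuous_on)
  then show ?thesis by (rule continuous_on_compose2) (use walk_dist_continuous[OF assms(1,3)] in auto)
qed

end

text \<open>A maximum of \<open>U + V\<close> with doubled times, where \<open>U\<close> and \<open>V\<close> are the upper envelopes of \<open>u\<close> and \<open>-w\<close>. The space
  variable is not doubled yet: the doubling depends on whether the maximum sits inside an edge or at a
  vertex. The term \<open>\<alpha> soft\<close>, which makes the maximum exist, perturbs slopes by at most \<open>\<alpha>\<close>.\<close>

locale penalised_maximum = network_graph G for G :: "'e network" +
  fixes H :: "'e hamiltonian" and p0 :: "'e \<Rightarrow> real \<Rightarrow> real \<Rightarrow> real" and A :: "'e point \<Rightarrow> real \<Rightarrow> real"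
    and T :: real and u w :: "real \<Rightarrow> 'e point \<Rightarrow> real"
    and Z :: "'e point" and \<sigma> \<nu> \<eta> \<alpha> tb sb :: real and ab :: "'e \<times> real"
  assumes sub: "subsolution_interior G H p0 A T u"
    and sup: "supersolution_interior G H p0 A T w"
    and H0: "H0 G H" and H1: "H1 G H"
    and Z: "Z \<in> network_points G"
    and pos: "0 < \<sigma>" "0 < \<nu>" "0 < \<eta>" "0 < \<alpha>"
    and tb: "tb \<in> {0<..<T}" and sb: "sb \<in> {0<..<T}" and ab: "ab \<in> edge_points G"
    and maximum: "\<And>t s a. t \<in> {0..<T} \<Longrightarrow> s \<in> {0..<T} \<Longrightarrow> a \<in> edge_points G \<Longrightarrow>
      upper_env G T u t a + upper_env G T (\<lambda>t z. - w t z) s a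
        - ((t - s)\<^sup>2 / (2 * \<nu>) + \<eta> / (T - t) + \<eta> / (T - s)) - \<alpha> * soft \<sigma> (walk_dist G Z a)
      \<le> upper_env G T u tb ab + upper_env G T (\<lambda>t z. - w t z) sb ab
        - ((tb - sb)\<^sup>2 / (2 * \<nu>) + \<eta> / (T - tb) + \<eta> / (T - sb)) - \<alpha> * soft \<sigma> (walk_dist G Z ab)"
begin

abbreviation "U \<equiv> upper_env G T u"
abbreviation "V \<equiv> upper_env G T (\<lambda>t z. - w t z)"
abbreviation "\<Lambda> a \<equiv> soft \<sigma> (walk_dist G Z a)"
abbreviation "tpart \<equiv> time_part T \<nu> \<eta>"
abbreviation "tpart' \<equiv> time_part' T \<nu> \<eta>"

lemma T_pos: "0 < T" using tb by simp

definition top_value :: real where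
  "top_value = U tb ab + V sb ab - ((tb - sb)\<^sup>2 / (2 * \<nu>) + \<eta> / (T - tb) + \<eta> / (T - sb)) - \<alpha> * \<Lambda> ab"

lemma U_bounded: "locally_bounded G T u"
  using sub by (simp add: subsolution_interior_def)

lemma V_bounded: "locally_bounded G T (\<lambda>t z. - w t z)"
  using sup locally_bounded_uminus by (auto simp: supersolution_interior_def)

lemma maximum': "t \<in> {0..<T} \<Longrightarrow> s \<in> {0..<T} \<Longrightarrow> a \<in> edge_points G \<Longrightarrow>
  U t a + V s a - ((t - s)\<^sup>2 / (2 * \<nu>) + \<eta> / (T - t) + \<eta> / (T - s)) - \<alpha> * \<Lambda> a \<le> top_value"
  unfolding top_value_def by (rule maximum)

lemmas \<Lambda>_continuous = soft_dist_continuous[OF Z pos(1)]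

text \<open>The perturbation of the slopes by \<open>\<alpha> q\<close> with \<open>\<bar>q\<bar> \<le> 1\<close> comes from the localising term \<open>\<alpha> \<Lambda>\<close>.\<close>

lemma test_U:
  assumes t0: "t0 \<in> {0<..<T}" and Y: "Y \<in> network_points G"
    and \<phi>: "\<And>i. i \<in> Y \<Longrightarrow> C1_line (\<phi> i) (\<phi>' i)" and \<rho>: "0 < \<rho>"
    and le: "\<And>t i y. t \<in> {0<..<T} \<Longrightarrow> \<bar>t - t0\<bar> < \<rho> \<Longrightarrow> i \<in> Y \<Longrightarrow> y \<in> edge G (fst i) \<Longrightarrow> \<bar>y - snd i\<bar> < \<rho> \<Longrightarrow>
      U t (fst i, y) - tpart c d t - \<alpha> * \<Lambda> (fst i, y) - \<phi> i y \<le> U t0 i - tpart c d t0 - \<alpha> * \<Lambda> i - \<phi> i (snd i)"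
  obtains q where "\<And>i. i \<in> Y \<Longrightarrow> \<bar>q i\<bar> \<le> 1"
    "tpart' c d t0 + network_hamiltonian G H p0 A t0 Y (\<lambda>i. \<alpha> * q i + \<phi>' i (snd i)) \<le> 0"
proof -
  obtain h h' where h: "\<forall>i\<in>Y. C1_line (h i) (h' i) \<and> h i (snd i) = 0 \<and> \<bar>h' i (snd i)\<bar> \<le> (1::real) \<and>
      (\<forall>y\<in>edge G (fst i). \<Lambda> (fst i, y) \<le> \<Lambda> i + h i y)"
    using soft_dist_tests[OF Z Y pos(1)] by blast
  let ?g = "\<lambda>i y. \<alpha> * h i y + (\<phi> i y - \<phi> i (snd i))"
  let ?g' = "\<lambda>i y. \<alpha> * h' i y + \<phi>' i y"
  have "upper_test G T U t0 Y (tpart c d) (tpart' c d) ?g ?g'"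
    unfolding upper_test_def
  proof (intro conjI ballI exI[of _ \<rho>] impI)
    show "(tpart c d has_real_derivative tpart' c d s) (at s)" if "s \<in> {0<..<T}" for s
      using time_part_deriv that by simp
    show "continuous_on {0<..<T} (tpart' c d)" by (rule time_part'_continuous)
    show "C1_line (?g i) (?g' i)" if "i \<in> Y" for i
    proof -
      have "C1_line (\<lambda>y. \<phi> i y - \<phi> i (snd i)) (\<phi>' i)"
        using \<phi>[OF that] unfolding C1_line_def by (auto intro!: derivative_eq_intros)
      then show ?thesis using h that by (intro C1_line_add C1_line_cmult) auto
    qed
    show "?g i (snd i) = 0" if "i \<in> Y" for i using h that by simp
    fix s i y assume *: "s \<in> {0<..<T}" "i \<in> Y" "y \<in> edge G (fst i)" "\<bar>s - t0\<bar> < \<rho>" "\<bar>y - snd i\<bar> < \<rho>"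
    have "\<alpha> * \<Lambda> (fst i, y) \<le> \<alpha> * (\<Lambda> i + h i y)" using h * pos(4) by (intro mult_left_mono) auto
    then show "U s (fst i, y) \<le> U t0 i + (tpart c d s - tpart c d t0) + ?g i y"
      using le[OF *(1,4,2,3,5)] by (simp add: algebra_simps)
  qed (use \<rho> in simp)
  from subsolution_test[OF sub t0 Y this]
  show thesis using that[of "\<lambda>i. h' i (snd i)"] h by auto
qed

lemma test_V:
  assumes t0: "t0 \<in> {0<..<T}" and Y: "Y \<in> network_points G"
    and \<phi>: "\<And>i. i \<in> Y \<Longrightarrow> C1_line (\<phi> i) (\<phi>' i)" and \<rho>: "0 < \<rho>"
    and le: "\<And>t i y. t \<in> {0<..<T} \<Longrightarrow> \<bar>t - t0\<bar> < \<rho> \<Longrightarrow> i \<in> Y \<Longrightarrow> y \<in> edge G (fst i) \<Longrightarrow> \<bar>y - snd i\<bar> < \<rho> \<Longrightarrow>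
      V t (fst i, y) - tpart c d t - \<phi> i y \<le> V t0 i - tpart c d t0 - \<phi> i (snd i)"
  shows "tpart' c d t0 \<le> network_hamiltonian G H p0 A t0 Y (\<lambda>i. - \<phi>' i (snd i))"
proof -
  let ?g = "\<lambda>i y. \<phi> i y - \<phi> i (snd i)"
  have "upper_test G T V t0 Y (tpart c d) (tpart' c d) ?g \<phi>'"
    unfolding upper_test_def
  proof (intro conjI ballI exI[of _ \<rho>] impI)
    show "(tpart c d has_real_derivative tpart' c d s) (at s)" if "s \<in> {0<..<T}" for s
      using time_part_deriv that by simp
    show "continuous_on {0<..<T} (tpart' c d)" by (rule time_part'_continuous)
    show "C1_line (?g i) (\<phi>' i)" if "i \<in> Y" for i
      using \<phi>[OF that] unfolding C1_line_def by (auto intro!: derivative_eq_intros)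
    fix s i y assume *: "s \<in> {0<..<T}" "i \<in> Y" "y \<in> edge G (fst i)" "\<bar>s - t0\<bar> < \<rho>" "\<bar>y - snd i\<bar> < \<rho>"
    show "V s (fst i, y) \<le> V t0 i + (tpart c d s - tpart c d t0) + ?g i y"
      using le[OF *(1,4,2,3,5)] by (simp add: algebra_simps)
  qed (use \<rho> in auto)
  from supersolution_test[OF sup t0 Y this] show ?thesis .
qed

lemma coercive:
  obtains R where "\<And>e x t q. e \<in> edges G \<Longrightarrow> x \<in> edge G e \<Longrightarrow> t \<in> {0..T} \<Longrightarrow> R \<le> \<bar>q\<bar> \<Longrightarrow> B \<le> H e t x q"
  using H1 T_pos unfolding H1_def by meson

lemma H_limit:
  assumes e: "e \<in> edges G" and conv: "t \<longlonglongrightarrow> t0" "x \<longlonglongrightarrow> x0" "q \<longlonglongrightarrow> q0"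
    and mem: "\<And>k. 0 \<le> t k" "\<And>k. x k \<in> edge G e"
  shows "(\<lambda>k. H e (t k) (x k) (q k)) \<longlonglongrightarrow> H e t0 x0 q0"
proof -
  have c: "continuous_on ({0..} \<times> edge G e \<times> UNIV) (\<lambda>(t, x, q). H e t x q)"
    using H0 e by (auto simp: H0_def)
  have "0 \<le> t0" using conv(1) mem(1) by (intro tendsto_lowerbound[OF conv(1)]) auto
  moreover have "x0 \<in> edge G e"
    using closed_sequentially[OF edge_closed[OF e]] mem(2) conv(2) by blast
  moreover have "(\<lambda>k. (t k, x k, q k)) \<longlonglongrightarrow> (t0, x0, q0)" using conv by (intro tendsto_intros)
  ultimately have "(\<lambda>k. (\<lambda>(t, x, q). H e t x q) (t k, x k, q k)) \<longlonglongrightarrow> (\<lambda>(t, x, q). H e t x q) (t0, x0, q0)"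
    using mem by (intro continuous_on_tendsto_compose[OF c]) auto
  then show ?thesis by simp
qed

text \<open>Doubling of the space variable inside an edge. The doubled maxima converge to the given maximum as the
  penalty \<open>k (x - y)\<^sup>2\<close> grows. The times stay doubled with a fixed parameter, so the time derivatives of the
  tests remain bounded; coercivity then bounds the slopes \<open>2 k (x - y)\<close>, and a limit slope satisfies both
  inequalities at the same point \<open>xb\<close>. In this way mere continuity of \<open>H\<close> in space is enough.\<close>

lemma interior_maximum:
  assumes ab_eq: "ab = (e, xb)" and xb: "xb \<in> edge_interior G e"
  obtains p q where "\<bar>q\<bar> \<le> 1"
    "(tb - sb) / \<nu> + \<eta> / (T - tb)\<^sup>2 + H e tb xb (p + \<alpha> * q) \<le> 0"
    "(sb - tb) / \<nu> + \<eta> / (T - sb)\<^sup>2 \<le> H e sb xb p"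
proof -
  have e: "e \<in> edges G" using ab ab_eq by (simp add: edge_points_def)
  have "open (edge_interior G e)" using e by (cases rule: edge_cases) auto
  then obtain \<rho>1 where \<rho>1: "0 < \<rho>1" "cball xb \<rho>1 \<subseteq> edge_interior G e"
    using xb open_contains_cball by blast
  define \<rho> where "\<rho> = min \<rho>1 (min (min (tb / 2) ((T - tb) / 2)) (min (sb / 2) ((T - sb) / 2)))"
  have \<rho>: "0 < \<rho>" "\<rho> \<le> \<rho>1" "\<rho> < tb" "tb + \<rho> < T" "\<rho> < sb" "sb + \<rho> < T"
  proof -
    have "\<rho> \<le> tb / 2" "\<rho> \<le> (T - tb) / 2" "\<rho> \<le> sb / 2" "\<rho> \<le> (T - sb) / 2"
      unfolding \<rho>_def by (simp_all only: min_le_iff_disj order_refl simp_thms)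
    note half = this
    have bars: "0 < tb" "tb < T" "0 < sb" "sb < T" using tb sb by auto
    show "\<rho> < tb" using half bars by linarith
    show "\<rho> < sb" using half bars by linarith
    have "\<rho> * 2 \<le> T - tb" "\<rho> * 2 \<le> T - sb" using half(2,4) by (simp_all only: le_divide_eq_numeral1)
    then show "tb + \<rho> < T" "sb + \<rho> < T" using bars by auto
    show "\<rho> \<le> \<rho>1" "0 < \<rho>" using \<rho>1(1) tb sb by (simp_all add: \<rho>_def)
  qed
  define J where "J = {xb - \<rho>..xb + \<rho>}"
  define K where "K = {tb - \<rho>..tb + \<rho>} \<times> {sb - \<rho>..sb + \<rho>} \<times> J \<times> J"
  have J: "x \<in> edge_interior G e" "x \<in> edge G e" if "x \<in> J" for x
  proof -
    have "x \<in> cball xb \<rho>1" using that \<rho>(2) by (auto simp: J_def dist_real_def)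
    then show "x \<in> edge_interior G e" using \<rho>1(2) by blast
    then show "x \<in> edge G e" by (rule interior_in_edge)
  qed
  have "compact K" unfolding K_def J_def by (intro compact_Times compact_Icc)
  \<comment> \<open>The summand \<open>0 * y\<close> only fixes the type of the fourth component.\<close>
  define rest where "rest = (\<lambda>(t, s, x, y). ((t - s)\<^sup>2 / (2 * \<nu>) + \<eta> / (T - t) + \<eta> / (T - s)) + \<alpha> * \<Lambda> (e, x)
      + (t - tb)\<^sup>2 + (s - sb)\<^sup>2 + (x - xb)\<^sup>2 + 0 * (y::real))"
  define F where "F z = U (fst (fst z, fst (snd (snd z)))) (e, snd (fst z, fst (snd (snd z))))
      + V (fst (fst (snd z), snd (snd (snd z)))) (e, snd (fst (snd z), snd (snd (snd z)))) - rest z" for z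
  have F: "F (t, s, x, y) = U t (e, x) + V s (e, y) - (((t - s)\<^sup>2 / (2 * \<nu>) + \<eta> / (T - t) + \<eta> / (T - s)) + \<alpha> * \<Lambda> (e, x)
      + (t - tb)\<^sup>2 + (s - sb)\<^sup>2 + (x - xb)\<^sup>2)" for t s x y
    by (simp add: F_def rest_def)
  define P where "P = (\<lambda>(t::real, s::real, x, y). (x - y)\<^sup>2 :: real)"
  let ?z0 = "(tb, sb, xb, xb)"
  have usc: "usc_on K F"
    unfolding F_def
  proof (rule doubled_usc[OF U_bounded V_bounded e e])
    have "continuous_on K (\<lambda>z. \<Lambda> (e, fst (snd (snd z))))"
      by (rule continuous_on_compose2[OF \<Lambda>_continuous[OF e]])
        (auto intro!: continuous_intros J simp: K_def)
    moreover have "\<forall>z\<in>K. T - fst z \<noteq> 0" "\<forall>z\<in>K. T - fst (snd z) \<noteq> 0" using \<rho> by (auto simp: K_def)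
    ultimately show "continuous_on K rest" unfolding rest_def case_prod_unfold
      using pos(2) by (intro continuous_intros) auto
  qed (use \<rho> J in \<open>auto simp: K_def intro!: continuous_intros\<close>)
  have Pc: "continuous_on K P" unfolding P_def case_prod_unfold by (intro continuous_intros)
  have z0: "?z0 \<in> K" using \<rho>(1) by (auto simp: K_def J_def)
  have top: "F ?z0 = top_value" unfolding top_value_def F by (simp add: ab_eq)
  have strict: "F z < top_value" if z: "z \<in> K" "P z = 0" "z \<noteq> ?z0" for z
  proof -
    obtain t s x y where zeq: "z = (t, s, x, y)" by (metis prod.collapse)
    then have y: "y = x" using z(2) by (simp add: P_def)
    have "t \<in> {0..<T}" "s \<in> {0..<T}" "(e, x) \<in> edge_points G"
      using z(1) \<rho> J[of x] e by (auto simp: zeq K_def edge_points_def)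
    from maximum'[OF this] have "F z \<le> top_value - ((t - tb)\<^sup>2 + (s - sb)\<^sup>2 + (x - xb)\<^sup>2)"
      by (simp add: zeq F y)
    moreover have "0 < (t - tb)\<^sup>2 + (s - sb)\<^sup>2 + (x - xb)\<^sup>2"
      using z(3) by (auto simp: zeq y add_pos_nonneg add_nonneg_pos)
    ultimately show ?thesis by linarith
  qed
  have ex: "\<exists>z. z \<in> K \<and> (\<forall>z'\<in>K. F z' - real k * P z' \<le> F z - real k * P z)" for k
  proof -
    have "continuous_on K (\<lambda>z. - (real k * P z))" using Pc by (intro continuous_intros)
    from usc_on_add[OF usc usc_on_continuous[OF this]]
    have "usc_on K (\<lambda>z. F z - real k * P z)" by simp
    moreover have "K \<noteq> {}" using z0 by auto
    ultimately show ?thesis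
      using usc_attains_max[OF \<open>compact K\<close>, of "\<lambda>z. F z - real k * P z"] by simp
  qed
  have "\<forall>k. \<exists>z. z \<in> K \<and> (\<forall>z'\<in>K. F z' - real k * P z' \<le> F z - real k * P z)" by (rule allI, rule ex)
  from choice[OF this] obtain zz where zz: "\<And>k. zz k \<in> K" "\<And>k z. z \<in> K \<Longrightarrow> F z - real k * P z \<le> F (zz k) - real k * P (zz k)"
    by blast
  have zz_top: "top_value \<le> F (zz k) - real k * P (zz k)" for k
    using zz(2)[OF z0, of k] top by (simp add: P_def)
  have Pn: "0 \<le> P z" for z by (auto simp: P_def split: prod.split)
  have near: "\<exists>N. \<forall>k\<ge>N. dist (zz k) ?z0 < r" if r: "0 < r" for r
  proof -
    have "\<exists>N. \<forall>k\<ge>N. \<forall>z\<in>K. top_value \<le> F z - real k * P z \<longrightarrow> dist z ?z0 < r"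
      by (rule penalisation[OF \<open>compact K\<close> usc Pc Pn strict r])
    then show ?thesis using zz(1) zz_top by blast
  qed
  then have conv: "zz \<longlonglongrightarrow> ?z0" by (simp add: LIMSEQ_def)
  obtain N where N: "\<And>k. N \<le> k \<Longrightarrow> dist (zz k) ?z0 < \<rho>" using near[OF \<rho>(1)] by blast
  define t where "t k = fst (zz (N + k))" for k
  define s where "s k = fst (snd (zz (N + k)))" for k
  define x where "x k = fst (snd (snd (zz (N + k))))" for k
  define y where "y k = snd (snd (snd (zz (N + k))))" for k
  have zeq: "zz (N + k) = (t k, s k, x k, y k)" for k by (simp add: t_def s_def x_def y_def)
  have conv': "(\<lambda>k. zz (N + k)) \<longlonglongrightarrow> ?z0" using LIMSEQ_ignore_initial_segment[OF conv, of N] by (simp add: add.commute)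
  have lims: "t \<longlonglongrightarrow> tb" "s \<longlonglongrightarrow> sb" "x \<longlonglongrightarrow> xb" "y \<longlonglongrightarrow> xb"
    using tendsto_fst[OF conv'] tendsto_fst[OF tendsto_snd[OF conv']] tendsto_fst[OF tendsto_snd[OF tendsto_snd[OF conv']]]
      tendsto_snd[OF tendsto_snd[OF tendsto_snd[OF conv']]]
    by (simp_all add: t_def[abs_def] s_def[abs_def] x_def[abs_def] y_def[abs_def])
  have close: "\<bar>t k - tb\<bar> < \<rho>" "\<bar>s k - sb\<bar> < \<rho>" "\<bar>x k - xb\<bar> < \<rho>" "\<bar>y k - xb\<bar> < \<rho>" for k
    using dist4[OF N[of "N + k", unfolded zeq]] by auto
  have mem: "t k \<in> {0<..<T}" "s k \<in> {0<..<T}" "x k \<in> J" "y k \<in> J" for k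
    using close[of k] \<rho> by (auto simp: J_def abs_less_iff)
  have inK: "(t', s', x', y') \<in> K" if "\<bar>t' - tb\<bar> < \<rho>" "\<bar>s' - sb\<bar> < \<rho>" "\<bar>x' - xb\<bar> < \<rho>" "\<bar>y' - xb\<bar> < \<rho>" for t' s' x' y'
    using that by (auto simp: K_def J_def abs_less_iff)
  define p where "p k = 2 * real (N + k) * (x k - y k)" for k
  have U_ineq: "\<exists>q. \<bar>q\<bar> \<le> 1 \<and> tpart' (s k) tb (t k) + H e (t k) (x k) (\<alpha> * q + (p k + 2 * (x k - xb))) \<le> 0" for k
  proof -
    let ?Y = "{(e, x k)}"
    let ?r = "min (\<rho> - \<bar>t k - tb\<bar>) (\<rho> - \<bar>x k - xb\<bar>)"
    have Y: "?Y \<in> network_points G" using interior_network_point[OF e J(1)[OF mem(3)]] .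
    have r: "0 < ?r" using close[of k] by simp
    obtain q where q: "\<And>i. i \<in> ?Y \<Longrightarrow> \<bar>q i\<bar> \<le> 1"
      "tpart' (s k) tb (t k) + network_hamiltonian G H p0 A (t k) ?Y
        (\<lambda>i. \<alpha> * q i + quad' 0 (real (N + k)) (y k - xb) 1 xb (snd i)) \<le> 0"
    proof (rule test_U[where c = "s k" and d = tb and \<phi> = "\<lambda>i. quad 0 (real (N + k)) (y k - xb) 1 xb"
          and \<phi>' = "\<lambda>i. quad' 0 (real (N + k)) (y k - xb) 1 xb", OF mem(1) Y quad_C1 r])
      fix t' i x' assume *: "t' \<in> {0<..<T}" "\<bar>t' - t k\<bar> < ?r" "i \<in> ?Y" "x' \<in> edge G (fst i)" "\<bar>x' - snd i\<bar> < ?r"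
      then have i: "i = (e, x k)" by simp
      have "\<bar>t' - tb\<bar> < \<rho>" "\<bar>x' - xb\<bar> < \<rho>" using * by (auto simp: i)
      then have "F (t', s k, x', y k) - real (N + k) * P (t', s k, x', y k)
          \<le> F (t k, s k, x k, y k) - real (N + k) * P (t k, s k, x k, y k)"
        using zz(2)[OF inK, of t' "s k" x' "y k" "N + k"] close[of k] by (simp only: zeq)
      then show "U t' (fst i, x') - tpart (s k) tb t' - \<alpha> * \<Lambda> (fst i, x') - quad 0 (real (N + k)) (y k - xb) 1 xb x'
        \<le> U (t k) i - tpart (s k) tb (t k) - \<alpha> * \<Lambda> i - quad 0 (real (N + k)) (y k - xb) 1 xb (snd i)"
        unfolding F P_def time_part_def quad_def i by simp
    qed (rule that)
    then show ?thesis
      using network_hamiltonian_interior[OF e J(1)[OF mem(3)]]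
      by (intro exI[of _ "q (e, x k)"]) (auto simp: quad'_def p_def algebra_simps)
  qed
  have V_ineq: "tpart' (t k) sb (s k) \<le> H e (s k) (y k) (p k)" for k
  proof -
    let ?Y = "{(e, y k)}"
    let ?r = "min (\<rho> - \<bar>s k - sb\<bar>) (\<rho> - \<bar>y k - xb\<bar>)"
    have Y: "?Y \<in> network_points G" using interior_network_point[OF e J(1)[OF mem(4)]] .
    have r: "0 < ?r" using close[of k] by simp
    have "tpart' (t k) sb (s k) \<le> network_hamiltonian G H p0 A (s k) ?Y
        (\<lambda>i. - quad' 0 (real (N + k) - 1) 0 1 (x k) (snd i))"
    proof (rule test_V[where c = "t k" and d = sb and \<phi> = "\<lambda>i. quad 0 (real (N + k) - 1) 0 1 (x k)"
          and \<phi>' = "\<lambda>i. quad' 0 (real (N + k) - 1) 0 1 (x k)", OF mem(2) Y quad_C1 r])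
      fix s' i y' assume *: "s' \<in> {0<..<T}" "\<bar>s' - s k\<bar> < ?r" "i \<in> ?Y" "y' \<in> edge G (fst i)" "\<bar>y' - snd i\<bar> < ?r"
      then have i: "i = (e, y k)" by simp
      have "\<bar>s' - sb\<bar> < \<rho>" "\<bar>y' - xb\<bar> < \<rho>" using * by (auto simp: i)
      then have "F (t k, s', x k, y') - real (N + k) * P (t k, s', x k, y')
          \<le> F (t k, s k, x k, y k) - real (N + k) * P (t k, s k, x k, y k)"
        using zz(2)[OF inK, of "t k" s' "x k" y' "N + k"] close[of k] by (simp only: zeq)
      then show "V s' (fst i, y') - tpart (t k) sb s' - quad 0 (real (N + k) - 1) 0 1 (x k) y'
        \<le> V (s k) i - tpart (t k) sb (s k) - quad 0 (real (N + k) - 1) 0 1 (x k) (snd i)"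
        unfolding F P_def time_part_def quad_def i
        by (simp add: power2_commute[of s' "t k"] power2_commute[of "s k" "t k"]
            power2_commute[of y' "x k"] power2_commute[of "y k" "x k"] algebra_simps)
    qed
    then show ?thesis
      using network_hamiltonian_interior[OF e J(1)[OF mem(4)]]
      by (auto simp: quad'_def p_def algebra_simps)
  qed
  obtain q where q: "\<And>k. \<bar>q k\<bar> \<le> 1"
    "\<And>k. tpart' (s k) tb (t k) + H e (t k) (x k) (\<alpha> * q k + (p k + 2 * (x k - xb))) \<le> 0"
    using U_ineq by metis
  obtain R where R: "\<And>e x t q. e \<in> edges G \<Longrightarrow> x \<in> edge G e \<Longrightarrow> t \<in> {0..T} \<Longrightarrow> R \<le> \<bar>q\<bar> \<Longrightarrow> T / \<nu> + 2 * T + 1 \<le> H e t x q"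
    using coercive by blast
  have p_bound: "\<bar>p k\<bar> \<le> R + \<alpha> + 2 * \<rho>" for k
  proof -
    have "- (T / \<nu>) \<le> (t k - s k) / \<nu>"
      using mem(1,2)[of k] pos(2) by (simp add: field_simps)
    moreover have "- (2 * T) \<le> 2 * (t k - tb)" using mem(1)[of k] tb by simp
    moreover have "0 \<le> \<eta> / (T - t k)\<^sup>2" using pos(3) by simp
    ultimately have "H e (t k) (x k) (\<alpha> * q k + (p k + 2 * (x k - xb))) < T / \<nu> + 2 * T + 1"
      using q(2)[of k] unfolding time_part'_def by linarith
    then have "\<bar>\<alpha> * q k + (p k + 2 * (x k - xb))\<bar> < R"
      using R[OF e J(2)[OF mem(3)[of k]], of "t k" "\<alpha> * q k + (p k + 2 * (x k - xb))"] mem(1)[of k]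
      by (auto simp: not_le[symmetric])
    moreover have "\<bar>\<alpha> * q k\<bar> \<le> \<alpha>" using q(1)[of k] pos(4) mult_left_mono[of "\<bar>q k\<bar>" 1 \<alpha>] by (simp add: abs_mult)
    moreover have "p k = (\<alpha> * q k + (p k + 2 * (x k - xb))) - \<alpha> * q k - 2 * (x k - xb)" by simp
    moreover have "\<bar>2 * (x k - xb)\<bar> \<le> 2 * \<rho>" using close(3)[of k] by (simp add: abs_mult)
    ultimately show ?thesis by (smt (verit))
  qed
  have "bounded (range (\<lambda>k. (p k, q k)))"
  proof (rule boundedI)
    fix z assume "z \<in> range (\<lambda>k. (p k, q k))"
    then obtain k where "z = (p k, q k)" by blast
    then have "norm z \<le> norm (p k) + norm (q k)" using norm_Pair_le[of "p k" "q k"] by (simp only:)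
    then show "norm z \<le> R + \<alpha> + 2 * \<rho> + 1" using p_bound[of k] q(1)[of k] by simp
  qed
  then obtain l m where lm: "strict_mono m" "((\<lambda>k. (p k, q k)) \<circ> m) \<longlonglongrightarrow> l"
    using bounded_imp_convergent_subsequence by blast
  have pm: "(\<lambda>k. p (m k)) \<longlonglongrightarrow> fst l" and qm: "(\<lambda>k. q (m k)) \<longlonglongrightarrow> snd l"
    using tendsto_fst[OF lm(2)] tendsto_snd[OF lm(2)] by (simp_all add: comp_def)
  have tm: "(\<lambda>k. t (m k)) \<longlonglongrightarrow> tb" and sm: "(\<lambda>k. s (m k)) \<longlonglongrightarrow> sb"
    and xm: "(\<lambda>k. x (m k)) \<longlonglongrightarrow> xb" and ym: "(\<lambda>k. y (m k)) \<longlonglongrightarrow> xb"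
    using LIMSEQ_subseq_LIMSEQ[OF _ lm(1)] lims by (auto simp: comp_def)
  have "T - tb \<noteq> 0" "T - sb \<noteq> 0" using tb sb by auto
  have tU: "(\<lambda>k. tpart' (s (m k)) tb (t (m k))) \<longlonglongrightarrow> (tb - sb) / \<nu> + \<eta> / (T - tb)\<^sup>2 + 2 * (tb - tb)"
    unfolding time_part'_def using tb pos(2) by (intro tendsto_intros tm sm) auto
  have tV: "(\<lambda>k. tpart' (t (m k)) sb (s (m k))) \<longlonglongrightarrow> (sb - tb) / \<nu> + \<eta> / (T - sb)\<^sup>2 + 2 * (sb - sb)"
    unfolding time_part'_def using sb pos(2) by (intro tendsto_intros tm sm) auto
  have "(\<lambda>k. \<alpha> * q (m k) + (p (m k) + 2 * (x (m k) - xb))) \<longlonglongrightarrow> \<alpha> * snd l + (fst l + 2 * (xb - xb))"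
    by (intro tendsto_intros qm pm xm)
  from H_limit[OF e tm xm this] have HU: "(\<lambda>k. H e (t (m k)) (x (m k)) (\<alpha> * q (m k) + (p (m k) + 2 * (x (m k) - xb))))
      \<longlonglongrightarrow> H e tb xb (\<alpha> * snd l + (fst l + 2 * (xb - xb)))"
    using mem J(2) by (auto simp: less_imp_le)
  have HV: "(\<lambda>k. H e (s (m k)) (y (m k)) (p (m k))) \<longlonglongrightarrow> H e sb xb (fst l)"
    using H_limit[OF e sm ym pm] mem J(2) by (auto simp: less_imp_le)
  show thesis
  proof (rule that[of "snd l" "fst l"])
    have "(\<lambda>k. \<bar>q (m k)\<bar>) \<longlonglongrightarrow> \<bar>snd l\<bar>" using qm by (rule tendsto_rabs)
    then show "\<bar>snd l\<bar> \<le> 1" by (rule tendsto_upperbound) (use q(1) in auto)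
    have "(tb - sb) / \<nu> + \<eta> / (T - tb)\<^sup>2 + 2 * (tb - tb) + H e tb xb (\<alpha> * snd l + (fst l + 2 * (xb - xb))) \<le> 0"
      by (rule tendsto_upperbound[OF tendsto_add[OF tU HU]]) (use q(2) in auto)
    then show "(tb - sb) / \<nu> + \<eta> / (T - tb)\<^sup>2 + H e tb xb (fst l + \<alpha> * snd l) \<le> 0" by (simp add: add.commute)
    have "(sb - tb) / \<nu> + \<eta> / (T - sb)\<^sup>2 + 2 * (sb - sb) \<le> H e sb xb (fst l)"
      by (rule tendsto_le[OF _ HV tV]) (use V_ineq in auto)
    then show "(sb - tb) / \<nu> + \<eta> / (T - sb)\<^sup>2 \<le> H e sb xb (fst l)" by simp
  qed
qed

end


section \<open>A maximum at a vertex\<close>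

lemma finite_argmax:
  fixes f :: "'a \<Rightarrow> real"
  assumes "finite S" "S \<noteq> {}"
  obtains x where "x \<in> S" "\<And>y. y \<in> S \<Longrightarrow> f y \<le> f x"
proof -
  have "Max (f ` S) \<in> f ` S" using assms by (intro Max_in) auto
  then obtain x where "x \<in> S" "Max (f ` S) = f x" by (rule imageE)
  moreover from this have "f y \<le> f x" if "y \<in> S" for y using assms(1) that by (metis Max_ge finite_imageI imageI)
  ultimately show thesis using that by blast
qed

lemma inward_square: "inward c * inward c = 1"
  by (simp add: inward_def)

lemma inward_cancel: "inward c * (inward c * r) = r"
  by (simp add: inward_def)

lemma abs_inward: "\<bar>inward c * r\<bar> = \<bar>r\<bar>"
  by (simp add: inward_def)

text \<open>In inward slopes, clipping means replacing a slope by a smaller one, at either end of an edge.\<close>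

lemma clip_inward: "\<exists>q'\<le>q. clip c p (inward c * q) = inward c * q'"
proof (cases "c = 0")
  case True
  then show ?thesis by (intro exI[of _ "min q p"]) (simp add: clip_def inward_def)
next
  case False
  then show ?thesis by (intro exI[of _ "min q (- p)"]) (auto simp: clip_def inward_def min_def max_def)
qed

definition from_end :: "'e \<times> real \<Rightarrow> real \<Rightarrow> 'e \<times> real" where
  "from_end i r = (fst i, snd i + inward (snd i) * r)"

lemma from_end_0: "from_end i 0 = i"
  by (simp add: from_end_def)

context network_graph
begin

lemma from_end_edge:
  assumes i: "i \<in> endpoints G" and r: "0 \<le> r" "r \<le> min_len"
  shows "snd i + inward (snd i) * r \<in> edge G (fst i)"
proof -
  obtain e c where ec: "i = (e, c)" by force
  note e = endpoint_cases[OF i[unfolded ec]]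
  from e(1) show ?thesis
  proof (cases rule: edge_cases)
    case (bounded l)
    then have "c = 0 \<or> c = l" "min_len \<le> l" using e(3) min_len(2)[OF e(1)] by auto
    then show ?thesis using bounded r by (auto simp: ec inward_def)
  next
    case unbounded
    then have "c = 0" using e(3) by auto
    then show ?thesis using unbounded r by (auto simp: ec inward_def)
  qed
qed

lemma from_end_interior:
  assumes i: "i \<in> endpoints G" and r: "0 < r" "r < min_len"
  shows "snd i + inward (snd i) * r \<in> edge_interior G (fst i)"
proof -
  obtain e c where ec: "i = (e, c)" by force
  note e = endpoint_cases[OF i[unfolded ec]]
  from e(1) show ?thesis
  proof (cases rule: edge_cases)
    case (bounded l)
    then have "c = 0 \<or> c = l" "min_len \<le> l" using e(3) min_len(2)[OF e(1)] by auto
    then show ?thesis using bounded r by (auto simp: ec inward_def)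
  next
    case unbounded
    then have "c = 0" using e(3) by auto
    then show ?thesis using unbounded r by (auto simp: ec inward_def)
  qed
qed

lemma from_end_eq: "(fst i, \<xi>) = from_end i (inward (snd i) * (\<xi> - snd i))"
  by (simp add: from_end_def inward_cancel)

end

context penalised_maximum
begin

text \<open>Below \<open>-R\<close> the bound is coercivity, and between \<open>-R\<close> and \<open>\<pi>\<close> it is continuity on a compact set.\<close>

lemma level_near_end:
  assumes i: "(e, c) \<in> endpoints G" and lev: "\<And>q. q \<le> \<pi> \<Longrightarrow> \<kappa> \<le> H e tb c (inward c * q)" and \<mu>: "\<mu> < \<kappa>"
  shows "\<exists>r>0. \<forall>t x q. t \<in> {0<..<T} \<longrightarrow> \<bar>t - tb\<bar> < r \<longrightarrow> 0 \<le> x \<longrightarrow> x < r \<longrightarrow> q \<le> \<pi> \<longrightarrow>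
    \<mu> < H e t (c + inward c * x) (inward c * q)"
proof -
  have e: "e \<in> edges G" using endpoint_cases[OF i] by blast
  show ?thesis
  proof (rule ccontr)
    assume no: "\<not> ?thesis"
    have ex: "\<exists>t x q. t \<in> {0<..<T} \<and> \<bar>t - tb\<bar> < min min_len (inverse (real (Suc k))) \<and> 0 \<le> x \<and>
      x < min min_len (inverse (real (Suc k))) \<and> q \<le> \<pi> \<and> H e t (c + inward c * x) (inward c * q) \<le> \<mu>" for k
    proof -
      have "0 < min min_len (inverse (real (Suc k)))" using min_len(1) by simp
      then show ?thesis using no by (metis not_le)
    qed
    have "\<forall>k. \<exists>z. fst z \<in> {0<..<T} \<and> \<bar>fst z - tb\<bar> < min min_len (inverse (real (Suc k))) \<and> 0 \<le> fst (snd z) \<and>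
      fst (snd z) < min min_len (inverse (real (Suc k))) \<and> snd (snd z) \<le> \<pi> \<and>
      H e (fst z) (c + inward c * fst (snd z)) (inward c * snd (snd z)) \<le> \<mu>"
    proof
      fix k
      obtain t x q where "t \<in> {0<..<T} \<and> \<bar>t - tb\<bar> < min min_len (inverse (real (Suc k))) \<and> 0 \<le> x \<and>
        x < min min_len (inverse (real (Suc k))) \<and> q \<le> \<pi> \<and> H e t (c + inward c * x) (inward c * q) \<le> \<mu>"
        using ex[of k] by (elim exE)
      then show "\<exists>z. fst z \<in> {0<..<T} \<and> \<bar>fst z - tb\<bar> < min min_len (inverse (real (Suc k))) \<and> 0 \<le> fst (snd z) \<and>
        fst (snd z) < min min_len (inverse (real (Suc k))) \<and> snd (snd z) \<le> \<pi> \<and>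
        H e (fst z) (c + inward c * fst (snd z)) (inward c * snd (snd z)) \<le> \<mu>"
        by (intro exI[of _ "(t, x, q)"]) (simp only: fst_conv snd_conv)
    qed
    from choice[OF this] obtain z where z: "\<forall>k. fst (z k) \<in> {0<..<T} \<and>
      \<bar>fst (z k) - tb\<bar> < min min_len (inverse (real (Suc k))) \<and> 0 \<le> fst (snd (z k)) \<and>
      fst (snd (z k)) < min min_len (inverse (real (Suc k))) \<and> snd (snd (z k)) \<le> \<pi> \<and>
      H e (fst (z k)) (c + inward c * fst (snd (z k))) (inward c * snd (snd (z k))) \<le> \<mu>" ..
    define t x q where "t k = fst (z k)" and "x k = fst (snd (z k))" and "q k = snd (snd (z k))" for k
    have t: "t k \<in> {0<..<T}" "\<bar>t k - tb\<bar> < inverse (real (Suc k))"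
      and x: "0 \<le> x k" "x k \<le> min_len" "\<bar>x k - 0\<bar> < inverse (real (Suc k))" and q: "q k \<le> \<pi>"
      and Hq: "H e (t k) (c + inward c * x k) (inward c * q k) \<le> \<mu>" for k
      using z[rule_format, of k] by (auto simp: t_def x_def q_def)
    have t_lim: "t \<longlonglongrightarrow> tb"
      by (rule LIM_zero_cancel, rule tendsto_rabs_zero_cancel, rule tendsto_sandwich[OF _ _ tendsto_const LIMSEQ_inverse_real_of_nat])
        (use t(2) in \<open>auto intro!: always_eventually less_imp_le\<close>)
    have x_lim: "x \<longlonglongrightarrow> 0"
      by (rule LIM_zero_cancel, rule tendsto_rabs_zero_cancel, rule tendsto_sandwich[OF _ _ tendsto_const LIMSEQ_inverse_real_of_nat])
        (use x(3) in \<open>auto intro!: always_eventually less_imp_le\<close>)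
    have pE: "c + inward c * x k \<in> edge G e" for k using from_end_edge[OF i x(1,2)] by simp
    obtain R where R: "\<And>e x t q. e \<in> edges G \<Longrightarrow> x \<in> edge G e \<Longrightarrow> t \<in> {0..T} \<Longrightarrow> R \<le> \<bar>q\<bar> \<Longrightarrow> \<mu> + 1 \<le> H e t x q"
      using coercive by blast
    have "\<bar>q k\<bar> \<le> R" for k
    proof (rule ccontr)
      assume "\<not> \<bar>q k\<bar> \<le> R"
      then have "\<mu> + 1 \<le> H e (t k) (c + inward c * x k) (inward c * q k)"
        using R[OF e pE[of k], of "t k" "inward c * q k"] t(1)[of k] by (simp add: abs_inward)
      then show False using Hq[of k] by simp
    qed
    then have "bounded (range q)" by (intro boundedI[of _ R]) auto
    then obtain l m where lm: "strict_mono m" "(q \<circ> m) \<longlonglongrightarrow> l"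
      using bounded_imp_convergent_subsequence by blast
    have qm: "(\<lambda>k. q (m k)) \<longlonglongrightarrow> l" using lm(2) by (simp add: comp_def)
    have tm: "(\<lambda>k. t (m k)) \<longlonglongrightarrow> tb" and xm: "(\<lambda>k. x (m k)) \<longlonglongrightarrow> 0"
      using LIMSEQ_subseq_LIMSEQ[OF t_lim lm(1)] LIMSEQ_subseq_LIMSEQ[OF x_lim lm(1)] by (auto simp: comp_def)
    have "(\<lambda>k. c + inward c * x (m k)) \<longlonglongrightarrow> c + inward c * 0" "(\<lambda>k. inward c * q (m k)) \<longlonglongrightarrow> inward c * l"
      by (intro tendsto_intros xm qm)+
    from H_limit[OF e tm this] have "(\<lambda>k. H e (t (m k)) (c + inward c * x (m k)) (inward c * q (m k)))
        \<longlonglongrightarrow> H e tb (c + inward c * 0) (inward c * l)"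
      using t(1) pE by (auto simp: less_imp_le)
    then have "H e tb (c + inward c * 0) (inward c * l) \<le> \<mu>"
      by (rule tendsto_upperbound) (use Hq in auto)
    moreover have "l \<le> \<pi>" using qm by (rule tendsto_upperbound) (use q in auto)
    ultimately show False using lev[of l] \<mu> by simp
  qed
qed

lemma time_level_near:
  assumes "- tpart' sb tb tb < \<mu>"
  obtains r where "0 < r" "\<And>t s. \<bar>t - tb\<bar> < r \<Longrightarrow> \<bar>s - sb\<bar> < r \<Longrightarrow> - tpart' s tb t < \<mu>"
proof -
  have "isCont (\<lambda>z. - tpart' (snd z) tb (fst z)) (tb, sb)"
    unfolding time_part'_def using tb pos(2) by (intro continuous_intros) auto
  then have "((\<lambda>z. - tpart' (snd z) tb (fst z)) \<longlongrightarrow> - tpart' sb tb tb) (nhds (tb, sb))"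
    unfolding isCont_def by (subst (asm) tendsto_at_iff_tendsto_nhds) simp
  from order_tendstoD(2)[OF this assms]
  have "\<forall>\<^sub>F z in nhds (tb, sb). - tpart' (snd z) tb (fst z) < \<mu>" .
  then obtain r where r: "0 < r" "\<And>z. dist z (tb, sb) < r \<Longrightarrow> - tpart' (snd z) tb (fst z) < \<mu>"
    by (auto simp: eventually_nhds_metric)
  show thesis
  proof (rule that[of "r / 2"])
    fix t s :: real assume *: "\<bar>t - tb\<bar> < r / 2" "\<bar>s - sb\<bar> < r / 2"
    have "dist (t, s) (tb, sb) \<le> \<bar>t - tb\<bar> + \<bar>s - sb\<bar>"
      unfolding dist_prod_def dist_real_def by simp (rule sqrt_sum_squares_le_sum_abs)
    then show "- tpart' s tb t < \<mu>" using r(2)[of "(t, s)"] * by simp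
  qed (use r in simp)
qed

text \<open>The core of the proof. Near the vertex the space variable is doubled with the penalty \<open>\<Theta> + k P\<close>. Here \<open>\<Theta>\<close> is
  an asymmetric distance between a point \<open>x\<close> on the end \<open>i\<close> and a point \<open>y\<close> on the end \<open>j\<close>. As a function of \<open>x\<close>, its
  inward slope between the vertex and \<open>y\<close> is \<open>\<sigma>' j = \<pi> j - 2 \<alpha>\<close>, and \<open>H\<close> is at least \<open>\<kappa>\<close> for all inward slopes below
  \<open>\<pi> j\<close>; elsewhere the slope is \<open>R'\<close>, so large that coercivity applies.

  All these slopes violate the sub-solution inequality for \<open>U\<close>, whose level is below \<open>\<kappa>\<close>. Testing \<open>U\<close> alone, at
  a point of the open edge or at the vertex itself, therefore shows that for large \<open>k\<close> the doubled maximum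
  has \<open>x = y\<close>. There the penalty vanishes and the doubled maximum is the original one, at the vertex.
  Consequently \<open>\<Theta> + k P\<close> provides tests of both functions at the vertex: \<open>U\<close> with inward slopes \<open>R'\<close>, and \<open>V\<close>
  with slopes that correspond to \<open>\<sigma>'\<close>.\<close>

lemma vertex_maximum:
  assumes n: "n \<in> vertices G" "ab \<in> n" and H4: "H4 G H p0"
    and lev: "\<And>e c q. (e, c) \<in> n \<Longrightarrow> q \<le> \<pi> (e, c) \<Longrightarrow> \<kappa> \<le> H e tb c (inward c * q)"
    and \<kappa>: "- ((tb - sb) / \<nu> + \<eta> / (T - tb)\<^sup>2) < \<kappa>"
  obtains q where
    "(tb - sb) / \<nu> + \<eta> / (T - tb)\<^sup>2 + network_hamiltonian G H p0 A tb n q \<le> 0"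
    "(sb - tb) / \<nu> + \<eta> / (T - sb)\<^sup>2 \<le> network_hamiltonian G H p0 A sb n (\<lambda>i. inward (snd i) * (\<pi> i - 2 * \<alpha>))"
proof -
  have nP: "n \<in> network_points G" using vertex_network_point[OF n(1)] .
  have fin: "finite n" using network_point_finite[OF nP] .
  have nE: "i \<in> endpoints G" "fst i \<in> edges G" "i \<in> edge_points G" if "i \<in> n" for i
    using that vertex_subset[OF n(1)] by (auto simp: endpoints_def edge_points_def)
  have glue: "U t i = U t j" "V t i = V t j" "\<Lambda> i = \<Lambda> j" if "i \<in> n" "j \<in> n" for t i j
    using upper_env_point[OF nP that] walk_dist_point[OF Z nP that] by auto
  \<comment> \<open>A level strictly between that of the sub-solution inequality and \<open>\<kappa>\<close>.\<close>
  define \<mu> where "\<mu> = (\<kappa> - ((tb - sb) / \<nu> + \<eta> / (T - tb)\<^sup>2)) / 2"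
  have \<mu>: "\<mu> < \<kappa>" "- tpart' sb tb tb < \<mu>"
  proof -
    have half: "(b - a) / 2 < b \<and> - a < (b - a) / 2" if "- a < b" for a b :: real using that by auto
    show "\<mu> < \<kappa>" "- tpart' sb tb tb < \<mu>"
      using half[OF \<kappa>] unfolding \<mu>_def time_part'_def by auto
  qed
  define \<sigma>' where "\<sigma>' i = \<pi> i - 2 * \<alpha>" for i
  obtain R where R: "\<And>e x t q. e \<in> edges G \<Longrightarrow> x \<in> edge G e \<Longrightarrow> t \<in> {0..T} \<Longrightarrow> R \<le> \<bar>q\<bar> \<Longrightarrow> \<mu> \<le> H e t x q"
    using coercive by blast
  define R' where "R' = R + \<alpha>"
  have "\<exists>r>0. \<forall>t x q. t \<in> {0<..<T} \<longrightarrow> \<bar>t - tb\<bar> < r \<longrightarrow> 0 \<le> x \<longrightarrow> x < r \<longrightarrow> q \<le> \<pi> i \<longrightarrow>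
      \<mu> < H (fst i) t (snd i + inward (snd i) * x) (inward (snd i) * q)" if i: "i \<in> n" for i
  proof -
    have "(fst i, snd i) \<in> endpoints G" using nE[OF i] by simp
    moreover have "\<kappa> \<le> H (fst i) tb (snd i) (inward (snd i) * q)" if "q \<le> \<pi> i" for q
      using lev[of "fst i" "snd i" q] i that by simp
    ultimately show ?thesis using \<mu>(1) by (rule level_near_end)
  qed
  then have "\<forall>i\<in>n. \<exists>r. 0 < r \<and> (\<forall>t x q. t \<in> {0<..<T} \<longrightarrow> \<bar>t - tb\<bar> < r \<longrightarrow> 0 \<le> x \<longrightarrow> x < r \<longrightarrow> q \<le> \<pi> i \<longrightarrow>
      \<mu> < H (fst i) t (snd i + inward (snd i) * x) (inward (snd i) * q))" by blast
  from bchoice[OF this] obtain rl where rl: "\<forall>i\<in>n. 0 < rl i \<and> (\<forall>t x q. t \<in> {0<..<T} \<longrightarrow> \<bar>t - tb\<bar> < rl i \<longrightarrow>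
      0 \<le> x \<longrightarrow> x < rl i \<longrightarrow> q \<le> \<pi> i \<longrightarrow> \<mu> < H (fst i) t (snd i + inward (snd i) * x) (inward (snd i) * q))" ..
  obtain rt where rt: "0 < rt" "\<And>t s. \<bar>t - tb\<bar> < rt \<Longrightarrow> \<bar>s - sb\<bar> < rt \<Longrightarrow> - tpart' s tb t < \<mu>"
    using time_level_near[OF \<mu>(2)] by blast
  \<comment> \<open>\<open>\<rho>\<close> is the size of the box of the maximisation, \<open>r\<close> that of the region where all local estimates hold; at \<open>r \<le> \<alpha> / 2\<close> the
    slopes added by the strictness terms are at most \<open>\<alpha>\<close>.\<close>
  define \<rho> where "\<rho> = Min {min_len / 2, tb / 2, (T - tb) / 2, sb / 2, (T - sb) / 2}"
  have "\<rho> \<in> {min_len / 2, tb / 2, (T - tb) / 2, sb / 2, (T - sb) / 2}"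
    unfolding \<rho>_def by (intro Min_in) auto
  then have \<rho>0: "0 < \<rho>" using min_len(1) tb sb by auto
  have \<rho>h: "\<rho> \<le> min_len / 2" "\<rho> \<le> tb / 2" "\<rho> \<le> (T - tb) / 2" "\<rho> \<le> sb / 2" "\<rho> \<le> (T - sb) / 2"
    unfolding \<rho>_def by (intro Min_le; simp)+
  have \<rho>: "\<rho> < min_len" "\<rho> < tb" "tb + \<rho> < T" "\<rho> < sb" "sb + \<rho> < T"
  proof -
    have "\<rho> * 2 \<le> min_len" "\<rho> * 2 \<le> tb" "\<rho> * 2 \<le> T - tb" "\<rho> * 2 \<le> sb" "\<rho> * 2 \<le> T - sb"
      using \<rho>h by (simp_all only: le_divide_eq_numeral1)
    then show "\<rho> < min_len" "\<rho> < tb" "tb + \<rho> < T" "\<rho> < sb" "sb + \<rho> < T" using \<rho>0 by auto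
  qed
  define r where "r = Min (insert (min \<rho> (min rt (\<alpha> / 2))) (rl ` n))"
  have "r \<in> insert (min \<rho> (min rt (\<alpha> / 2))) (rl ` n)" unfolding r_def using fin by (intro Min_in) auto
  then have r0: "0 < r" using \<rho>0 rt(1) pos(4) rl by auto
  have "r \<le> min \<rho> (min rt (\<alpha> / 2))" unfolding r_def using fin by (intro Min_le) auto
  then have r: "r \<le> \<rho>" "r \<le> rt" "r \<le> \<alpha> / 2" by auto
  have r_rl: "r \<le> rl i" if "i \<in> n" for i unfolding r_def using fin that by (intro Min_le) auto
  have level: "\<mu> < H (fst i) t (snd i + inward (snd i) * x) (inward (snd i) * q)"
    if "i \<in> n" "t \<in> {0<..<T}" "\<bar>t - tb\<bar> < r" "0 \<le> x" "x < r" "q \<le> \<pi> i" for i t x q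
    using rl[rule_format, OF that(1)] r_rl[OF that(1)] that by auto
  define K where "K = {tb - \<rho>..tb + \<rho>} \<times> {sb - \<rho>..sb + \<rho>} \<times> {0..\<rho>} \<times> {0..\<rho>}"
  have "compact K" unfolding K_def by (intro compact_Times compact_Icc)
  have inE: "snd (from_end i x) \<in> edge G (fst i)" "from_end i x \<in> edge_points G" if "i \<in> n" "x \<in> {0..\<rho>}" for i x
    using from_end_edge[OF nE(1)[OF that(1)], of x] that(2) \<rho>(1) nE(2)[OF that(1)]
    by (auto simp: from_end_def edge_points_def)
  define \<Theta> where "\<Theta> i j x y = (if i = j then R' * max (x - y) 0 + \<sigma>' i * min (x - y) 0 else R' * x - \<sigma>' j * y)" for i j x y
  define P where "P i j = (\<lambda>(t::real, s::real, x, y). if i = j then (x - y)\<^sup>2 else x\<^sup>2 + y\<^sup>2 :: real)" for i j :: "'e \<times> real"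
  define rest where "rest i j = (\<lambda>(t, s, x, y). ((t - s)\<^sup>2 / (2 * \<nu>) + \<eta> / (T - t) + \<eta> / (T - s)) + \<alpha> * \<Lambda> (from_end i x)
      + (t - tb)\<^sup>2 + (s - sb)\<^sup>2 + x\<^sup>2 + \<Theta> i j x y)" for i j
  define F where "F i j z = U (fst (fst z, snd (from_end i (fst (snd (snd z)))))) (fst i, snd (fst z, snd (from_end i (fst (snd (snd z))))))
      + V (fst (fst (snd z), snd (from_end j (snd (snd (snd z)))))) (fst j, snd (fst (snd z), snd (from_end j (snd (snd (snd z)))))) - rest i j z" for i j z
  have F: "F i j (t, s, x, y) = U t (from_end i x) + V s (from_end j y) - (((t - s)\<^sup>2 / (2 * \<nu>) + \<eta> / (T - t) + \<eta> / (T - s))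
      + \<alpha> * \<Lambda> (from_end i x) + (t - tb)\<^sup>2 + (s - sb)\<^sup>2 + x\<^sup>2 + \<Theta> i j x y)" for i j t s x y
    by (simp add: F_def rest_def from_end_def)
  let ?z0 = "(tb, sb, 0, 0)"
  have top: "top_value = U tb i + V sb j - ((tb - sb)\<^sup>2 / (2 * \<nu>) + \<eta> / (T - tb) + \<eta> / (T - sb)) - \<alpha> * \<Lambda> i"
    if "i \<in> n" "j \<in> n" for i j
    using glue[OF that(1) n(2)] glue[OF that(2) n(2)] by (simp add: top_value_def)
  have usc: "usc_on K (F i j)" if ij: "i \<in> n" "j \<in> n" for i j
    unfolding F_def[abs_def]
  proof (rule doubled_usc[OF U_bounded V_bounded nE(2)[OF ij(1)] nE(2)[OF ij(2)]])
    have fe: "continuous_on K (\<lambda>z. snd (from_end i (fst (snd (snd z)))))" for i :: "'e \<times> real"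
      unfolding from_end_def snd_conv by (intro continuous_intros)
    have fe': "continuous_on K (\<lambda>z. snd (from_end i (snd (snd (snd z)))))" for i :: "'e \<times> real"
      unfolding from_end_def snd_conv by (intro continuous_intros)
    show "continuous_on K (\<lambda>z. (fst z, snd (from_end i (fst (snd (snd z))))))"
      "continuous_on K (\<lambda>z. (fst (snd z), snd (from_end j (snd (snd (snd z))))))"
      by (intro continuous_intros fe fe')+
    show "(\<lambda>z. (fst z, snd (from_end i (fst (snd (snd z)))))) ` K \<subseteq> {0..<T} \<times> edge G (fst i)"
      using \<rho> inE(1)[OF ij(1)] by (auto simp: K_def)
    show "(\<lambda>z. (fst (snd z), snd (from_end j (snd (snd (snd z)))))) ` K \<subseteq> {0..<T} \<times> edge G (fst j)"
      using \<rho> inE(1)[OF ij(2)] by (auto simp: K_def)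
    have "continuous_on K (\<lambda>z. \<Lambda> (fst i, snd (from_end i (fst (snd (snd z))))))"
      by (rule continuous_on_compose2[OF \<Lambda>_continuous[OF nE(2)[OF ij(1)]] fe])
        (use inE(1)[OF ij(1)] in \<open>auto simp: K_def\<close>)
    then have 1: "continuous_on K (\<lambda>z. \<Lambda> (from_end i (fst (snd (snd z)))))" by (simp add: from_end_def)
    have 2: "continuous_on K (\<lambda>z. \<Theta> i j (fst (snd (snd z))) (snd (snd (snd z))))"
      unfolding \<Theta>_def by (cases "i = j") (auto intro!: continuous_intros)
    have "\<forall>z\<in>K. T - fst z \<noteq> 0" "\<forall>z\<in>K. T - fst (snd z) \<noteq> 0" using \<rho> by (auto simp: K_def)
    then show "continuous_on K (rest i j)" unfolding rest_def case_prod_unfold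
      using pos(2) by (intro continuous_intros 1 2) auto
  qed
  have Pc: "continuous_on K (P i j)" for i j
    unfolding P_def case_prod_unfold by (cases "i = j") (auto intro!: continuous_intros)
  have Pn: "0 \<le> P i j z" for i j z by (auto simp: P_def split: prod.split)
  have z0: "?z0 \<in> K" using \<rho>0 by (auto simp: K_def)
  have diag: "F i j (t, s, x, y) \<le> top_value - ((t - tb)\<^sup>2 + (s - sb)\<^sup>2 + x\<^sup>2)"
    if ij: "i \<in> n" "j \<in> n" and K: "(t, s, x, y) \<in> K" and P0: "P i j (t, s, x, y) = 0" for i j t s x y
  proof -
    have ts: "t \<in> {0..<T}" "s \<in> {0..<T}" "x \<in> {0..\<rho>}" using K \<rho> by (auto simp: K_def)
    have "V s (from_end j y) = V s (from_end i x)" "\<Theta> i j x y = 0"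
      using P0 glue(2)[OF ij] by (auto simp: P_def \<Theta>_def from_end_0 split: if_splits)
    then show ?thesis using maximum'[OF ts(1,2) inE(2)[OF ij(1) ts(3)]] unfolding F by simp
  qed
  have strict: "F i j z < top_value" if ij: "i \<in> n" "j \<in> n" and z: "z \<in> K" "P i j z = 0" "z \<noteq> ?z0" for i j z
  proof -
    obtain t s x y where zeq: "z = (t, s, x, y)" by (metis prod.collapse)
    have "y = 0" if "x = 0" using z(2) that by (auto simp: zeq P_def split: if_splits)
    then have "t \<noteq> tb \<or> s \<noteq> sb \<or> x \<noteq> 0" using z(3) zeq by auto
    then have "0 < (t - tb)\<^sup>2 + (s - sb)\<^sup>2 + x\<^sup>2" by (auto simp: add_pos_nonneg add_nonneg_pos)
    then show ?thesis using diag[OF ij z(1,2)[unfolded zeq]] by (simp add: zeq)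
  qed
  have "\<forall>\<^sub>F k in sequentially. \<forall>z\<in>K. top_value \<le> F i j z - real k * P i j z \<longrightarrow> dist z ?z0 < r" if "i \<in> n" "j \<in> n" for i j
    unfolding eventually_sequentially
    by (rule penalisation[OF \<open>compact K\<close> usc[OF that] Pc Pn strict[OF that] r0])
  then have "\<forall>i\<in>n. \<forall>j\<in>n. \<forall>\<^sub>F k in sequentially. \<forall>z\<in>K. top_value \<le> F i j z - real k * P i j z \<longrightarrow> dist z ?z0 < r" by blast
  then have "\<forall>\<^sub>F k in sequentially. \<forall>i\<in>n. \<forall>j\<in>n. \<forall>z\<in>K. top_value \<le> F i j z - real k * P i j z \<longrightarrow> dist z ?z0 < r"
    by (intro eventually_ball_finite[OF fin] ballI) (drule bspec, assumption, drule bspec, assumption, assumption)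
  then obtain k :: nat where "\<forall>i\<in>n. \<forall>j\<in>n. \<forall>z\<in>K. top_value \<le> F i j z - real k * P i j z \<longrightarrow> dist z ?z0 < r"
    using eventually_happens'[OF sequentially_bot] by blast
  note k = this[rule_format]
  define \<Phi> where "\<Phi> i j t s x y = F i j (t, s, x, y) - real k * P i j (t, s, x, y)" for i j t s x y
  have \<Phi>_same: "\<Phi> i i t s x y = U t (from_end i x) + V s (from_end i y)
      - ((t - s)\<^sup>2 / (2 * \<nu>) + \<eta> / (T - t) + \<eta> / (T - s)) - \<alpha> * \<Lambda> (from_end i x)
      - (t - tb)\<^sup>2 - (s - sb)\<^sup>2 - x\<^sup>2 - (R' * max (x - y) 0 + \<sigma>' i * min (x - y) 0) - real k * (x - y)\<^sup>2" for i t s x y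
    unfolding \<Phi>_def F by (simp add: \<Theta>_def P_def)
  have \<Phi>_diff: "\<Phi> i j t s x y = U t (from_end i x) + V s (from_end j y)
      - ((t - s)\<^sup>2 / (2 * \<nu>) + \<eta> / (T - t) + \<eta> / (T - s)) - \<alpha> * \<Lambda> (from_end i x)
      - (t - tb)\<^sup>2 - (s - sb)\<^sup>2 - x\<^sup>2 - (R' * x - \<sigma>' j * y) - real k * (x\<^sup>2 + y\<^sup>2)" if "i \<noteq> j" for i j t s x y
    unfolding \<Phi>_def F using that by (simp add: \<Theta>_def P_def)
  have zK: "(t, s, x, y) \<in> K \<longleftrightarrow> \<bar>t - tb\<bar> \<le> \<rho> \<and> \<bar>s - sb\<bar> \<le> \<rho> \<and> 0 \<le> x \<and> x \<le> \<rho> \<and> 0 \<le> y \<and> y \<le> \<rho>" for t s x y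
    by (auto simp: K_def abs_le_iff)
  have \<Phi>_top: "\<Phi> i i tb sb 0 0 = top_value" if "i \<in> n" for i
    unfolding \<Phi>_same top[OF that that] by (simp add: from_end_0)
  have top_le: "\<Phi> i j t s x y \<le> top_value" if ij0: "i \<in> n" "j \<in> n" and K0: "(t, s, x, y) \<in> K" for i j t s x y
  proof -
    have "\<exists>z. z \<in> K \<and> (\<forall>z'\<in>K. F (fst p) (snd p) z' - real k * P (fst p) (snd p) z' \<le> F (fst p) (snd p) z - real k * P (fst p) (snd p) z)"
      if p: "p \<in> n \<times> n" for p
    proof -
      have "continuous_on K (\<lambda>z. - (real k * P (fst p) (snd p) z))"
        by (intro continuous_on_minus continuous_on_mult_left Pc)
      from usc_on_add[OF usc[of "fst p" "snd p"] usc_on_continuous[OF this]] p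
      have "usc_on K (\<lambda>z. F (fst p) (snd p) z - real k * P (fst p) (snd p) z)" by (simp add: mem_Times_iff)
      moreover have "K \<noteq> {}" using z0 by auto
      ultimately show ?thesis
        using usc_attains_max[OF \<open>compact K\<close>, of "\<lambda>z. F (fst p) (snd p) z - real k * P (fst p) (snd p) z"] by simp
    qed
    then have "\<forall>p\<in>n \<times> n. \<exists>z. z \<in> K \<and> (\<forall>z'\<in>K. F (fst p) (snd p) z' - real k * P (fst p) (snd p) z'
      \<le> F (fst p) (snd p) z - real k * P (fst p) (snd p) z)" by (rule ballI)
    from bchoice[OF this] obtain zm where zm: "\<forall>p\<in>n \<times> n. zm p \<in> K \<and> (\<forall>z'\<in>K. F (fst p) (snd p) z' - real k * P (fst p) (snd p) z'
      \<le> F (fst p) (snd p) (zm p) - real k * P (fst p) (snd p) (zm p))" ..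
    have "finite (n \<times> n)" "n \<times> n \<noteq> {}" using fin ij0 by auto
    then obtain p where p: "p \<in> n \<times> n" "\<And>p'. p' \<in> n \<times> n \<Longrightarrow> F (fst p') (snd p') (zm p') - real k * P (fst p') (snd p') (zm p')
        \<le> F (fst p) (snd p) (zm p) - real k * P (fst p) (snd p) (zm p)"
      by (rule finite_argmax[where f = "\<lambda>p. F (fst p) (snd p) (zm p) - real k * P (fst p) (snd p) (zm p)"]) (rule that)
    obtain i j where ij: "p = (i, j)" "i \<in> n" "j \<in> n" using p(1) by auto
    obtain t s x y where z: "zm p = (t, s, x, y)" by (metis prod.collapse)
    have K: "(t, s, x, y) \<in> K" using zm[rule_format, OF p(1)] unfolding z by simp
    have mx: "\<Phi> i' j' t' s' x' y' \<le> \<Phi> i j t s x y" if "i' \<in> n" "j' \<in> n" "(t', s', x', y') \<in> K" for i' j' t' s' x' y'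
    proof -
      have p': "(i', j') \<in> n \<times> n" using that by simp
      show ?thesis using p(2)[OF p'] zm[rule_format, OF p'] that(3) unfolding \<Phi>_def ij(1) z[unfolded ij(1)]
        by fastforce
    qed
    have val: "top_value \<le> \<Phi> i j t s x y"
      using mx[OF ij(2,2) z0] \<Phi>_top[OF ij(2)] by simp
    have d: "\<bar>t - tb\<bar> < r" "\<bar>s - sb\<bar> < r" "\<bar>x - 0\<bar> < r" "\<bar>y - 0\<bar> < r"
      using dist4[OF k[OF ij(2,3) K val[unfolded \<Phi>_def]]] by auto
    have xy: "0 \<le> x" "0 \<le> y" "x < r" "y < r" using K d by (auto simp: zK)
    have t: "t \<in> {0<..<T}" "\<bar>t - tb\<bar> < \<rho>" "\<bar>s - sb\<bar> < \<rho>" using d(1,2) r(1) \<rho> by (auto simp: abs_less_iff)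
    have lt: "- tpart' s tb t < \<mu>" using rt(2) d(1,2) r(2) by auto
    \<comment> \<open>No inward slope below \<open>\<pi> i\<close> or above \<open>R\<close> is compatible with a test of \<open>U\<close> near the maximum.\<close>
    have slope: False if i: "i \<in> n" and H: "tpart' s tb t + H (fst i) t (snd i + inward (snd i) * \<xi>) (inward (snd i) * Q) \<le> 0"
      and \<xi>: "0 \<le> \<xi>" "\<xi> < r" and Q: "Q \<le> \<pi> i \<or> R \<le> Q" for i \<xi> Q
      using Q
    proof
      assume "Q \<le> \<pi> i"
      then show False using level[OF i t(1) d(1) \<xi>] H lt by fastforce
    next
      assume "R \<le> Q"
      then have "R \<le> \<bar>inward (snd i) * Q\<bar>" by (simp add: abs_inward)
      moreover have "snd i + inward (snd i) * \<xi> \<in> edge G (fst i)"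
        using from_end_edge[OF nE(1)[OF i] \<xi>(1)] \<xi>(2) r(1) \<rho>(1) by simp
      ultimately show False using R[OF nE(2)[OF i], of "snd i + inward (snd i) * \<xi>" t "inward (snd i) * Q"] t(1) H lt by fastforce
    qed
    have "\<Phi> i j t s x y \<le> top_value"
    proof (cases "P i j (t, s, x, y) = 0")
      case True
      have "0 \<le> real k * P i j (t, s, x, y)" using Pn by simp
      moreover have "0 \<le> (t - tb)\<^sup>2 + (s - sb)\<^sup>2 + x\<^sup>2" by simp
      ultimately show ?thesis using diag[OF ij(2,3) K True] unfolding \<Phi>_def by linarith
    next
      case off: False
      show ?thesis
      proof (cases "x = 0")
        case False
        \<comment> \<open>\<open>U\<close> is tested inside the edge of \<open>i\<close>; \<open>a\<close> and \<open>m\<close> describe the branch of the penalty that is active near \<open>x\<close>.\<close>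
        then have x0: "0 < x" using xy(1) by simp
        define a where "a = (if i = j \<and> x < y then \<sigma>' i else R')"
        define m where "m = (if i = j then y else 0)"
        define r2 where "r2 = (if i = j then min x \<bar>x - y\<bar> else x)"
        define rad where "rad = min r2 (min (\<rho> - x) (\<rho> - \<bar>t - tb\<bar>))"
        have neq: "x \<noteq> y" if "i = j" using off that by (simp add: P_def)
        have r2: "0 < r2" "r2 \<le> x" using x0 neq by (auto simp: r2_def)
        have rad: "0 < rad" "rad \<le> r2" "rad \<le> \<rho> - x" "rad \<le> \<rho> - \<bar>t - tb\<bar>"
          using r2 xy(3) r(1) t(2) by (auto simp: rad_def)
        define cst where "cst = V s (from_end j y) - \<eta> / (T - s) - (s - sb)\<^sup>2
          + (if i = j then a * y else \<sigma>' j * y - real k * y\<^sup>2)"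
        have loc: "\<Phi> i j t' s x' y = U t' (from_end i x') - tpart s tb t' - \<alpha> * \<Lambda> (from_end i x')
            - (a * x' + real k * (x' - m)\<^sup>2 + x'\<^sup>2) + cst" if "\<bar>x' - x\<bar> < r2" for t' x'
        proof (cases "i = j")
          case True
          have "R' * max (x' - y) 0 + \<sigma>' i * min (x' - y) 0 = a * (x' - y)"
          proof (cases "x < y")
            case lt: True
            then have "x' < y" using that True by (simp add: r2_def) linarith
            then show ?thesis using lt True by (simp add: a_def)
          next
            case ge: False
            then have "y < x'" using that True neq[OF True] by (simp add: r2_def) linarith
            then show ?thesis using ge True by (simp add: a_def)
          qed
          then show ?thesis unfolding True[symmetric] \<Phi>_same cst_def m_def time_part_def
            using True by (simp add: algebra_simps)
        next
          case False
          then show ?thesis unfolding \<Phi>_diff[OF False] cst_def m_def a_def time_part_def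
            by (simp add: algebra_simps)
        qed
        let ?c = "snd i" and ?v = "inward (snd i)"
        let ?Y = "{from_end i x}"
        have fe: "from_end i x = (fst i, ?c + ?v * x)" by (simp add: from_end_def)
        have int: "?c + ?v * x \<in> edge_interior G (fst i)"
          using from_end_interior[OF nE(1)[OF ij(2)] x0] xy(3) r(1) \<rho>(1) by simp
        have Y: "?Y \<in> network_points G" unfolding fe using interior_network_point[OF nE(2)[OF ij(2)] int] .
        obtain q where q: "\<And>l. l \<in> ?Y \<Longrightarrow> \<bar>q l\<bar> \<le> 1"
          "tpart' s tb t + network_hamiltonian G H p0 A t ?Y (\<lambda>l. \<alpha> * q l + quad' a (real k) m ?v ?c (snd l)) \<le> 0"
        proof (rule test_U[where c = s and d = tb and \<phi> = "\<lambda>l. quad a (real k) m ?v ?c"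
              and \<phi>' = "\<lambda>l. quad' a (real k) m ?v ?c", OF t(1) Y quad_C1 rad(1)])
          fix t' l \<xi> assume *: "t' \<in> {0<..<T}" "\<bar>t' - t\<bar> < rad" "l \<in> ?Y" "\<xi> \<in> edge G (fst l)" "\<bar>\<xi> - snd l\<bar> < rad"
          then have l: "l = from_end i x" by simp
          define x' where "x' = ?v * (\<xi> - ?c)"
          have \<xi>: "(fst l, \<xi>) = from_end i x'" unfolding x'_def l using from_end_eq[of i \<xi>] by (simp add: from_end_def)
          have "x' - x = ?v * (\<xi> - snd l)" by (simp add: x'_def l fe algebra_simps inward_cancel inward_square)
          then have x': "\<bar>x' - x\<bar> < rad" using *(5) by (simp add: abs_inward)
          then have "(t', s, x', y) \<in> K" using rad(2-4) r2(2) *(2) K by (auto simp: zK abs_if split: if_splits)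
          from mx[OF ij(2,3) this]
          have "U t' (from_end i x') - tpart s tb t' - \<alpha> * \<Lambda> (from_end i x') - (a * x' + real k * (x' - m)\<^sup>2 + x'\<^sup>2)
              \<le> U t (from_end i x) - tpart s tb t - \<alpha> * \<Lambda> (from_end i x) - (a * x + real k * (x - m)\<^sup>2 + x\<^sup>2)"
            using loc[of x' t'] loc[of x t] x' rad(2) r2(1) by simp
          moreover have "quad a (real k) m ?v ?c \<xi> = a * x' + real k * (x' - m)\<^sup>2 + x'\<^sup>2"
            "quad a (real k) m ?v ?c (snd l) = a * x + real k * (x - m)\<^sup>2 + x\<^sup>2"
            by (simp_all add: quad_def x'_def l fe inward_cancel inward_square)
          ultimately show "U t' (fst l, \<xi>) - tpart s tb t' - \<alpha> * \<Lambda> (fst l, \<xi>) - quad a (real k) m ?v ?c \<xi>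
              \<le> U t l - tpart s tb t - \<alpha> * \<Lambda> l - quad a (real k) m ?v ?c (snd l)"
            unfolding \<xi> by (simp only: l)
        qed (rule that)
        define Q where "Q = \<alpha> * (?v * q (from_end i x)) + (a + 2 * real k * (x - m) + 2 * x)"
        have "?v * Q = \<alpha> * q (from_end i x) + quad' a (real k) m ?v ?c (snd (from_end i x))"
          by (simp add: Q_def quad'_def fe inward_cancel distrib_left mult.left_commute[of ?v \<alpha>])
        then have HQ: "tpart' s tb t + H (fst i) t (?c + ?v * x) (?v * Q) \<le> 0"
          using q(2) network_hamiltonian_interior[OF nE(2)[OF ij(2)] int] by (simp add: fe)
        have "\<bar>q (from_end i x)\<bar> \<le> 1" using q(1) by simp
        then have "\<bar>\<alpha> * (?v * q (from_end i x))\<bar> \<le> \<alpha>"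
          using pos(4) mult_left_mono[of "\<bar>q (from_end i x)\<bar>" 1 \<alpha>] by (simp add: abs_mult[of \<alpha>] abs_inward)
        then have aq: "- \<alpha> \<le> \<alpha> * (?v * q (from_end i x))" "\<alpha> * (?v * q (from_end i x)) \<le> \<alpha>" by (simp_all add: abs_le_iff)
        have "Q \<le> \<pi> i \<or> R \<le> Q"
        proof (cases "i = j \<and> x < y")
          case True
          then have "real k * (x - m) \<le> 0" by (simp add: m_def mult_nonneg_nonpos)
          then have "Q \<le> \<pi> i" using aq(2) xy(3) r(3) True unfolding Q_def a_def \<sigma>'_def by simp
          then show ?thesis ..
        next
          case nt: False
          have "0 \<le> x - m" using nt x0 neq by (auto simp: m_def)
          then have "0 \<le> real k * (x - m)" by simp
          then have "R \<le> Q" using aq(1) x0 nt unfolding Q_def a_def R'_def by auto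
          then show ?thesis ..
        qed
        then have False using slope[OF ij(2) HQ xy(1,3)] by blast
        then show ?thesis ..
      next
        \<comment> \<open>Then \<open>x\<close> is the vertex, and the end \<open>j\<close> that carries \<open>y\<close> provides the violated inequality through the
            monotone part of its Hamiltonian.\<close>
        case x0: True
        have y0: "0 < y" using off x0 xy(2) by (cases "y = 0") (auto simp: P_def split: if_splits)
        define a where "a l = (if l = j then \<sigma>' j else R')" for l
        define m where "m l = (if l = j then y else 0)" for l :: "'e \<times> real"
        define rad where "rad = min y (\<rho> - \<bar>t - tb\<bar>)"
        have rad: "0 < rad" "rad \<le> y" "rad \<le> \<rho> - \<bar>t - tb\<bar>" using y0 t(2) by (auto simp: rad_def)
        define cst where "cst l = V s (from_end j y) - \<eta> / (T - s) - (s - sb)\<^sup>2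
          + (if l = j then \<sigma>' j * y else \<sigma>' j * y - real k * y\<^sup>2)" for l
        have loc: "\<Phi> l j t' s x' y = U t' (from_end l x') - tpart s tb t' - \<alpha> * \<Lambda> (from_end l x')
            - (a l * x' + real k * (x' - m l)\<^sup>2 + x'\<^sup>2) + cst l" if "0 \<le> x'" "x' < y" for t' x' l
        proof (cases "l = j")
          case True
          have "R' * max (x' - y) 0 + \<sigma>' j * min (x' - y) 0 = \<sigma>' j * (x' - y)"
            using that by (simp add: max_def min_def)
          then show ?thesis unfolding True \<Phi>_same cst_def m_def a_def time_part_def by (simp add: algebra_simps)
        next
          case False
          then show ?thesis unfolding \<Phi>_diff[OF False] cst_def m_def a_def time_part_def by (simp add: algebra_simps)
        qed
        have at_n: "\<Phi> i j t s x y = \<Phi> l j t s 0 y" if l: "l \<in> n" for l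
        proof -
          have 1: "\<Phi> l j t s 0 y = U t l - tpart s tb t - \<alpha> * \<Lambda> l + V s (from_end j y) - \<eta> / (T - s) - (s - sb)\<^sup>2
              + \<sigma>' j * y - real k * y\<^sup>2" for l
            using loc[of 0 l t] y0 by (auto simp: cst_def m_def from_end_0)
          show ?thesis unfolding x0 1 using glue[OF ij(2) l] by simp
        qed
        obtain q where q: "\<And>l. l \<in> n \<Longrightarrow> \<bar>q l\<bar> \<le> 1"
          "tpart' s tb t + network_hamiltonian G H p0 A t n
            (\<lambda>l. \<alpha> * q l + quad' (a l) (real k) (m l) (inward (snd l)) (snd l) (snd l)) \<le> 0"
        proof (rule test_U[where c = s and d = tb and \<phi> = "\<lambda>l. quad (a l) (real k) (m l) (inward (snd l)) (snd l)"
              and \<phi>' = "\<lambda>l. quad' (a l) (real k) (m l) (inward (snd l)) (snd l)", OF t(1) nP quad_C1 rad(1)])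
          fix t' l \<xi> assume *: "t' \<in> {0<..<T}" "\<bar>t' - t\<bar> < rad" "l \<in> n" "\<xi> \<in> edge G (fst l)" "\<bar>\<xi> - snd l\<bar> < rad"
          define x' where "x' = inward (snd l) * (\<xi> - snd l)"
          have \<xi>: "(fst l, \<xi>) = from_end l x'" unfolding x'_def by (rule from_end_eq)
          have "x' = \<bar>\<xi> - snd l\<bar>" using endpoint_abs[of "fst l" "snd l" \<xi>] nE(1)[OF *(3)] *(4) by (simp add: x'_def)
          then have x': "0 \<le> x'" "x' < rad" using *(5) by auto
          then have "(t', s, x', y) \<in> K" using rad(2,3) *(2) K by (auto simp: zK abs_if split: if_splits)
          from mx[OF *(3) ij(3) this] at_n[OF *(3)] have "\<Phi> l j t' s x' y \<le> \<Phi> l j t s 0 y" by simp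
          then have "U t' (from_end l x') - tpart s tb t' - \<alpha> * \<Lambda> (from_end l x') - (a l * x' + real k * (x' - m l)\<^sup>2 + x'\<^sup>2)
              \<le> U t l - tpart s tb t - \<alpha> * \<Lambda> l - (a l * 0 + real k * (0 - m l)\<^sup>2 + 0\<^sup>2)"
            using loc[of x' l t'] loc[of 0 l t] x' rad(2) y0 by (simp add: from_end_0)
          moreover have "quad (a l) (real k) (m l) (inward (snd l)) (snd l) \<xi> = a l * x' + real k * (x' - m l)\<^sup>2 + x'\<^sup>2"
            "quad (a l) (real k) (m l) (inward (snd l)) (snd l) (snd l) = a l * 0 + real k * (0 - m l)\<^sup>2 + 0\<^sup>2"
            by (simp_all add: quad_def x'_def)
          ultimately show "U t' (fst l, \<xi>) - tpart s tb t' - \<alpha> * \<Lambda> (fst l, \<xi>) - quad (a l) (real k) (m l) (inward (snd l)) (snd l) \<xi>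
              \<le> U t l - tpart s tb t - \<alpha> * \<Lambda> l - quad (a l) (real k) (m l) (inward (snd l)) (snd l) (snd l)"
            unfolding \<xi> by (simp only:)
        qed (rule that)
        let ?c = "snd j" and ?v = "inward (snd j)"
        define Q where "Q = \<alpha> * (?v * q j) + (\<sigma>' j - 2 * real k * y)"
        have vQ: "\<alpha> * q j + quad' (a j) (real k) (m j) ?v ?c ?c = ?v * Q"
          by (simp add: Q_def quad'_def a_def m_def inward_cancel distrib_left mult.left_commute[of ?v \<alpha>])
        obtain Q' where Q': "Q' \<le> Q" "clip ?c (p0 (fst j) t ?c) (?v * Q) = ?v * Q'" using clip_inward by blast
        have "H (fst j) t ?c (?v * Q') \<le> network_hamiltonian G H p0 A t n
            (\<lambda>l. \<alpha> * q l + quad' (a l) (real k) (m l) (inward (snd l)) (snd l) (snd l))"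
          using flux_bounds(2)[OF n(1), of "fst j" ?c H t p0 "\<lambda>l. \<alpha> * q l + quad' (a l) (real k) (m l) (inward (snd l)) (snd l) (snd l)" A]
            ij(3) vQ Q'(2) by simp
        then have HQ: "tpart' s tb t + H (fst j) t (?c + ?v * 0) (?v * Q') \<le> 0" using q(2) by simp
        have "\<bar>\<alpha> * (?v * q j)\<bar> \<le> \<alpha>"
          using q(1)[OF ij(3)] pos(4) mult_left_mono[of "\<bar>q j\<bar>" 1 \<alpha>] by (simp add: abs_mult[of \<alpha>] abs_inward)
        then have "\<alpha> * (?v * q j) \<le> \<alpha>" by (rule order_trans[OF abs_ge_self])
        moreover have "0 \<le> 2 * real k * y" using y0 by simp
        ultimately have "Q' \<le> \<pi> j" using Q'(1) pos(4) unfolding Q_def \<sigma>'_def by linarith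
        then have False using slope[OF ij(3) HQ] r0 by blast
        then show ?thesis ..
      qed
    qed
    then show ?thesis using mx[OF ij0 K0] by simp
  qed
  have near_K: "(t, s, x, y) \<in> K" if "\<bar>t - tb\<bar> < \<rho>" "\<bar>s - sb\<bar> < \<rho>" "0 \<le> x" "x < \<rho>" "0 \<le> y" "y < \<rho>" for t s x y
    using that by (simp add: zK)
  have coord: "(fst l, \<xi>) = from_end l \<bar>\<xi> - snd l\<bar>" "\<bar>\<xi> - snd l\<bar> = inward (snd l) * (\<xi> - snd l)"
    if "l \<in> n" "\<xi> \<in> edge G (fst l)" for l \<xi>
    using endpoint_abs[of "fst l" "snd l" \<xi>] nE(1)[OF that(1)] that(2) from_end_eq[of l \<xi>] by auto
  obtain q where q: "tpart' sb tb tb + network_hamiltonian G H p0 A tb n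
      (\<lambda>l. \<alpha> * q l + quad' R' (real k) 0 (inward (snd l)) (snd l) (snd l)) \<le> 0"
  proof (rule test_U[where c = sb and d = tb and \<phi> = "\<lambda>l. quad R' (real k) 0 (inward (snd l)) (snd l)"
        and \<phi>' = "\<lambda>l. quad' R' (real k) 0 (inward (snd l)) (snd l)", OF tb nP quad_C1 \<rho>0])
    fix t' l \<xi> assume *: "t' \<in> {0<..<T}" "\<bar>t' - tb\<bar> < \<rho>" "l \<in> n" "\<xi> \<in> edge G (fst l)" "\<bar>\<xi> - snd l\<bar> < \<rho>"
    define x' where "x' = \<bar>\<xi> - snd l\<bar>"
    have "\<Phi> l l t' sb x' 0 \<le> \<Phi> l l tb sb 0 0"
      unfolding \<Phi>_top[OF *(3)] using *(2,5) \<rho>0 by (intro top_le[OF *(3,3)] near_K) (auto simp: x'_def)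
    moreover have "max (x' - 0) 0 = x'" "min (x' - 0) 0 = 0" by (auto simp: x'_def)
    ultimately show "U t' (fst l, \<xi>) - tpart sb tb t' - \<alpha> * \<Lambda> (fst l, \<xi>) - quad R' (real k) 0 (inward (snd l)) (snd l) \<xi>
        \<le> U tb l - tpart sb tb tb - \<alpha> * \<Lambda> l - quad R' (real k) 0 (inward (snd l)) (snd l) (snd l)"
      unfolding \<Phi>_same coord(1)[OF *(3,4)] quad_def coord(2)[OF *(3,4), symmetric] x'_def[symmetric] time_part_def
      by (simp add: from_end_0)
  qed blast
  have v: "tpart' tb sb sb \<le> network_hamiltonian G H p0 A sb n
      (\<lambda>l. - quad' (- \<sigma>' l) (real k - 1) 0 (inward (snd l)) (snd l) (snd l))"
  proof (rule test_V[where c = tb and d = sb and \<phi> = "\<lambda>l. quad (- \<sigma>' l) (real k - 1) 0 (inward (snd l)) (snd l)"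
        and \<phi>' = "\<lambda>l. quad' (- \<sigma>' l) (real k - 1) 0 (inward (snd l)) (snd l)", OF sb nP quad_C1 \<rho>0])
    fix s' l \<xi> assume *: "s' \<in> {0<..<T}" "\<bar>s' - sb\<bar> < \<rho>" "l \<in> n" "\<xi> \<in> edge G (fst l)" "\<bar>\<xi> - snd l\<bar> < \<rho>"
    define x' where "x' = \<bar>\<xi> - snd l\<bar>"
    have "\<Phi> l l tb s' 0 x' \<le> \<Phi> l l tb sb 0 0"
      unfolding \<Phi>_top[OF *(3)] using *(2,5) \<rho>0 by (intro top_le[OF *(3,3)] near_K) (auto simp: x'_def)
    moreover have "min (0 - x') 0 = - x'" "max (0 - x') 0 = 0" by (auto simp: x'_def)
    ultimately show "V s' (fst l, \<xi>) - tpart tb sb s' - quad (- \<sigma>' l) (real k - 1) 0 (inward (snd l)) (snd l) \<xi>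
        \<le> V sb l - tpart tb sb sb - quad (- \<sigma>' l) (real k - 1) 0 (inward (snd l)) (snd l) (snd l)"
      unfolding \<Phi>_same coord(1)[OF *(3,4)] quad_def coord(2)[OF *(3,4), symmetric] x'_def[symmetric] time_part_def
      by (simp add: from_end_0 power2_commute[of s' tb] power2_commute[of sb tb] algebra_simps)
  qed
  show thesis
  proof (rule that)
    show "(tb - sb) / \<nu> + \<eta> / (T - tb)\<^sup>2 + network_hamiltonian G H p0 A tb n
      (\<lambda>l. \<alpha> * q l + quad' R' (real k) 0 (inward (snd l)) (snd l) (snd l)) \<le> 0"
      using q by (simp add: time_part'_def)
    show "(sb - tb) / \<nu> + \<eta> / (T - sb)\<^sup>2 \<le> network_hamiltonian G H p0 A sb n (\<lambda>i. inward (snd i) * (\<pi> i - 2 * \<alpha>))"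
    proof -
      have "(\<lambda>l. - quad' (- \<sigma>' l) (real k - 1) 0 (inward (snd l)) (snd l) (snd l)) = (\<lambda>i. inward (snd i) * (\<pi> i - 2 * \<alpha>))"
        by (rule ext) (simp add: quad'_def \<sigma>'_def algebra_simps)
      then show ?thesis using v by (simp add: time_part'_def)
    qed
  qed
qed

end


section \<open>The comparison principle\<close>

lemma modulus_small:
  assumes "modulus \<omega>" "0 < \<epsilon>"
  obtains r where "0 < r" "\<And>s. 0 \<le> s \<Longrightarrow> s \<le> r \<Longrightarrow> \<omega> s \<le> \<epsilon>"
proof -
  have m: "mono_on {0..} \<omega>" "(\<omega> \<longlongrightarrow> 0) (at_right 0)" using assms(1) by (auto simp: modulus_def)
  have "\<forall>\<^sub>F s in at_right 0. \<omega> s < \<epsilon>" using order_tendstoD(2)[OF m(2) assms(2)] .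
  then obtain b where b: "0 < b" "\<And>s. 0 < s \<Longrightarrow> s < b \<Longrightarrow> \<omega> s < \<epsilon>"
    unfolding eventually_at_right_field by blast
  show thesis
  proof (rule that[of "b / 2"])
    fix s :: real assume "0 \<le> s" "s \<le> b / 2"
    then have "\<omega> s \<le> \<omega> (b / 2)" using m(1) b(1) by (intro mono_onD[OF m(1)]) auto
    also have "\<dots> < \<epsilon>" using b by simp
    finally show "\<omega> s \<le> \<epsilon>" by simp
  qed (use b in simp)
qed

context network_graph
begin

text \<open>If \<open>H\<close> goes below \<open>\<kappa>\<close>, then by coercivity its decreasing branch passes through this level; otherwise the
  minimiser will do.\<close>

lemma critical_slope:
  assumes H: "H0 G H" "H1 G H" "H4 G H p0" and n: "n \<in> vertices G" "(e, c) \<in> n" and t: "t \<in> {0..T}" and T: "0 < T"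
  shows "\<exists>\<pi>. (\<forall>q\<le>\<pi>. \<kappa> \<le> H e t c (inward c * q)) \<and>
    (H e t c (p0 e t c) < \<kappa> \<longrightarrow> H e t c (inward c * \<pi>) = \<kappa>)"
proof -
  define h where "h q = H e t c (inward c * q)" for q
  have e: "e \<in> edges G" "c \<in> edge G e" using n vertex_subset endpoint_cases by blast+
  let ?p = "inward c * p0 e t c"
  have hp: "h ?p = H e t c (p0 e t c)" by (simp add: h_def inward_cancel)
  have mono: "h q' \<le> h q" if "q \<le> q'" "q' \<le> ?p" for q q'
  proof (cases "c = 0")
    case True
    then show ?thesis using H4_monotone(1)[OF H(3) n, of t q q'] t that by (simp add: h_def inward_def)
  next
    case False
    then show ?thesis using H4_monotone(2)[OF H(3) n, of t "- q'" "- q"] t that by (simp add: h_def inward_def)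
  qed
  show ?thesis
  proof (cases "h ?p < \<kappa>")
    case False
    then show ?thesis using mono[of _ ?p] hp by (intro exI[of _ ?p]) (fastforce simp: h_def)
  next
    case True
    obtain R where R: "\<And>q. R \<le> \<bar>q\<bar> \<Longrightarrow> \<kappa> \<le> H e t c q"
      using H(2) T e t unfolding H1_def by meson
    define q0 where "q0 = min ?p (- \<bar>R\<bar>)"
    have q0: "q0 \<le> ?p" "R \<le> \<bar>inward c * q0\<bar>" unfolding abs_inward by (auto simp: q0_def)
    have c: "continuous_on ({0..} \<times> edge G e \<times> UNIV) (\<lambda>(t, x, q). H e t x q)"
      using H(1) e by (auto simp: H0_def)
    have "continuous_on {q0..?p} (\<lambda>q. (\<lambda>(t, x, q). H e t x q) (t, c, inward c * q))"
      by (rule continuous_on_compose2[OF c]) (use e t in \<open>auto intro!: continuous_intros\<close>)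
    then have "continuous_on {q0..?p} h" by (simp add: h_def[abs_def])
    moreover have "h ?p \<le> \<kappa>" "\<kappa> \<le> h q0" using True R[OF q0(2)] by (auto simp: h_def)
    ultimately obtain \<pi> where \<pi>: "q0 \<le> \<pi>" "\<pi> \<le> ?p" "h \<pi> = \<kappa>"
      using IVT2'[of h ?p \<kappa> q0] q0(1) by blast
    then show ?thesis using mono[of _ \<pi>] by (intro exI[of _ \<pi>]) (auto simp: h_def)
  qed
qed

end

context penalised_maximum
begin

text \<open>The tests of \<open>U\<close> and \<open>V\<close> hold at levels that differ by \<open>2 \<theta>\<close>, at times \<open>tb\<close> and \<open>sb\<close> and with slopes that
  differ by at most \<open>2 \<alpha>\<close>; by assumption these discrepancies change \<open>H\<close> and \<open>A\<close> by no more than a fraction of the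
  gap. At a vertex the test of \<open>U\<close> with steep slopes bounds \<open>A\<close> and the minima of \<open>H\<close>, and the critical slopes in
  the test of \<open>V\<close> leave nothing else in the flux that could reach the upper level.\<close>

lemma no_penalised_maximum:
  assumes H4: "H4 G H p0" and \<theta>: "0 < \<theta>" "\<theta> \<le> \<eta> / (T - tb)\<^sup>2" "\<theta> \<le> \<eta> / (T - sb)\<^sup>2"
    and h5: "\<And>e x p. e \<in> edges G \<Longrightarrow> x \<in> edge G e \<Longrightarrow> H e tb x p \<le> - ((tb - sb) / \<nu>) \<Longrightarrow> H e sb x p \<le> H e tb x p + \<theta> / 2"
    and h3: "\<And>e x p q. e \<in> edges G \<Longrightarrow> x \<in> edge G e \<Longrightarrow> \<bar>p\<bar> \<le> L \<Longrightarrow> \<bar>q\<bar> \<le> L \<Longrightarrow> \<bar>p - q\<bar> \<le> 2 * \<alpha> \<Longrightarrow>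
        H e tb x p \<le> H e tb x q + \<theta> / 4"
    and hL: "\<And>e x q. e \<in> edges G \<Longrightarrow> x \<in> edge G e \<Longrightarrow> L - 1 \<le> \<bar>q\<bar> \<Longrightarrow> - ((tb - sb) / \<nu>) < H e tb x q"
    and hA: "\<And>n. n \<in> vertices G \<Longrightarrow> A n sb \<le> A n tb + \<theta>" and \<alpha>: "2 * \<alpha> \<le> 1"
  shows False
proof -
  define S where "S = (tb - sb) / \<nu>"
  have S: "(sb - tb) / \<nu> = - S" unfolding S_def by (simp add: minus_divide_left)
  have pos4: "0 < \<alpha>" using pos(4) .
  have transfer: "H e sb x p \<le> - S + \<theta> / 4"
    if e: "e \<in> edges G" "x \<in> edge G e" and q: "H e tb x q \<le> - S - \<theta> / 2" and pq: "\<bar>p - q\<bar> \<le> 2 * \<alpha>" for e x p q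
  proof -
    have "\<bar>q\<bar> < L - 1" using hL[OF e, of q] q \<theta>(1) unfolding S_def by linarith
    then have "\<bar>p\<bar> \<le> L" "\<bar>q\<bar> \<le> L" using pq \<alpha> by linarith+
    then have "H e tb x p \<le> - S - \<theta> / 4" using h3[OF e _ _ pq] q by fastforce
    moreover from this have "H e sb x p \<le> H e tb x p + \<theta> / 2" using \<theta>(1) by (intro h5[OF e]) (simp add: S_def)
    ultimately show ?thesis by linarith
  qed
  obtain e xb where ab_eq: "ab = (e, xb)" by force
  have e: "e \<in> edges G" "xb \<in> edge G e" using ab ab_eq by (auto simp: edge_points_def)
  consider "xb \<in> edge_interior G e" | "(e, xb) \<in> endpoints G" using edge_points_cases ab ab_eq by blast
  then show False
  proof cases
    case 1
    obtain p q where pq: "\<bar>q\<bar> \<le> 1" "(tb - sb) / \<nu> + \<eta> / (T - tb)\<^sup>2 + H e tb xb (p + \<alpha> * q) \<le> 0"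
      "(sb - tb) / \<nu> + \<eta> / (T - sb)\<^sup>2 \<le> H e sb xb p"
      using interior_maximum[OF ab_eq 1] by blast
    have "\<bar>p - (p + \<alpha> * q)\<bar> \<le> 2 * \<alpha>"
      using pq(1) pos4 mult_left_mono[of "\<bar>q\<bar>" 1 \<alpha>] by (simp add: abs_mult)
    moreover have "H e tb xb (p + \<alpha> * q) \<le> - S - \<theta> / 2" using pq(2) \<theta> by (simp add: S_def[symmetric])
    ultimately have "H e sb xb p \<le> - S + \<theta> / 4" using transfer[OF e] by blast
    then show False using pq(3) \<theta> unfolding S by linarith
  next
    case 2
    let ?n = "proj G ab"
    have n: "?n \<in> vertices G" "ab \<in> ?n" using endpoint_vertex 2 ab proj_mem ab_eq by auto
    let ?\<kappa> = "- S - \<theta> / 2"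
    have "\<forall>i\<in>?n. \<exists>\<pi>. (\<forall>q\<le>\<pi>. ?\<kappa> \<le> H (fst i) tb (snd i) (inward (snd i) * q)) \<and>
      (H (fst i) tb (snd i) (p0 (fst i) tb (snd i)) < ?\<kappa> \<longrightarrow> H (fst i) tb (snd i) (inward (snd i) * \<pi>) = ?\<kappa>)"
    proof
      fix i assume "i \<in> ?n"
      then have i: "(fst i, snd i) \<in> ?n" by simp
      show "\<exists>\<pi>. (\<forall>q\<le>\<pi>. ?\<kappa> \<le> H (fst i) tb (snd i) (inward (snd i) * q)) \<and>
        (H (fst i) tb (snd i) (p0 (fst i) tb (snd i)) < ?\<kappa> \<longrightarrow> H (fst i) tb (snd i) (inward (snd i) * \<pi>) = ?\<kappa>)"
        using tb by (intro critical_slope[OF H0 H1 H4 n(1) i _ T_pos]) auto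
    qed
    from bchoice[OF this] obtain \<pi> where \<pi>: "\<forall>i\<in>?n. (\<forall>q\<le>\<pi> i. ?\<kappa> \<le> H (fst i) tb (snd i) (inward (snd i) * q)) \<and>
      (H (fst i) tb (snd i) (p0 (fst i) tb (snd i)) < ?\<kappa> \<longrightarrow> H (fst i) tb (snd i) (inward (snd i) * \<pi> i) = ?\<kappa>)" ..
    have lev: "?\<kappa> \<le> H e' tb c (inward c * q)" if "(e', c) \<in> ?n" "q \<le> \<pi> (e', c)" for e' c q
      using \<pi>[rule_format, OF that(1)] that(2) by simp
    have "- ((tb - sb) / \<nu> + \<eta> / (T - tb)\<^sup>2) < ?\<kappa>" using \<theta> unfolding S_def[symmetric] by linarith
    then obtain q where q: "(tb - sb) / \<nu> + \<eta> / (T - tb)\<^sup>2 + network_hamiltonian G H p0 A tb ?n q \<le> 0"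
      "(sb - tb) / \<nu> + \<eta> / (T - sb)\<^sup>2 \<le> network_hamiltonian G H p0 A sb ?n (\<lambda>i. inward (snd i) * (\<pi> i - 2 * \<alpha>))"
      using vertex_maximum[OF n H4, of \<pi> ?\<kappa>] lev by blast
    let ?q = "\<lambda>i. inward (snd i) * (\<pi> i - 2 * \<alpha>)"
    have q1: "network_hamiltonian G H p0 A tb ?n q \<le> - S - \<theta>" using q(1) \<theta> unfolding S_def[symmetric] by linarith
    have q2: "- S + \<theta> \<le> network_hamiltonian G H p0 A sb ?n ?q" using q(2) \<theta> unfolding S by linarith
    from flux_bounds(3)[OF n(1), where A = A and t = sb and H = H and ?p0.0 = p0 and p = ?q]
    show False
    proof (elim disjE exE conjE)
      assume "network_hamiltonian G H p0 A sb ?n ?q = A ?n sb"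
      moreover have "A ?n tb \<le> - S - \<theta>"
        using flux_bounds(1)[OF n(1), where A = A and t = tb and H = H and ?p0.0 = p0 and p = q] q1 by linarith
      ultimately show False using q2 hA[OF n(1)] \<theta>(1) by linarith
    next
      fix e' c assume i: "(e', c) \<in> ?n"
        and eq: "network_hamiltonian G H p0 A sb ?n ?q = H e' sb c (clip c (p0 e' sb c) (?q (e', c)))"
      have E: "e' \<in> edges G" "c \<in> edge G e'" using i vertex_subset[OF n(1)] endpoint_cases by blast+
      have "H e' tb c (p0 e' tb c) \<le> H e' tb c (clip c (p0 e' tb c) (q (e', c)))"
        using H4_monotone(3)[OF H4 n(1) i] tb by simp
      also have "\<dots> \<le> - S - \<theta>"
        using flux_bounds(2)[OF n(1) i, where A = A and t = tb and H = H and ?p0.0 = p0 and p = q] q1 by linarith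
      also have "\<dots> < ?\<kappa>" using \<theta>(1) by simp
      finally have "H e' tb c (inward c * \<pi> (e', c)) \<le> - S - \<theta> / 2"
        using \<pi>[rule_format, OF i] by simp
      moreover have "inward c * (\<pi> (e', c) - 2 * \<alpha>) - inward c * \<pi> (e', c) = inward c * (- (2 * \<alpha>))"
        by (simp add: algebra_simps)
      then have "\<bar>inward c * (\<pi> (e', c) - 2 * \<alpha>) - inward c * \<pi> (e', c)\<bar> \<le> 2 * \<alpha>"
        using pos4 by (simp only: abs_inward)
      ultimately have "H e' sb c (inward c * (\<pi> (e', c) - 2 * \<alpha>)) \<le> - S + \<theta> / 4" using transfer[OF E] by blast
      moreover have "H e' sb c (clip c (p0 e' sb c) (?q (e', c))) \<le> H e' sb c (?q (e', c))"
        using H4_monotone(4)[OF H4 n(1) i] sb by simp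
      ultimately show False using eq q2 \<theta>(1) by simp
    qed
  qed
qed

end

text \<open>Otherwise \<open>M\<close> would drop by \<open>\<kappa>\<close> at each halving of \<open>\<nu>\<close> and become negative.\<close>

lemma small_increment:
  fixes M :: "real \<Rightarrow> real"
  assumes "\<And>\<nu>. 0 < \<nu> \<Longrightarrow> 0 \<le> M \<nu>" "0 < \<kappa>"
  obtains \<nu> where "0 < \<nu>" "\<nu> \<le> 1" "M (2 * \<nu>) \<le> M \<nu> + \<kappa>"
proof -
  have "\<exists>\<nu>. 0 < \<nu> \<and> \<nu> \<le> 1 \<and> M (2 * \<nu>) \<le> M \<nu> + \<kappa>"
  proof (rule ccontr)
    assume "\<not> ?thesis"
    then have big: "M \<nu> + \<kappa> < M (2 * \<nu>)" if "0 < \<nu>" "\<nu> \<le> 1" for \<nu> using that by (meson not_le)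
    have step: "M ((1/2) ^ k) + real k * \<kappa> \<le> M 1" for k
    proof (induction k)
      case (Suc k)
      have "M ((1/2) ^ Suc k) + \<kappa> < M (2 * (1/2) ^ Suc k)"
        by (rule big) (rule zero_less_power, simp, rule power_le_one, simp_all)
      then show ?case using Suc by (simp add: algebra_simps)
    qed simp
    obtain k where "M 1 < real k * \<kappa>" using reals_Archimedean3[OF assms(2)] by blast
    moreover have "0 \<le> M ((1/2) ^ k)" by (rule assms(1)) simp
    ultimately show False using step[of k] by linarith
  qed
  then show thesis using that by blast
qed

context network_graph
begin

text \<open>The maximum is penalised by \<open>(t - s)\<^sup>2 / 2 \<nu>\<close>, by \<open>\<eta> / (T - t) + \<eta> / (T - s)\<close>, which creates the gap \<open>2 \<theta>\<close> between the
  two equations, and by \<open>\<alpha> \<Lambda>\<close>. The order of the choices matters. A scale \<open>\<nu>\<close> at which the supremum \<open>M\<close> varies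
  little makes \<open>(t - s)\<^sup>2 / \<nu>\<close> small, as the time modulus of \<open>H\<close> demands. Once \<open>\<nu>\<close> is fixed, coercivity bounds
  all relevant slopes, and \<open>\<alpha>\<close> is chosen small for the modulus of \<open>H\<close> in bounded slopes.\<close>

lemma comparison:
  assumes H: "H0 G H" "H1 G H" "H2 G H" "H3 G H" "H4 G H p0" "H5 G H" and A: "A1 G A" "A2 G A"
    and u0: "uniformly_continuous_on_network G u0" and T: "0 < T"
    and u: "subsolution G H p0 A T u0 u" and w: "supersolution G H p0 A T u0 w"
    and C: "0 < C" and x0: "x0 \<in> network_points G"
    and growth_u: "\<And>t x. t \<in> {0..<T} \<Longrightarrow> x \<in> network_points G \<Longrightarrow> u t x \<le> C * (1 + network_dist G x0 x)"
    and growth_w: "\<And>t x. t \<in> {0..<T} \<Longrightarrow> x \<in> network_points G \<Longrightarrow> - C * (1 + network_dist G x0 x) \<le> w t x"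
    and t1: "t1 \<in> {0..<T}" and a1: "a1 \<in> edge_points G"
  shows "upper_env G T u t1 a1 + upper_env G T (\<lambda>t z. - w t z) t1 a1 \<le> 0"
proof (rule ccontr)
  let ?U = "upper_env G T u" and ?V = "upper_env G T (\<lambda>t z. - w t z)"
  assume "\<not> ?thesis"
  then have m0_pos: "0 < ?U t1 a1 + ?V t1 a1" by simp
  define m0 where "m0 = ?U t1 a1 + ?V t1 a1"
  have m0: "0 < m0" using m0_pos by (simp add: m0_def)
  have sub: "subsolution_interior G H p0 A T u" using u by (simp add: subsolution_def)
  have sup: "supersolution_interior G H p0 A T w" using w by (simp add: supersolution_def)
  have ub: "locally_bounded G T u" using sub by (simp add: subsolution_interior_def)
  have wb: "locally_bounded G T (\<lambda>t z. - w t z)"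
    using sup locally_bounded_uminus by (auto simp: supersolution_interior_def)
  have m32: "0 < m0 / 32" using m0 by simp
  obtain K1 where K1: "0 \<le> K1" "\<And>t a. t \<in> {0..<T} \<Longrightarrow> a \<in> edge_points G \<Longrightarrow> ?U t a \<le> u0 (proj G a) + m0 / 32 + K1 * t"
    using subsolution_barrier[OF H(1,3,5) A(1) T u0 u C x0 growth_u m32] by blast
  obtain K2 where K2: "0 \<le> K2" "\<And>t a. t \<in> {0..<T} \<Longrightarrow> a \<in> edge_points G \<Longrightarrow> ?V t a \<le> - u0 (proj G a) + m0 / 32 + K2 * t"
    using supersolution_barrier[OF H(1,3,5) A(1) T u0 w C x0 growth_w m32] by blast
  define K where "K = K1 + K2"
  have K: "0 \<le> K" using K1(1) K2(1) by (simp add: K_def)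
  have UV: "?U t a + ?V s a \<le> m0 / 16 + K * (t + s)" if ts: "t \<in> {0..<T}" "s \<in> {0..<T}" and a: "a \<in> edge_points G" for t s a
  proof -
    have "K1 * t \<le> K * t" "K2 * s \<le> K * s" using ts K1(1) K2(1) by (auto simp: K_def intro!: mult_right_mono)
    then show ?thesis using K1(2)[OF ts(1) a] K2(2)[OF ts(2) a] by (simp add: distrib_left)
  qed
  define B where "B = m0 / 16 + 2 * K * T"
  have B: "?U t a + ?V s a \<le> B" if ts: "t \<in> {0..<T}" "s \<in> {0..<T}" and a: "a \<in> edge_points G" for t s a
  proof -
    have "K * (t + s) \<le> K * (2 * T)" using ts K by (intro mult_left_mono) auto
    then show ?thesis using UV[OF ts a] by (simp add: B_def)
  qed
  define \<eta> where "\<eta> = m0 / 8 * (T - t1)"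
  have \<eta>: "0 < \<eta>" "\<eta> / (T - t1) = m0 / 8"
    using m0 t1 by (auto simp: \<eta>_def simp del: times_divide_eq_left)
  define \<theta> where "\<theta> = \<eta> / T\<^sup>2"
  have \<theta>: "0 < \<theta>" using \<eta>(1) T by (simp add: \<theta>_def)
  have \<theta>_le: "\<theta> \<le> \<eta> / (T - t)\<^sup>2" if "t \<in> {0..<T}" for t
    unfolding \<theta>_def using that \<eta>(1) T by (intro divide_left_mono power_mono mult_pos_pos) auto
  define \<Psi> where "\<Psi> \<nu> t s a = ?U t a + ?V s a - ((t - s)\<^sup>2 / (2 * \<nu>) + \<eta> / (T - t) + \<eta> / (T - s))" for \<nu> t s a
  define D where "D = {(t, s, a). t \<in> {0..<T} \<and> s \<in> {0..<T} \<and> a \<in> edge_points G}"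
  define M where "M \<nu> = Sup ((\<lambda>(t, s, a). \<Psi> \<nu> t s a) ` D)" for \<nu>
  have \<Psi>_B: "\<Psi> \<nu> t s a \<le> B" if "0 < \<nu>" "t \<in> {0..<T}" "s \<in> {0..<T}" "a \<in> edge_points G" for \<nu> t s a
  proof -
    have "0 \<le> (t - s)\<^sup>2 / (2 * \<nu>)" "0 \<le> \<eta> / (T - t)" "0 \<le> \<eta> / (T - s)" using that \<eta>(1) by auto
    then show ?thesis using B[OF that(2-4)] unfolding \<Psi>_def by linarith
  qed
  have bdd: "bdd_above ((\<lambda>(t, s, a). \<Psi> \<nu> t s a) ` D)" if "0 < \<nu>" for \<nu>
    using \<Psi>_B[OF that] by (intro bdd_aboveI2[where M = B]) (auto simp: D_def)
  have \<Psi>_M: "\<Psi> \<nu> t s a \<le> M \<nu>" if "0 < \<nu>" "t \<in> {0..<T}" "s \<in> {0..<T}" "a \<in> edge_points G" for \<nu> t s a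
  proof -
    have "(t, s, a) \<in> D" using that by (simp add: D_def)
    then have "\<Psi> \<nu> t s a \<in> (\<lambda>(t, s, a). \<Psi> \<nu> t s a) ` D" by (rule image_eqI[rotated]) simp
    then show ?thesis unfolding M_def by (rule cSup_upper[OF _ bdd[OF that(1)]])
  qed
  have \<Psi>_1: "\<Psi> \<nu> t1 t1 a1 = 3 * m0 / 4" for \<nu> unfolding \<Psi>_def \<eta>(2) m0_def[symmetric] by simp
  have M_low: "3 * m0 / 4 \<le> M \<nu>" if "0 < \<nu>" for \<nu> using \<Psi>_M[OF that t1 t1 a1] by (simp only: \<Psi>_1)
  obtain \<omega>5 where \<omega>5: "modulus \<omega>5" "\<And>e x t s p. e \<in> edges G \<Longrightarrow> x \<in> edge G e \<Longrightarrow> t \<in> {0..T} \<Longrightarrow> s \<in> {0..T} \<Longrightarrow>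
      H e t x p - H e s x p \<le> \<omega>5 (\<bar>t - s\<bar> * (1 + max (H e s x p) 0))"
    using H(6) T unfolding H5_def by meson
  obtain \<omega>A where \<omega>A: "modulus \<omega>A" "\<And>n t s. n \<in> vertices G \<Longrightarrow> t \<in> {0..T} \<Longrightarrow> s \<in> {0..T} \<Longrightarrow> \<bar>A n t - A n s\<bar> \<le> \<omega>A \<bar>t - s\<bar>"
    using A(2) T unfolding A2_def by meson
  have \<theta>2: "0 < \<theta> / 2" and \<theta>4: "0 < \<theta> / 4" using \<theta> by auto
  obtain r5 where r5: "0 < r5" "\<And>s. 0 \<le> s \<Longrightarrow> s \<le> r5 \<Longrightarrow> \<omega>5 s \<le> \<theta> / 2"
    using modulus_small[OF \<omega>5(1) \<theta>2] by blast
  obtain rA where rA: "0 < rA" "\<And>s. 0 \<le> s \<Longrightarrow> s \<le> rA \<Longrightarrow> \<omega>A s \<le> \<theta>"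
    using modulus_small[OF \<omega>A(1) \<theta>] by blast
  \<comment> \<open>\<open>\<delta>\<close> bounds the distance of the two times at the maximum. Its four bounds serve the time modulus of \<open>H\<close>, that of \<open>A\<close>,
    the exclusion of the initial time, and \<open>\<delta>\<^sup>2 \<le> \<delta>\<close>.\<close>
  define \<delta> where "\<delta> = min (min (r5 / 2) rA) (min (m0 / (16 * (K + 1))) 1)"
  have \<delta>: "0 < \<delta>" "\<delta> \<le> r5 / 2" "\<delta> \<le> rA" "\<delta> \<le> m0 / (16 * (K + 1))" "\<delta> \<le> 1"
  proof -
    show "0 < \<delta>" using r5(1) rA(1) m0 K by (simp add: \<delta>_def)
    show "\<delta> \<le> r5 / 2" "\<delta> \<le> rA" "\<delta> \<le> m0 / (16 * (K + 1))" "\<delta> \<le> 1"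
      unfolding \<delta>_def by (simp_all only: min_le_iff_disj order_refl simp_thms)
  qed
  define \<kappa> where "\<kappa> = min (m0 / 8) (\<delta>\<^sup>2 / 8)"
  have \<kappa>: "0 < \<kappa>" "\<kappa> \<le> m0 / 8" "8 * \<kappa> \<le> \<delta>\<^sup>2" 
  proof -
    have "\<kappa> \<le> \<delta>\<^sup>2 / 8" unfolding \<kappa>_def by (rule min.cobounded2)
    then show "8 * \<kappa> \<le> \<delta>\<^sup>2" by simp
    show "0 < \<kappa>" using m0 \<delta>(1) by (simp add: \<kappa>_def)
    show "\<kappa> \<le> m0 / 8" unfolding \<kappa>_def by (rule min.cobounded1)
  qed
  have "0 \<le> M \<nu>" if "0 < \<nu>" for \<nu> using M_low[OF that] m0 by linarith
  then obtain \<nu> where \<nu>: "0 < \<nu>" "\<nu> \<le> 1" "M (2 * \<nu>) \<le> M \<nu> + \<kappa>" using small_increment[OF _ \<kappa>(1)] by blast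
  obtain R where R: "\<And>e x t q. e \<in> edges G \<Longrightarrow> x \<in> edge G e \<Longrightarrow> t \<in> {0..T} \<Longrightarrow> R \<le> \<bar>q\<bar> \<Longrightarrow> \<delta> / \<nu> + 1 \<le> H e t x q"
    using H(2) T unfolding H1_def by meson
  define L where "L = \<bar>R\<bar> + 1"
  have L: "0 < L" "R \<le> L - 1" by (auto simp: L_def)
  obtain \<omega>3 where \<omega>3: "modulus \<omega>3" "\<And>e x t p q. e \<in> edges G \<Longrightarrow> x \<in> edge G e \<Longrightarrow> t \<in> {0..T} \<Longrightarrow> \<bar>p\<bar> \<le> L \<Longrightarrow> \<bar>q\<bar> \<le> L \<Longrightarrow>
      \<bar>H e t x p - H e t x q\<bar> \<le> \<omega>3 \<bar>p - q\<bar>"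
    using H(4) T L(1) unfolding H3_def by meson
  obtain r3 where r3: "0 < r3" "\<And>s. 0 \<le> s \<Longrightarrow> s \<le> r3 \<Longrightarrow> \<omega>3 s \<le> \<theta> / 4"
    using modulus_small[OF \<omega>3(1) \<theta>4] by blast
  have "(\<lambda>(t, s, a). \<Psi> \<nu> t s a) ` D \<noteq> {}" using t1 a1 by (auto simp: D_def)
  moreover have "M \<nu> - \<kappa> / 2 < Sup ((\<lambda>(t, s, a). \<Psi> \<nu> t s a) ` D)" using \<kappa>(1) by (simp add: M_def)
  ultimately obtain v where "v \<in> (\<lambda>(t, s, a). \<Psi> \<nu> t s a) ` D" "M \<nu> - \<kappa> / 2 < v" using less_cSupE by blast
  then obtain t2 s2 a2 where z2: "t2 \<in> {0..<T}" "s2 \<in> {0..<T}" "a2 \<in> edge_points G" "M \<nu> - \<kappa> / 2 < \<Psi> \<nu> t2 s2 a2"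
    by (auto simp: D_def)
  let ?Z = "proj G a1"
  have Z: "?Z \<in> network_points G" using proj_network_point[OF a1] .
  let ?\<Lambda> = "\<lambda>a. soft 1 (walk_dist G ?Z a)"
  have \<Lambda>0: "0 \<le> ?\<Lambda> a" for a by (rule soft_nonneg) simp
  define \<alpha> where "\<alpha> = min (min (1/2) (r3 / 2)) (\<kappa> / (2 * (?\<Lambda> a2 + 1)))"
  have \<alpha>: "0 < \<alpha>" "2 * \<alpha> \<le> 1" "2 * \<alpha> \<le> r3" "\<alpha> \<le> \<kappa> / (2 * (?\<Lambda> a2 + 1))"
  proof -
    have "\<alpha> \<le> 1/2" "\<alpha> \<le> r3 / 2" "\<alpha> \<le> \<kappa> / (2 * (?\<Lambda> a2 + 1))"
      unfolding \<alpha>_def by (simp_all only: min_le_iff_disj order_refl simp_thms)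
    then show "2 * \<alpha> \<le> 1" "2 * \<alpha> \<le> r3" "\<alpha> \<le> \<kappa> / (2 * (?\<Lambda> a2 + 1))" by (simp_all only: le_divide_eq_numeral1 mult.commute)
    have "0 < ?\<Lambda> a2 + 1" using \<Lambda>0[of a2] by linarith
    then show "0 < \<alpha>" using r3(1) \<kappa>(1) by (simp add: \<alpha>_def)
  qed
  have "\<alpha> * ?\<Lambda> a2 \<le> \<kappa> / 2"
  proof -
    have "\<alpha> * (2 * (?\<Lambda> a2 + 1)) \<le> \<kappa>" using \<alpha>(4) \<Lambda>0[of a2] by (simp add: pos_le_divide_eq)
    then show ?thesis using \<alpha>(1) by (simp add: algebra_simps)
  qed
  \<comment> \<open>A near-optimal point for \<open>\<Psi>\<close> shows that the localising term costs at most \<open>\<kappa> / 2\<close>.\<close>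
  define F where "F p a = \<Psi> \<nu> (fst p) (snd p) a - \<alpha> * ?\<Lambda> a" for p a
  define f1 where "f1 = F (t2, s2) a2"
  have f1: "M \<nu> - \<kappa> \<le> f1" using z2(4) \<open>\<alpha> * ?\<Lambda> a2 \<le> \<kappa> / 2\<close> by (simp add: f1_def F_def)
  have f1_pos: "m0 / 2 \<le> f1" using f1 M_low[OF \<nu>(1)] \<kappa>(2) m0 by linarith
  have B0: "0 < B" using m0 K T by (simp add: B_def add_pos_nonneg)
  define \<tau> where "\<tau> = \<eta> / B"
  have \<tau>: "0 < \<tau>" using \<eta>(1) B0 by (simp add: \<tau>_def)
  define \<R> where "\<R> = B / \<alpha> + 1"
  have region: "t \<le> T - \<tau>" "s \<le> T - \<tau>" "walk_dist G ?Z a \<le> \<R>"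
    if ts: "t \<in> {0..<T}" "s \<in> {0..<T}" and a: "a \<in> edge_points G" and F: "f1 \<le> F (t, s) a" for t s a
  proof -
    have nn: "0 \<le> (t - s)\<^sup>2 / (2 * \<nu>)" "0 \<le> \<eta> / (T - t)" "0 \<le> \<eta> / (T - s)" "0 \<le> \<alpha> * ?\<Lambda> a"
      using ts \<nu>(1) \<eta>(1) \<alpha>(1) \<Lambda>0[of a] by auto
    have b: "\<eta> / (T - t) \<le> B" "\<eta> / (T - s) \<le> B" "\<alpha> * ?\<Lambda> a \<le> B"
      using F f1_pos m0 B[OF ts a] nn unfolding F_def \<Psi>_def by auto
    have late: "q \<le> T - \<tau>" if "q < T" "\<eta> / (T - q) \<le> B" for q
    proof -
      have "\<eta> \<le> B * (T - q)" using that by (simp add: pos_divide_le_eq)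
      then have "\<tau> \<le> T - q" using B0 by (simp add: \<tau>_def pos_divide_le_eq mult.commute)
      then show ?thesis by simp
    qed
    show "t \<le> T - \<tau>" "s \<le> T - \<tau>" using late b ts by auto
    have "?\<Lambda> a \<le> B / \<alpha>" using b(3) \<alpha>(1) by (simp add: pos_le_divide_eq mult.commute)
    then show "walk_dist G ?Z a \<le> \<R>" using soft_ge[of "walk_dist G ?Z a" 1] by (simp add: \<R>_def)
  qed
  let ?P = "{0..T - \<tau>} \<times> {0..T - \<tau>}"
  have P: "compact ?P" by (intro compact_Times compact_Icc)
  have F_usc: "usc_on (?P \<times> edge G e) (\<lambda>q. F (fst q) (e, snd q))" if e: "e \<in> edges G" for e
  proof -
    let ?Q = "?P \<times> edge G e"
    have "continuous_on ?Q (\<lambda>q. ?\<Lambda> (e, snd q))"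
      by (rule continuous_on_compose2[OF soft_dist_continuous[OF Z _ e]]) (auto intro!: continuous_intros)
    moreover have "\<forall>q\<in>?Q. T - fst (fst q) \<noteq> 0" "\<forall>q\<in>?Q. T - snd (fst q) \<noteq> 0" using \<tau> by auto
    ultimately have r: "continuous_on ?Q (\<lambda>q. ((fst (fst q) - snd (fst q))\<^sup>2 / (2 * \<nu>) + \<eta> / (T - fst (fst q)) + \<eta> / (T - snd (fst q))) + \<alpha> * ?\<Lambda> (e, snd q))"
      using \<nu>(1) by (intro continuous_intros) auto
    have f: "continuous_on ?Q (\<lambda>q. (fst (fst q), snd q))" "(\<lambda>q. (fst (fst q), snd q)) ` ?Q \<subseteq> {0..<T} \<times> edge G e"
      "continuous_on ?Q (\<lambda>q. (snd (fst q), snd q))" "(\<lambda>q. (snd (fst q), snd q)) ` ?Q \<subseteq> {0..<T} \<times> edge G e"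
      using \<tau> by (auto intro!: continuous_intros)
    from doubled_usc[OF ub wb e e f r] show ?thesis by (simp add: F_def \<Psi>_def algebra_simps)
  qed
  have f1_F: "f1 \<le> F (t2, s2) a2" by (simp add: f1_def)
  have z2P: "(t2, s2) \<in> ?P" "walk_dist G ?Z a2 \<le> \<R>" using region[OF z2(1-3) f1_F] z2(1,2) by auto
  obtain p ab where pab: "p \<in> ?P" "ab \<in> edge_points G" "walk_dist G ?Z ab \<le> \<R>"
    "\<And>q b. q \<in> ?P \<Longrightarrow> b \<in> edge_points G \<Longrightarrow> walk_dist G ?Z b \<le> \<R> \<Longrightarrow> F q b \<le> F p ab"
    using attains_max_sublevel[where F = F, OF Z P F_usc z2P(1) z2(3) z2P(2)] by metis
  define tb sb where "tb = fst p" and "sb = snd p"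
  have p: "p = (tb, sb)" by (simp add: tb_def sb_def)
  have bars: "tb \<in> {0..<T}" "sb \<in> {0..<T}" using pab(1) \<tau> by (auto simp: p)
  have val: "f1 \<le> F (tb, sb) ab" using pab(4)[OF z2P(1) z2(3) z2P(2)] by (simp add: f1_def p)
  have max: "F (t, s) a \<le> F (tb, sb) ab" if ts: "t \<in> {0..<T}" "s \<in> {0..<T}" "a \<in> edge_points G" for t s a
  proof (cases "f1 \<le> F (t, s) a")
    case True
    then show ?thesis using pab(4)[of "(t, s)" a] region[OF ts True] ts by (simp add: p)
  next
    case False
    then show ?thesis using val by simp
  qed
  have "f1 \<le> \<Psi> \<nu> tb sb ab"
    using val mult_nonneg_nonneg[OF less_imp_le[OF \<alpha>(1)] \<Lambda>0[of ab]] by (simp add: F_def)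
  then have near: "M \<nu> - \<kappa> \<le> \<Psi> \<nu> tb sb ab" "m0 / 2 \<le> \<Psi> \<nu> tb sb ab" using f1 f1_pos by auto
  have "\<Psi> (2 * \<nu>) tb sb ab = \<Psi> \<nu> tb sb ab + (tb - sb)\<^sup>2 / (4 * \<nu>)"
    unfolding \<Psi>_def using \<nu>(1) by (simp add: field_simps)
  then have "(tb - sb)\<^sup>2 / (4 * \<nu>) \<le> 2 * \<kappa>"
    using \<Psi>_M[of "2 * \<nu>", OF _ bars pab(2)] \<nu>(1,3) near(1) by simp
  then have sq: "(tb - sb)\<^sup>2 \<le> 8 * \<kappa> * \<nu>" using \<nu>(1) by (simp add: pos_divide_le_eq)
  have sq_le: "8 * \<kappa> * \<nu> \<le> \<delta>\<^sup>2 * \<nu>" using \<kappa>(3) \<nu>(1) by (intro mult_right_mono) auto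
  also have "\<delta>\<^sup>2 * \<nu> \<le> \<delta>\<^sup>2" using \<nu> by (intro mult_left_le) auto
  finally have "(tb - sb)\<^sup>2 \<le> \<delta>\<^sup>2" using sq by simp
  then have dist_ts: "\<bar>tb - sb\<bar> \<le> \<delta>" using \<delta>(1) by (simp add: abs_le_square_iff[symmetric])
  have speed: "\<bar>tb - sb\<bar> * (\<bar>tb - sb\<bar> / \<nu>) \<le> \<delta>\<^sup>2"
  proof -
    have "\<bar>tb - sb\<bar> * (\<bar>tb - sb\<bar> / \<nu>) = (tb - sb)\<^sup>2 / \<nu>" by (simp add: power2_eq_square abs_mult[symmetric])
    also have "\<dots> \<le> \<delta>\<^sup>2" using order_trans[OF sq sq_le] \<nu>(1) by (simp only: pos_divide_le_eq)
    finally show ?thesis .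
  qed
  \<comment> \<open>If one of the times were \<open>0\<close>, the other would be at most \<open>\<delta>\<close>, and \<open>U + V\<close> too small by the barriers.\<close>
  have "tb \<noteq> 0 \<and> sb \<noteq> 0"
  proof (rule ccontr)
    assume "\<not> ?thesis"
    then have "tb + sb = \<bar>tb - sb\<bar>" using bars by auto
    then have "K * (tb + sb) \<le> K * \<delta>" using dist_ts K by (simp add: mult_left_mono)
    also have "\<dots> \<le> (K + 1) * (m0 / (16 * (K + 1)))" using \<delta>(1,4) K by (intro mult_mono) auto
    also have "\<dots> = m0 / 16" using K by (simp add: field_simps)
    finally have "?U tb ab + ?V sb ab \<le> m0 / 8" using UV[OF bars pab(2)] by simp
    moreover have "0 \<le> (tb - sb)\<^sup>2 / (2 * \<nu>)" "0 \<le> \<eta> / (T - tb)" "0 \<le> \<eta> / (T - sb)" using bars \<nu>(1) \<eta>(1) by auto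
    ultimately show False using near(2) m0 unfolding \<Psi>_def by linarith
  qed
  then have bars': "tb \<in> {0<..<T}" "sb \<in> {0<..<T}" "tb \<in> {0..T}" "sb \<in> {0..T}" using bars by auto
  interpret penalised_maximum G H p0 A T u w ?Z 1 \<nu> \<eta> \<alpha> tb sb ab
    using sub sup H(1,2) Z \<nu>(1) \<eta>(1) \<alpha>(1) bars'(1,2) pab(2) max
    by unfold_locales (auto simp: F_def \<Psi>_def)
  have S: "\<bar>(tb - sb) / \<nu>\<bar> \<le> \<delta> / \<nu>" using dist_ts \<nu>(1) by (simp add: abs_divide divide_right_mono)
  show False
  proof (rule no_penalised_maximum[OF H(5) \<theta> \<theta>_le[OF bars(1)] \<theta>_le[OF bars(2)], of L])
    fix e x q assume e: "e \<in> edges G" "x \<in> edge G e"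
    show "- ((tb - sb) / \<nu>) < H e tb x q" if "L - 1 \<le> \<bar>q\<bar>"
    proof -
      have "\<delta> / \<nu> + 1 \<le> H e tb x q" using R[OF e bars'(3), of q] that L(2) by linarith
      then show ?thesis using S by linarith
    qed
    show "H e sb x q \<le> H e tb x q + \<theta> / 2" if le: "H e tb x q \<le> - ((tb - sb) / \<nu>)"
    proof -
      have "max (H e tb x q) 0 \<le> \<bar>tb - sb\<bar> / \<nu>"
        using le \<nu>(1) abs_ge_minus_self[of "(tb - sb) / \<nu>"] by (simp add: abs_divide)
      then have "\<bar>sb - tb\<bar> * (1 + max (H e tb x q) 0) \<le> \<bar>tb - sb\<bar> * (1 + \<bar>tb - sb\<bar> / \<nu>)"
        by (intro mult_mono) auto
      also have "\<dots> = \<bar>tb - sb\<bar> + \<bar>tb - sb\<bar> * (\<bar>tb - sb\<bar> / \<nu>)" by (simp only: distrib_left mult_1_right)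
      also have "\<dots> \<le> \<delta> + \<delta>\<^sup>2" using dist_ts speed by simp
      also have "\<delta>\<^sup>2 \<le> \<delta>" using \<delta>(1,5) by (simp add: power2_eq_square mult_left_le)
      also have "\<delta> + \<delta> \<le> r5" using \<delta>(2) by simp
      finally have "\<omega>5 (\<bar>sb - tb\<bar> * (1 + max (H e tb x q) 0)) \<le> \<theta> / 2" by (intro r5(2)) auto
      then show ?thesis using \<omega>5(2)[OF e bars'(4,3), of q] by linarith
    qed
  next
    fix e x p q assume e: "e \<in> edges G" "x \<in> edge G e" and pq: "\<bar>p\<bar> \<le> L" "\<bar>q\<bar> \<le> L" "\<bar>p - q\<bar> \<le> 2 * \<alpha>"
    have "\<omega>3 \<bar>p - q\<bar> \<le> \<theta> / 4" using pq(3) \<alpha>(3) by (intro r3(2)) auto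
    then show "H e tb x p \<le> H e tb x q + \<theta> / 4" using \<omega>3(2)[OF e bars'(3) pq(1,2)] by (simp add: abs_le_iff)
  next
    fix n assume n: "n \<in> vertices G"
    have "\<omega>A \<bar>sb - tb\<bar> \<le> \<theta>" using dist_ts \<delta>(3) by (intro rA(2)) (auto simp: abs_minus_commute)
    then show "A n sb \<le> A n tb + \<theta>" using \<omega>A(2)[OF n bars'(4,3)] by (simp add: abs_le_iff)
  qed (use \<alpha>(2) in simp)
qed

end

theorem theorem5p8:
  fixes G :: "'e network"
    and H :: "'e \<Rightarrow> real \<Rightarrow> real \<Rightarrow> real \<Rightarrow> real"
    and p0 :: "'e \<Rightarrow> real \<Rightarrow> real \<Rightarrow> real"
    and A :: "'e point \<Rightarrow> real \<Rightarrow> real"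
    and u0 :: "'e point \<Rightarrow> real"
    and u w :: "real \<Rightarrow> 'e point \<Rightarrow> real"
    and T C :: real
    and x0 :: "'e point"
  assumes "is_network G"
    and "H0 G H" and "H1 G H" and "H2 G H" and "H3 G H"
    and "H4 G H p0" and "H5 G H" and "H6 G H p0"
    and "A0 G A" and "A1 G A" and "A2 G A"
    and "uniformly_continuous_on_network G u0"
    and "T > 0"
    and "subsolution G H p0 A T u0 u"
    and "supersolution G H p0 A T u0 w"
    and "C > 0" and "x0 \<in> network_points G"
    and "\<And>t x. t \<in> {0..<T} \<Longrightarrow> x \<in> network_points G \<Longrightarrow>
           u t x \<le> C * (1 + network_dist G x0 x)"
    and "\<And>t x. t \<in> {0..<T} \<Longrightarrow> x \<in> network_points G \<Longrightarrow>
           w t x \<ge> - C * (1 + network_dist G x0 x)"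
  shows "\<forall>t \<in> {0..<T}. \<forall>x \<in> network_points G. u t x \<le> w t x"
proof (intro ballI)
  interpret network_graph G using assms(1) by (rule network_graph.intro)
  fix t x assume t: "t \<in> {0..<T}" and x: "x \<in> network_points G"
  obtain a where "a \<in> x" using network_point_nonempty[OF x] by blast
  then have a: "a \<in> edge_points G" "proj G a = x" using network_point_subset[OF x] network_point_proj[OF x] by auto
  have ub: "locally_bounded G T u" using assms(14) by (simp add: subsolution_def subsolution_interior_def)
  have wb: "locally_bounded G T (\<lambda>t z. - w t z)"
    using assms(15) locally_bounded_uminus by (auto simp: supersolution_def supersolution_interior_def)
  have "upper_env G T u t a + upper_env G T (\<lambda>t z. - w t z) t a \<le> 0"
    by (rule comparison[OF assms(2-7) assms(10-17) assms(18,19) t a(1)])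
  then show "u t x \<le> w t x"
    using upper_env_ge[OF ub t a(1)] upper_env_ge[OF wb t a(1)] a(2) by simp
qed

end
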